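(* Let $n\ge 2$, let $\kappa$ be the unique integer with $\binom{\kappa}{2}<n\le\binom{\kappa+1}{2}$, and put $\Lambda_n=n\kappa-\binom{\kappa}{2}-1$. Let $A(z,\bar z)$ be a Hermitian polynomial on $\mathbb C^n$ such that $A(z,\bar z)\|z\|^2\in\mathrm{SOS}_n$, and let $\rho$ be the rank of $A(z,\bar z)\|z\|^2$. Then either $\rho\ge\Lambda_n$, or there is some $k\in\{0,\dots,\kappa-1\}$ with $$kn-\frac{k(k-1)}{2}\le\rho\le kn .$$
   Context: A Hermitian polynomial on $\mathbb C^n$ is a real-valued polynomial $A(z,\bar z)=\sum_{\alpha,\beta}c_{\alpha\beta}z^\alpha\bar z^\beta$ (finite sum over multi-indices, $c_{\beta\alpha}=\overline{c_{\alpha\beta}}$). Its rank is the rank of the Hermitian coefficient matrix $(c_{\alpha\beta})$. Write $A\in\mathrm{SOS}_n$ if $A(z,\bar z)=\sum_{\mu=1}^m|f_\mu(z)|^2$ for finitely many holomorphic polynomials $f_\mu\in\mathbb C[z_1,\dots,z_n]$ (the zero polynomial is in $\mathrm{SOS}_n$). $\|z\|^2=\sum_{j=1}^n|z_j|^2$. *)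

theory Defs
  imports
    "HOL-Analysis.Analysis"
    "HOL-Library.Poly_Mapping"
    "HOL-Library.Product_Plus"
    "HOL-Library.Function_Algebras"
begin

section \<open>Polynomials in \<open>z\<^sub>0, \<dots>, z\<^sub>n\<^sub>-\<^sub>1\<close> and their conjugates\<close>

text \<open>
  A multi-index is a finitely supported exponent function. A polynomial in \<open>z\<close> and its conjugate
  is the finitely supported family of its coefficients \<open>c\<^sub>\<alpha>\<^sub>\<beta>\<close>, indexed by pairs
  \<open>(\<alpha>, \<beta>)\<close>; the product of the type \<^typ>\<open>_ \<Rightarrow>\<^sub>0 _\<close> is the convolution, that is,
  multiplication of polynomials. The number of variables is not part of the types:
  \<open>n\<close>-variable objects only involve the variables with index in \<^term>\<open>{..<n}\<close>. Points are functions
  \<^typ>\<open>nat \<Rightarrow> complex\<close> of which only the coordinates with index in \<^term>\<open>{..<n}\<close> matter.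
\<close>

type_synonym multi_index = "nat \<Rightarrow>\<^sub>0 nat"
type_synonym hol_poly = "multi_index \<Rightarrow>\<^sub>0 complex"
type_synonym bi_poly = "(multi_index \<times> multi_index) \<Rightarrow>\<^sub>0 complex"

definition multi_indices :: "nat \<Rightarrow> multi_index set" where
  "multi_indices n = {\<alpha>. Poly_Mapping.keys \<alpha> \<subseteq> {..<n}}"

definition hol_polys :: "nat \<Rightarrow> hol_poly set" where
  "hol_polys n = {f. Poly_Mapping.keys f \<subseteq> multi_indices n}"

definition hermitian_polys :: "nat \<Rightarrow> bi_poly set" where
  "hermitian_polys n = {A. Poly_Mapping.keys A \<subseteq> multi_indices n \<times> multi_indices n \<and>
     (\<forall>\<alpha> \<beta>. Poly_Mapping.lookup A (\<beta>, \<alpha>) = cnj (Poly_Mapping.lookup A (\<alpha>, \<beta>)))}"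

definition eval_monom :: "multi_index \<Rightarrow> (nat \<Rightarrow> complex) \<Rightarrow> complex" where
  "eval_monom \<alpha> z = (\<Prod>j\<in>Poly_Mapping.keys \<alpha>. z j ^ Poly_Mapping.lookup \<alpha> j)"

definition eval_hol :: "hol_poly \<Rightarrow> (nat \<Rightarrow> complex) \<Rightarrow> complex" where
  "eval_hol f z = (\<Sum>\<alpha>\<in>Poly_Mapping.keys f. Poly_Mapping.lookup f \<alpha> * eval_monom \<alpha> z)"

definition eval_bi :: "bi_poly \<Rightarrow> (nat \<Rightarrow> complex) \<Rightarrow> complex" where
  "eval_bi A z =
     (\<Sum>(\<alpha>, \<beta>)\<in>Poly_Mapping.keys A. Poly_Mapping.lookup A (\<alpha>, \<beta>) * eval_monom \<alpha> z * cnj (eval_monom \<beta> z))"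

definition SOS :: "nat \<Rightarrow> bi_poly set" where
  "SOS n = {A. \<exists>(m::nat) f. (\<forall>\<mu><m. f \<mu> \<in> hol_polys n) \<and>
     (\<forall>z. eval_bi A z = of_real (\<Sum>\<mu><m. (cmod (eval_hol (f \<mu>) z))\<^sup>2))}"

text \<open>The polynomial \<open>\<parallel>z\<parallel>\<^sup>2\<close>; see \<open>eval_bi_norm_sq\<close> below.\<close>

definition norm_sq_poly :: "nat \<Rightarrow> bi_poly" where
  "norm_sq_poly n =
     (\<Sum>j<n. Poly_Mapping.single (Poly_Mapping.single j 1, Poly_Mapping.single j 1) 1)"

text \<open>
  The coefficient matrix is indexed by all multi-indices but has only finitely many nonzero
  entries; its rank is the complex dimension of its column space.
\<close>

definition cscale :: "complex \<Rightarrow> (multi_index \<Rightarrow> complex) \<Rightarrow> multi_index \<Rightarrow> complex" where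
  "cscale c v = (\<lambda>\<alpha>. c * v \<alpha>)"

global_interpretation coeff_vs: vector_space cscale
  by unfold_locales (auto simp: cscale_def fun_eq_iff algebra_simps)

definition coeff_column :: "bi_poly \<Rightarrow> multi_index \<Rightarrow> (multi_index \<Rightarrow> complex)" where
  "coeff_column A \<beta> = (\<lambda>\<alpha>. Poly_Mapping.lookup A (\<alpha>, \<beta>))"

definition hrank :: "bi_poly \<Rightarrow> nat" where
  "hrank A = coeff_vs.dim (range (coeff_column A))"


section \<open>Compatibility of the formal operations with evaluation\<close>

lemma eval_monom_superset:
  "finite S \<Longrightarrow> Poly_Mapping.keys \<alpha> \<subseteq> S \<Longrightarrow> eval_monom \<alpha> z = (\<Prod>j\<in>S. z j ^ Poly_Mapping.lookup \<alpha> j)"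
  unfolding eval_monom_def by (rule prod.mono_neutral_left) (auto simp: in_keys_iff)

lemma eval_monom_add: "eval_monom (\<alpha> + \<beta>) z = eval_monom \<alpha> z * eval_monom \<beta> z"
proof -
  let ?S = "Poly_Mapping.keys \<alpha> \<union> Poly_Mapping.keys \<beta>"
  have "Poly_Mapping.keys (\<alpha> + \<beta>) \<subseteq> ?S" by (rule Poly_Mapping.keys_add)
  then show ?thesis
    by (simp add: eval_monom_superset[of ?S] lookup_add power_add prod.distrib)
qed

lemma eval_bi_superset:
  assumes "finite S" "Poly_Mapping.keys A \<subseteq> S"
  shows "eval_bi A z =
    (\<Sum>(\<alpha>, \<beta>)\<in>S. Poly_Mapping.lookup A (\<alpha>, \<beta>) * eval_monom \<alpha> z * cnj (eval_monom \<beta> z))"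
  unfolding eval_bi_def
  by (rule sum.mono_neutral_left) (use assms in \<open>auto simp: in_keys_iff\<close>)

lemma eval_bi_add: "eval_bi (A + B) z = eval_bi A z + eval_bi B z"
proof -
  let ?S = "Poly_Mapping.keys A \<union> Poly_Mapping.keys B"
  have "Poly_Mapping.keys (A + B) \<subseteq> ?S" by (rule Poly_Mapping.keys_add)
  then show ?thesis
    by (simp add: eval_bi_superset[of ?S] lookup_add sum.distrib[symmetric] case_prod_unfold
        algebra_simps)
qed

lemma eval_bi_zero [simp]: "eval_bi 0 z = 0"
  by (simp add: eval_bi_def)

lemma eval_bi_sum: "eval_bi (sum F I) z = (\<Sum>i\<in>I. eval_bi (F i) z)"
  by (induction I rule: infinite_finite_induct) (auto simp: eval_bi_add)

lemma eval_bi_single: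
  "eval_bi (Poly_Mapping.single (\<alpha>, \<beta>) c) z = c * eval_monom \<alpha> z * cnj (eval_monom \<beta> z)"
  by (simp add: eval_bi_def)

lemma bi_poly_eq_sum:
  fixes A :: bi_poly
  shows "A = (\<Sum>k\<in>Poly_Mapping.keys A. Poly_Mapping.single k (Poly_Mapping.lookup A k))"
proof (rule poly_mapping_eqI)
  fix k
  show "Poly_Mapping.lookup A k = Poly_Mapping.lookup (\<Sum>k\<in>Poly_Mapping.keys A. Poly_Mapping.single k (Poly_Mapping.lookup A k)) k"
    by (simp add: lookup_sum lookup_single when_def in_keys_iff)
qed

lemma eval_bi_mult: "eval_bi (A * B) z = eval_bi A z * eval_bi B z"
proof -
  have "A * B = (\<Sum>k\<in>Poly_Mapping.keys A. \<Sum>l\<in>Poly_Mapping.keys B.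
      Poly_Mapping.single (k + l) (Poly_Mapping.lookup A k * Poly_Mapping.lookup B l))"
    (is "_ = ?R")
  proof -
    have "A * B = (\<Sum>k\<in>Poly_Mapping.keys A. Poly_Mapping.single k (Poly_Mapping.lookup A k)) *
        (\<Sum>l\<in>Poly_Mapping.keys B. Poly_Mapping.single l (Poly_Mapping.lookup B l))"
      by (simp only: bi_poly_eq_sum[symmetric])
    also have "\<dots> = ?R"
      by (simp only: sum_product mult_single)
    finally show ?thesis .
  qed
  then have "eval_bi (A * B) z = (\<Sum>k\<in>Poly_Mapping.keys A. \<Sum>l\<in>Poly_Mapping.keys B.
      eval_bi (Poly_Mapping.single (k + l) (Poly_Mapping.lookup A k * Poly_Mapping.lookup B l)) z)"
    by (simp add: eval_bi_sum)
  also have "\<dots> = eval_bi A z * eval_bi B z"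
    unfolding eval_bi_def[of A] eval_bi_def[of B] sum_product
    by (intro sum.cong refl)
      (auto simp: eval_bi_single eval_monom_add case_prod_unfold plus_prod_def)
  finally show ?thesis .
qed

lemma eval_bi_norm_sq: "eval_bi (norm_sq_poly n) z = of_real (\<Sum>j<n. (cmod (z j))\<^sup>2)"
proof -
  have "eval_monom (Poly_Mapping.single j 1) z = z j" for j
    by (simp add: eval_monom_def)
  then show ?thesis
    unfolding norm_sq_poly_def eval_bi_sum eval_bi_single of_real_sum complex_norm_square
    by (simp only: mult_1)
qed

lemma eval_bi_real:
  assumes "A \<in> hermitian_polys n"
  shows "eval_bi A z \<in> \<real>"
proof -
  have herm: "Poly_Mapping.lookup A (\<beta>, \<alpha>) = cnj (Poly_Mapping.lookup A (\<alpha>, \<beta>))" for \<alpha> \<beta>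
    using assms unfolding hermitian_polys_def by blast
  let ?t = "\<lambda>k. Poly_Mapping.lookup A k * eval_monom (fst k) z * cnj (eval_monom (snd k) z)"
  have swap: "Poly_Mapping.lookup A (prod.swap k) = cnj (Poly_Mapping.lookup A k)" for k
    by (metis herm prod.collapse prod.swap_def)
  have swap_keys: "prod.swap k \<in> Poly_Mapping.keys A" if "k \<in> Poly_Mapping.keys A" for k
    using that unfolding in_keys_iff swap complex_cnj_zero_iff .
  have eval: "eval_bi A z = (\<Sum>k\<in>Poly_Mapping.keys A. ?t k)"
    unfolding eval_bi_def by (simp add: case_prod_unfold)
  have "cnj (eval_bi A z) = (\<Sum>k\<in>Poly_Mapping.keys A. cnj (?t k))"
    unfolding eval by (rule cnj_sum)
  also have "\<dots> = (\<Sum>k\<in>Poly_Mapping.keys A. ?t k)"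
  proof (rule sum.reindex_bij_witness[of _ prod.swap prod.swap])
    show "?t (prod.swap k) = cnj (?t k)" for k
      unfolding swap by (simp add: mult_ac)
  qed (simp_all only: swap_swap swap_keys)
  finally show ?thesis unfolding Reals_cnj_iff eval .
qed

lemma ex1_kappa:
  assumes "n \<ge> (1::nat)"
  shows "\<exists>!\<kappa>. \<kappa> choose 2 < n \<and> n \<le> (\<kappa> + 1) choose 2"
proof -
  let ?\<kappa> = "LEAST \<kappa>. n \<le> (\<kappa> + 1) choose 2"
  have "n \<le> (n + 1) choose 2" by (induction n) (auto simp: numeral_2_eq_2)
  then have *: "n \<le> (?\<kappa> + 1) choose 2" by (rule LeastI)
  have **: "?\<kappa> choose 2 < n"
  proof (cases ?\<kappa>)
    case 0
    show ?thesis unfolding 0 using assms by (simp add: numeral_2_eq_2)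
  next
    case (Suc k)
    then have "\<not> n \<le> (k + 1) choose 2" by (intro not_less_Least) simp
    then show ?thesis unfolding Suc by simp
  qed
  have mono: "a choose 2 \<le> b choose 2" if "a \<le> b" for a b :: nat
    using that by (rule binomial_right_mono)
  show ?thesis
  proof (rule ex1I[of _ ?\<kappa>])
    fix k assume k: "k choose 2 < n \<and> n \<le> (k + 1) choose 2"
    show "k = ?\<kappa>"
    proof (rule linorder_cases[of k ?\<kappa>])
      assume "k < ?\<kappa>"
      then show ?thesis using mono[of "k + 1" ?\<kappa>] k ** by linarith
    next
      assume "?\<kappa> < k"
      then show ?thesis using mono[of "?\<kappa> + 1" k] k * by linarith
    qed
  qed (use * ** in blast)
qed

end

(*
  Write A(z, z) |z|^2 = |h(z)|^2 and polarise: <h(x), h(w)> = <x, w> A(x, w). Let a be the rank of A,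
  let k(x) be the coefficient vector of A(x, .), and let R(i) be the rank of h on the span of i
  generic vectors, so that rho = R(n).

  If A is positive semidefinite, then h and z (x) k(z) satisfy the same linear relations, whence
  the sum of min(i, a) over i = 1, ..., n is at most rho, which is at most n a. This is one of the
  intervals for a < kappa and gives rho >= Lambda otherwise.

  If A is not positive semidefinite, then a > kappa, because otherwise the span of z (x) k(z) has
  codimension less than n, and k has rank at least 3 on some plane. As h preserves orthogonality,
  R(b) + R(n - b) <= R(n). The main step concerns the first-order jets of h normal to the span of b
  generic vectors: relations among the values of h induce relations among these jets with an extra
  linear factor. Either the jets have rank exactly R(b) - R(b - 1), and then they determine A, so
  that R(i) is at least the rank of z (x) k(z) on i vectors for all i <= b; or there are fewer of
  them, and then R(b) - R(b - 1) exceeds the smaller of R(b + 1) - R(b) and b. A count based on this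
  dichotomy for b >= n / 2 gives rho >= Lambda.
*)

theory Submission
  imports Defs "HOL-Computational_Algebra.Fundamental_Theorem_Algebra"
begin

section \<open>Ranks of families of vectors\<close>

text \<open>For positive semidefinite A a relation among values of h passes to z (x) k(z) because
  the squared norm of a combination of values of h is a sum of n values of the Hermitian form of A.
  For indefinite A this fails, and variation replaces it. Tilt the j-th of b vectors by t times a
  further vector e: the point with coordinates c moves by t c_j e, and as the rank is already
  maximal, the derivative of a relation at t = 0 stays in the span. This is the origin of the extra
  factor c_j. To pass from jets to A, fix w: <h(z), h(w)> = <z, w> A(z, w) vanishes on the
  hyperplane normal to w, as do the jets multiplied by <z, w>; when the latter use up all remaining
  rank, the former is a linear function of them. A plane of rank 3 exists because otherwise two
  values of k merge, up to limits, into a multiple of a third, and the form would be nonnegative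
  since A(x, x) is. The constant arises by adding, for two complementary halves of sizes i, the
  bound i (kappa + 1) - (kappa choose 2) - 1 and using n >= (kappa choose 2) + 1.\<close>

definition fscale :: "complex \<Rightarrow> ('i \<Rightarrow> complex) \<Rightarrow> 'i \<Rightarrow> complex" where
  "fscale c v = (\<lambda>i. c * v i)"

global_interpretation fv: vector_space fscale
  by unfold_locales (auto simp: fscale_def fun_eq_iff algebra_simps)

lemma sum_fun_app: "(\<Sum>x\<in>A. f x) i = (\<Sum>x\<in>A. f x i)"
  by (induction A rule: infinite_finite_induct) auto

text \<open>Independence of a family rather than of the set of its values: it forces
  \<open>\<phi>\<close> to be injective on \<open>B\<close>, so that ranks can be counted on the
  index side.\<close>

definition indf :: "('c \<Rightarrow> 'i \<Rightarrow> complex) \<Rightarrow> 'c set \<Rightarrow> bool" where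
  "indf \<phi> B \<longleftrightarrow> finite B \<and> (\<forall>\<beta>. (\<forall>i. (\<Sum>b\<in>B. \<beta> b * \<phi> b i) = 0) \<longrightarrow> (\<forall>b\<in>B. \<beta> b = 0))"

definition bd :: "('c \<Rightarrow> 'i \<Rightarrow> complex) \<Rightarrow> bool" where
  "bd \<phi> \<longleftrightarrow> (\<exists>I. finite I \<and> (\<forall>c. \<forall>i. i \<notin> I \<longrightarrow> \<phi> c i = 0))"

text \<open>The maximum is meaningful only for families with a common finite support, \<open>bd \<phi>\<close>; otherwise
  it may range over an infinite set.\<close>

definition rk :: "('c \<Rightarrow> 'i \<Rightarrow> complex) \<Rightarrow> 'c set \<Rightarrow> nat" where
  "rk \<phi> C = Max {card B |B. B \<subseteq> C \<and> indf \<phi> B}"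

text \<open>Equivalently, some linear map of spans takes each \<open>\<phi> c\<close> to
  \<open>\<psi> c\<close>. Stating this through relations avoids constructing the map.\<close>

definition relfac :: "('c \<Rightarrow> 'i \<Rightarrow> complex) \<Rightarrow> ('c \<Rightarrow> 'j \<Rightarrow> complex) \<Rightarrow> 'c set \<Rightarrow> bool" where
  "relfac \<phi> \<psi> C \<longleftrightarrow> (\<forall>F \<beta>. finite F \<longrightarrow> F \<subseteq> C \<longrightarrow> (\<forall>i. (\<Sum>c\<in>F. \<beta> c * \<phi> c i) = 0)
      \<longrightarrow> (\<forall>j. (\<Sum>c\<in>F. \<beta> c * \<psi> c j) = 0))"

lemma indfD: "indf \<phi> B \<Longrightarrow> (\<And>i. (\<Sum>b\<in>B. \<beta> b * \<phi> b i) = 0) \<Longrightarrow> b \<in> B \<Longrightarrow> \<beta> b = 0"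
  unfolding indf_def by blast

lemma indf_finite: "indf \<phi> B \<Longrightarrow> finite B"
  unfolding indf_def by blast

lemma indfI: "finite B \<Longrightarrow> (\<And>\<beta> b. (\<And>i. (\<Sum>b\<in>B. \<beta> b * \<phi> b i) = 0) \<Longrightarrow> b \<in> B \<Longrightarrow> \<beta> b = 0) \<Longrightarrow> indf \<phi> B"
  unfolding indf_def by blast

lemma indf_empty [simp]: "indf \<phi> {}"
  by (simp add: indf_def)

lemma relfacD: "relfac \<phi> \<psi> C \<Longrightarrow> finite F \<Longrightarrow> F \<subseteq> C \<Longrightarrow> (\<And>i. (\<Sum>c\<in>F. \<beta> c * \<phi> c i) = 0)
    \<Longrightarrow> (\<Sum>c\<in>F. \<beta> c * \<psi> c j) = 0"
  unfolding relfac_def by blast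

lemma indf_subset:
  assumes "indf \<phi> B" "B' \<subseteq> B"
  shows "indf \<phi> B'"
proof (rule indfI)
  show fin: "finite B'" using assms indf_finite finite_subset by blast
  fix \<beta> b assume z: "\<And>i. (\<Sum>b\<in>B'. \<beta> b * \<phi> b i) = 0" and b: "b \<in> B'"
  have "(\<Sum>b\<in>B. (if b \<in> B' then \<beta> b else 0) * \<phi> b i) = 0" for i
  proof -
    have "(\<Sum>b\<in>B. (if b \<in> B' then \<beta> b else 0) * \<phi> b i) = (\<Sum>b\<in>B'. (if b \<in> B' then \<beta> b else 0) * \<phi> b i)"
      using assms indf_finite by (intro sum.mono_neutral_right) auto
    also have "\<dots> = (\<Sum>b\<in>B'. \<beta> b * \<phi> b i)" by (intro sum.cong) auto
    finally show ?thesis using z by simp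
  qed
  then have "(if b \<in> B' then \<beta> b else 0) = 0"
    using indfD[OF assms(1), of "\<lambda>b. if b \<in> B' then \<beta> b else 0" b] b assms(2) by blast
  then show "\<beta> b = 0" using b by simp
qed

lemma indf_inj:
  assumes "indf \<phi> B"
  shows "inj_on \<phi> B"
proof (rule inj_onI, rule ccontr)
  fix a b assume ab: "a \<in> B" "b \<in> B" "\<phi> a = \<phi> b" "a \<noteq> b"
  have "indf \<phi> {a, b}" using indf_subset[OF assms] ab by auto
  from indfD[OF this, of "\<lambda>x. if x = a then 1 else - 1" a] ab show False by auto
qed

lemma indf_independent:
  assumes "indf \<phi> B"
  shows "fv.independent (\<phi> ` B)"
proof
  have fin: "finite B" using assms indf_finite by blast
  assume "fv.dependent (\<phi> ` B)"
  then obtain u v where u: "v \<in> \<phi> ` B" "u v \<noteq> 0" "(\<Sum>v\<in>\<phi> ` B. fscale (u v) v) = 0"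
    using fv.dependent_finite[of "\<phi> ` B"] fin by blast
  have "(\<Sum>b\<in>B. u (\<phi> b) * \<phi> b i) = 0" for i
  proof -
    have "(\<Sum>b\<in>B. fscale (u (\<phi> b)) (\<phi> b)) = 0"
      using u(3) sum.reindex[OF indf_inj[OF assms], of "\<lambda>v. fscale (u v) v"] by (simp add: o_def)
    from fun_cong[OF this, of i] show ?thesis by (simp add: sum_fun_app fscale_def)
  qed
  with indfD[OF assms, of "\<lambda>b. u (\<phi> b)"] u show False by blast
qed

lemma span_fam:
  "v \<in> fv.span (\<phi> ` C) \<longleftrightarrow> (\<exists>F \<beta>. finite F \<and> F \<subseteq> C \<and> (\<forall>i. v i = (\<Sum>c\<in>F. \<beta> c * \<phi> c i)))"
proof
  assume "v \<in> fv.span (\<phi> ` C)"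
  then obtain t r where t: "finite t" "t \<subseteq> \<phi> ` C" "v = (\<Sum>a\<in>t. fscale (r a) a)"
    unfolding fv.span_explicit by blast
  obtain F where F: "F \<subseteq> C" "inj_on \<phi> F" "t = \<phi> ` F" using t(2) subset_image_inj[of t \<phi> C] by blast
  have "finite F" using F t by (simp add: finite_image_iff)
  moreover have "v i = (\<Sum>c\<in>F. r (\<phi> c) * \<phi> c i)" for i
    unfolding t(3) F(3) using F(2) by (simp add: sum.reindex sum_fun_app fscale_def)
  ultimately show "\<exists>F \<beta>. finite F \<and> F \<subseteq> C \<and> (\<forall>i. v i = (\<Sum>c\<in>F. \<beta> c * \<phi> c i))"
    using F(1) by (intro exI[of _ F] exI[of _ "\<lambda>c. r (\<phi> c)"]) auto
next
  assume "\<exists>F \<beta>. finite F \<and> F \<subseteq> C \<and> (\<forall>i. v i = (\<Sum>c\<in>F. \<beta> c * \<phi> c i))"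
  then obtain F \<beta> where F: "finite F" "F \<subseteq> C" "\<And>i. v i = (\<Sum>c\<in>F. \<beta> c * \<phi> c i)" by blast
  have "v = (\<Sum>c\<in>F. fscale (\<beta> c) (\<phi> c))"
    using F(3) by (auto simp: fun_eq_iff sum_fun_app fscale_def)
  also have "\<dots> \<in> fv.span (\<phi> ` C)"
    using F(2) by (intro fv.span_sum fv.span_scale fv.span_base) auto
  finally show "v \<in> fv.span (\<phi> ` C)" .
qed

lemma span_famI:
  "finite F \<Longrightarrow> F \<subseteq> C \<Longrightarrow> (\<And>i. v i = (\<Sum>c\<in>F. \<beta> c * \<phi> c i)) \<Longrightarrow> v \<in> fv.span (\<phi> ` C)"
  unfolding span_fam by blast

lemma span_fam_base: "c \<in> C \<Longrightarrow> \<phi> c \<in> fv.span (\<phi> ` C)"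
  by (rule fv.span_base) (rule imageI)

lemma span_fam_finite:
  assumes "finite F" "v \<in> fv.span (\<phi> ` F)"
  obtains \<beta> where "\<And>i. v i = (\<Sum>c\<in>F. \<beta> c * \<phi> c i)"
proof -
  obtain G \<beta> where G: "finite G" "G \<subseteq> F" "\<And>i. v i = (\<Sum>c\<in>G. \<beta> c * \<phi> c i)"
    using assms(2) unfolding span_fam by blast
  have "v i = (\<Sum>c\<in>F. (if c \<in> G then \<beta> c else 0) * \<phi> c i)" for i
  proof -
    have "(\<Sum>c\<in>F. (if c \<in> G then \<beta> c else 0) * \<phi> c i) = (\<Sum>c\<in>G. (if c \<in> G then \<beta> c else 0) * \<phi> c i)"
      using assms G by (intro sum.mono_neutral_right) auto
    also have "\<dots> = (\<Sum>c\<in>G. \<beta> c * \<phi> c i)" by (intro sum.cong) auto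
    finally show ?thesis using G by simp
  qed
  then show ?thesis by (rule that)
qed

lemma indf_card_le:
  assumes "indf \<phi> B" "finite D" "\<And>b. b \<in> B \<Longrightarrow> \<phi> b \<in> fv.span (\<psi> ` D)"
  shows "card B \<le> card D"
proof -
  have "card (\<phi> ` B) \<le> card (\<psi> ` D)"
    using fv.independent_span_bound[of "\<psi> ` D" "\<phi> ` B"] assms indf_independent[OF assms(1)] by auto
  also have "\<dots> \<le> card D" using assms by (simp add: card_image_le)
  finally show ?thesis using indf_inj[OF assms(1)] by (simp add: card_image)
qed

lemma span_fam_ex: "finite F \<Longrightarrow> v \<in> fv.span (\<phi> ` F) \<Longrightarrow> \<exists>\<beta>. \<forall>i. v i = (\<Sum>c\<in>F. \<beta> c * \<phi> c i)"
  by (rule span_fam_finite) blast+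

lemma bd_span:
  assumes "finite I" "\<And>i. i \<notin> I \<Longrightarrow> v i = 0"
  shows "v \<in> fv.span ((\<lambda>j i. if i = j then 1 else 0) ` I)"
proof (rule span_famI[of I])
  fix i
  have "(\<Sum>j\<in>I. v j * (if i = j then 1 else 0)) = (\<Sum>j\<in>I. if j = i then v j else 0)"
    by (intro sum.cong) auto
  also have "\<dots> = v i" using assms by simp
  finally show "v i = (\<Sum>j\<in>I. v j * (if i = j then 1 else 0))" by simp
qed (use assms in auto)

lemma bd_indf_le:
  assumes "bd \<phi>"
  obtains K where "\<And>B. indf \<phi> B \<Longrightarrow> card B \<le> K"
proof -
  obtain I where I: "finite I" "\<And>c i. i \<notin> I \<Longrightarrow> \<phi> c i = 0" using assms unfolding bd_def by blast
  show ?thesis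
  proof (rule that[of "card I"])
    fix B assume "indf \<phi> B"
    then show "card B \<le> card I" using I
      by (elim indf_card_le) (auto intro!: bd_span)
  qed
qed

lemma bd_finite: "bd \<phi> \<Longrightarrow> finite {card B |B. B \<subseteq> C \<and> indf \<phi> B}"
proof -
  assume "bd \<phi>"
  then obtain K where "\<And>B. indf \<phi> B \<Longrightarrow> card B \<le> K" using bd_indf_le by blast
  then have "{card B |B. B \<subseteq> C \<and> indf \<phi> B} \<subseteq> {..K}" by auto
  then show ?thesis using finite_subset by blast
qed

lemma rk_ge: "bd \<phi> \<Longrightarrow> B \<subseteq> C \<Longrightarrow> indf \<phi> B \<Longrightarrow> card B \<le> rk \<phi> C"
  unfolding rk_def by (rule Max_ge[OF bd_finite]) auto

lemma rk_witness:
  assumes "bd \<phi>"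
  obtains B where "B \<subseteq> C" "indf \<phi> B" "card B = rk \<phi> C"
proof -
  have "rk \<phi> C \<in> {card B |B. B \<subseteq> C \<and> indf \<phi> B}"
    unfolding rk_def by (rule Max_in[OF bd_finite[OF assms]]) (auto intro!: exI[of _ "{}"])
  then show ?thesis using that by force
qed

lemma rk_geE:
  assumes "bd \<phi>" "r \<le> rk \<phi> C"
  obtains B where "B \<subseteq> C" "indf \<phi> B" "card B = r"
proof -
  obtain B where B: "B \<subseteq> C" "indf \<phi> B" "card B = rk \<phi> C" using rk_witness[OF assms(1)] .
  obtain B' where "B' \<subseteq> B" "card B' = r" using assms(2) B(3) by (metis obtain_subset_with_card_n)
  then show ?thesis using B that indf_subset by blast
qed

lemma indf_insert:
  assumes "indf \<phi> B" "\<phi> c \<notin> fv.span (\<phi> ` B)"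
  shows "indf \<phi> (insert c B)"
proof (rule indfI)
  have fin: "finite B" using assms indf_finite by blast
  have c: "c \<notin> B" using assms(2) span_fam_base[of c B \<phi>] by blast
  show "finite (insert c B)" using fin by simp
  fix \<beta> b assume z: "\<And>i. (\<Sum>b\<in>insert c B. \<beta> b * \<phi> b i) = 0" and b: "b \<in> insert c B"
  have e: "\<beta> c * \<phi> c i + (\<Sum>b\<in>B. \<beta> b * \<phi> b i) = 0" for i
    using z[of i] fin c by simp
  have c0: "\<beta> c = 0"
  proof (rule ccontr)
    assume n: "\<beta> c \<noteq> 0"
    have "\<phi> c i = (\<Sum>b\<in>B. (- \<beta> b / \<beta> c) * \<phi> b i)" for i
    proof -
      have "(\<Sum>b\<in>B. (- \<beta> b / \<beta> c) * \<phi> b i) = - (\<Sum>b\<in>B. \<beta> b * \<phi> b i) / \<beta> c"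
        by (simp add: sum_divide_distrib sum_negf)
      also have "\<dots> = \<phi> c i" using e[of i] n by (simp add: field_simps add_eq_0_iff2)
      finally show ?thesis by simp
    qed
    then have "\<phi> c \<in> fv.span (\<phi> ` B)" using fin by (intro span_famI[of B B _ "\<lambda>b. - \<beta> b / \<beta> c"]) auto
    with assms show False by blast
  qed
  have "(\<Sum>b\<in>B. \<beta> b * \<phi> b i) = 0" for i using e[of i] c0 by simp
  then show "\<beta> b = 0" using indfD[OF assms(1), of \<beta> b] b c0 by blast
qed

lemma indf_extend:
  assumes "bd \<phi>" "B \<subseteq> C" "indf \<phi> B"
  obtains B' where "B \<subseteq> B'" "B' \<subseteq> C" "indf \<phi> B'" "\<And>c. c \<in> C \<Longrightarrow> \<phi> c \<in> fv.span (\<phi> ` B')"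
    "card B' = rk \<phi> C"
proof -
  let ?S = "{card B' |B'. B \<subseteq> B' \<and> B' \<subseteq> C \<and> indf \<phi> B'}"
  have fin: "finite ?S" by (rule finite_subset[OF _ bd_finite[OF assms(1)]]) auto
  have "card B \<in> ?S" using assms by blast
  then have "Max ?S \<in> ?S" using fin Max_in[of ?S] by blast
  then obtain B' where B': "B \<subseteq> B'" "B' \<subseteq> C" "indf \<phi> B'" "card B' = Max ?S" by force
  have sp: "\<phi> c \<in> fv.span (\<phi> ` B')" if c: "c \<in> C" for c
  proof (rule ccontr)
    assume n: "\<phi> c \<notin> fv.span (\<phi> ` B')"
    then have "c \<notin> B'" using span_fam_base[of c B' \<phi>] by blast
    then have "card (insert c B') = Suc (card B')" using indf_finite[OF B'(3)] by simp
    moreover have "card (insert c B') \<in> ?S"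
      using indf_insert[OF B'(3) n] B' c by blast
    then have "card (insert c B') \<le> Max ?S" by (rule Max_ge[OF fin])
    ultimately show False unfolding B'(4)[symmetric] by simp
  qed
  have "card B' = rk \<phi> C"
  proof (rule antisym)
    show "card B' \<le> rk \<phi> C" using rk_ge[OF assms(1)] B' by blast
    obtain D where D: "D \<subseteq> C" "indf \<phi> D" "card D = rk \<phi> C" using rk_witness[OF assms(1)] .
    have "card D \<le> card B'" using D sp indf_finite[OF B'(3)] by (intro indf_card_le[of \<phi> D B' \<phi>]) auto
    then show "rk \<phi> C \<le> card B'" using D by simp
  qed
  then show ?thesis using that B' sp by blast
qed

lemma rk_span:
  assumes "bd \<phi>" "B \<subseteq> C" "indf \<phi> B" "card B = rk \<phi> C" "c \<in> C"
  shows "\<phi> c \<in> fv.span (\<phi> ` B)"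
proof (rule ccontr)
  assume n: "\<phi> c \<notin> fv.span (\<phi> ` B)"
  then have "c \<notin> B" using span_fam_base[of c B \<phi>] by blast
  then have "card (insert c B) = Suc (card B)" using indf_finite[OF assms(3)] by simp
  moreover have "card (insert c B) \<le> rk \<phi> C" using rk_ge[OF assms(1)] indf_insert[OF assms(3) n] assms by blast
  ultimately show False using assms by simp
qed

lemma rk_le_card:
  assumes "bd \<phi>" "finite D" "\<And>c. c \<in> C \<Longrightarrow> \<phi> c \<in> fv.span (\<psi> ` D)"
  shows "rk \<phi> C \<le> card D"
proof -
  obtain B where B: "B \<subseteq> C" "indf \<phi> B" "card B = rk \<phi> C" using rk_witness[OF assms(1)] .
  have "card B \<le> card D" using B assms(3) by (intro indf_card_le[OF B(2) assms(2), where \<psi> = \<psi>]) auto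
  then show ?thesis using B by simp
qed

lemma rk_le_span:
  assumes "bd \<phi>" "bd \<psi>" "\<And>d. d \<in> D \<Longrightarrow> \<psi> d \<in> fv.span (\<phi> ` C)"
  shows "rk \<psi> D \<le> rk \<phi> C"
proof -
  obtain B where B: "B \<subseteq> C" "indf \<phi> B" "card B = rk \<phi> C" using rk_witness[OF assms(1)] .
  have "\<phi> ` C \<subseteq> fv.span (\<phi> ` B)" using rk_span[OF assms(1) B] by blast
  then have "fv.span (\<phi> ` C) \<subseteq> fv.span (\<phi> ` B)" by (rule fv.span_minimal) (rule fv.subspace_span)
  then show ?thesis using rk_le_card[OF assms(2) indf_finite[OF B(2)], of D \<phi>] assms(3) B(3) by auto
qed

lemma rk_le_image:
  assumes "bd \<phi>" "bd \<psi>" "\<And>d. d \<in> D \<Longrightarrow> \<exists>c\<in>C. \<psi> d = \<phi> c"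
  shows "rk \<psi> D \<le> rk \<phi> C"
proof (rule rk_le_span)
  fix d assume "d \<in> D"
  then obtain c where "c \<in> C" "\<psi> d = \<phi> c" using assms(3) by blast
  then show "\<psi> d \<in> fv.span (\<phi> ` C)" by (auto intro: fv.span_base)
qed (use assms in auto)

lemma relfac_indf:
  assumes "relfac \<phi> \<psi> C" "B \<subseteq> C" "indf \<psi> B"
  shows "indf \<phi> B"
proof (rule indfI)
  show fin: "finite B" using indf_finite[OF assms(3)] .
  fix \<beta> b assume z: "\<And>i. (\<Sum>b\<in>B. \<beta> b * \<phi> b i) = 0" and b: "b \<in> B"
  have "(\<Sum>b\<in>B. \<beta> b * \<psi> b i) = 0" for i
    using relfacD[OF assms(1) fin assms(2) z] .
  then show "\<beta> b = 0" using indfD[OF assms(3), of \<beta>] b by blast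
qed

lemma rk_le_relfac:
  assumes "bd \<phi>" "bd \<psi>" "relfac \<phi> \<psi> C"
  shows "rk \<psi> C \<le> rk \<phi> C"
proof -
  obtain B where B: "B \<subseteq> C" "indf \<psi> B" "card B = rk \<psi> C" using rk_witness[OF assms(2)] .
  have "card B \<le> rk \<phi> C" using rk_ge[OF assms(1) B(1) relfac_indf[OF assms(3) B(1,2)]] .
  then show ?thesis using B by simp
qed

text \<open>Rank and nullity: the linear map of spans given by \<open>relfac\<close> has the span of
  \<open>\<psi>\<close> as its image and the values of \<open>\<phi>\<close> on \<open>C'\<close> in
  its kernel. This is the main source of lower bounds for the growth of ranks.\<close>

lemma rk_add:
  assumes "bd \<phi>" "bd \<psi>" "relfac \<phi> \<psi> C" "C' \<subseteq> C" "\<And>c j. c \<in> C' \<Longrightarrow> \<psi> c j = 0"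
  shows "rk \<phi> C' + rk \<psi> C \<le> rk \<phi> C"
proof -
  obtain B' where B': "B' \<subseteq> C'" "indf \<phi> B'" "card B' = rk \<phi> C'" using rk_witness[OF assms(1)] .
  obtain B where B: "B \<subseteq> C" "indf \<psi> B" "card B = rk \<psi> C" using rk_witness[OF assms(2)] .
  have fin: "finite B" "finite B'" using B B' indf_finite by auto
  have disj: "B \<inter> B' = {}"
  proof (rule ccontr)
    assume "B \<inter> B' \<noteq> {}"
    then obtain b where b: "b \<in> B" "b \<in> B'" by blast
    have "indf \<psi> {b}" using indf_subset[OF B(2)] b by blast
    moreover have "\<psi> b j = 0" for j using assms(5) b B' by blast
    ultimately show False using indfD[of \<psi> "{b}" "\<lambda>_. 1" b] by simp
  qed
  have ind: "indf \<phi> (B \<union> B')"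
  proof (rule indfI)
    fix \<beta> b assume z: "\<And>i. (\<Sum>b\<in>B \<union> B'. \<beta> b * \<phi> b i) = 0" and b: "b \<in> B \<union> B'"
    have "(\<Sum>b\<in>B. \<beta> b * \<psi> b j) = 0" for j
    proof -
      have "(\<Sum>b\<in>B \<union> B'. \<beta> b * \<psi> b j) = 0"
        using assms(4) B B' fin z by (intro relfacD[OF assms(3)]) auto
      moreover have "(\<Sum>b\<in>B'. \<beta> b * \<psi> b j) = 0" using assms(5) B'(1) by (intro sum.neutral) auto
      ultimately show ?thesis using fin disj by (simp add: sum.union_disjoint)
    qed
    then have bB: "\<beta> b = 0" if "b \<in> B" for b using indfD[OF B(2), of \<beta>] that by blast
    have "(\<Sum>b\<in>B'. \<beta> b * \<phi> b i) = 0" for i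
      using z[of i] fin disj bB by (simp add: sum.union_disjoint)
    then have "\<beta> b = 0" if "b \<in> B'" for b using indfD[OF B'(2), of \<beta>] that by blast
    then show "\<beta> b = 0" using b bB by blast
  qed (use fin in auto)
  have "card (B \<union> B') \<le> rk \<phi> C" using rk_ge[OF assms(1) _ ind, of C] B(1) B'(1) assms(4) by auto
  then show ?thesis using B B' fin disj by (simp add: card_Un_disjoint)
qed

section \<open>Adjoined coordinates, dual bases and separating functionals\<close>

definition adj :: "('c \<Rightarrow> 'i \<Rightarrow> complex) \<Rightarrow> ('c \<Rightarrow> complex) \<Rightarrow> 'c \<Rightarrow> 'i option \<Rightarrow> complex" where
  "adj \<psi> \<xi> c = case_option (\<xi> c) (\<psi> c)"

lemma bd_adj: "bd \<psi> \<Longrightarrow> bd (adj \<psi> \<xi>)"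
  unfolding bd_def adj_def
proof (elim exE conjE)
  fix I assume I: "finite I" "\<forall>c i. i \<notin> I \<longrightarrow> \<psi> c i = 0"
  show "\<exists>I. finite I \<and> (\<forall>c i. i \<notin> I \<longrightarrow> case_option (\<xi> c) (\<psi> c) i = 0)"
    using I by (intro exI[of _ "insert None (Some ` I)"]) (auto split: option.splits)
qed

text \<open>A coordinate \<open>\<xi>\<close> that does not raise the rank is a linear function of
  \<open>\<psi>\<close> on \<open>C\<close>.\<close>

lemma rk_adj_relation:
  assumes "bd \<psi>" "rk (adj \<psi> \<xi>) C \<le> rk \<psi> C" "finite F" "F \<subseteq> C"
    "\<And>i. (\<Sum>c\<in>F. \<beta> c * \<psi> c i) = 0"
  shows "(\<Sum>c\<in>F. \<beta> c * \<xi> c) = 0"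
proof -
  obtain B where B: "B \<subseteq> C" "indf \<psi> B" "card B = rk \<psi> C" using rk_witness[OF assms(1)] .
  have finB: "finite B" using B indf_finite by auto
  have ind: "indf (adj \<psi> \<xi>) B"
  proof (rule indfI)
    fix \<beta> b assume z: "\<And>i. (\<Sum>b\<in>B. \<beta> b * adj \<psi> \<xi> b i) = 0" and b: "b \<in> B"
    have "(\<Sum>b\<in>B. \<beta> b * \<psi> b i) = 0" for i using z[of "Some i"] by (simp add: adj_def)
    then show "\<beta> b = 0" using indfD[OF B(2), of \<beta>] b by blast
  qed (rule finB)
  have "card B \<le> rk (adj \<psi> \<xi>) C" using rk_ge[OF bd_adj[OF assms(1)] B(1) ind] .
  then have eq: "card B = rk (adj \<psi> \<xi>) C" using B assms(2) by simp
  have "\<exists>g. \<forall>i. adj \<psi> \<xi> c i = (\<Sum>b\<in>B. g b * adj \<psi> \<xi> b i)" if "c \<in> C" for c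
    by (rule span_fam_finite[OF finB rk_span[OF bd_adj[OF assms(1)] B(1) ind eq that]]) blast
  then obtain g where g: "\<And>c i. c \<in> C \<Longrightarrow> adj \<psi> \<xi> c i = (\<Sum>b\<in>B. g c b * adj \<psi> \<xi> b i)" by metis
  have ex: "(\<Sum>c\<in>F. \<beta> c * adj \<psi> \<xi> c i) = (\<Sum>b\<in>B. (\<Sum>c\<in>F. \<beta> c * g c b) * adj \<psi> \<xi> b i)" for i
  proof -
    have "(\<Sum>c\<in>F. \<beta> c * adj \<psi> \<xi> c i) = (\<Sum>c\<in>F. \<Sum>b\<in>B. \<beta> c * g c b * adj \<psi> \<xi> b i)"
      using g[of _ i] assms(4) by (intro sum.cong refl) (simp add: sum_distrib_left mult.assoc subset_iff)
    also have "\<dots> = (\<Sum>b\<in>B. \<Sum>c\<in>F. \<beta> c * g c b * adj \<psi> \<xi> b i)" by (rule sum.swap)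
    finally show ?thesis by (simp add: sum_distrib_right)
  qed
  have "(\<Sum>b\<in>B. (\<Sum>c\<in>F. \<beta> c * g c b) * \<psi> b i) = 0" for i
    using ex[of "Some i"] assms(5)[of i] by (simp add: adj_def)
  then have "(\<Sum>c\<in>F. \<beta> c * g c b) = 0" if "b \<in> B" for b
    using indfD[OF B(2), of "\<lambda>b. \<Sum>c\<in>F. \<beta> c * g c b"] that by blast
  then show ?thesis using ex[of None] by (simp add: adj_def)
qed

text \<open>Finitely many coordinates suffice for a dual basis. Subtract from
  \<open>\<phi> b0\<close> its components along \<open>B\<close>; any coordinate \<open>i0\<close>
  at which the remainder \<open>v\<close> is nonzero yields the new functional.\<close>

lemma dual_functionals:
  fixes \<phi> :: "'c \<Rightarrow> 'i \<Rightarrow> complex"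
  assumes "indf \<phi> B"
  shows "\<exists>J f. finite J \<and> (\<forall>b\<in>B. \<forall>b'\<in>B. (\<Sum>i\<in>J. f b i * \<phi> b' i) = (if b = b' then 1 else 0))"
  using indf_finite[OF assms] assms
proof (induction B rule: finite_induct)
  case empty
  show ?case by (intro exI[of _ "{}"]) auto
next
  case (insert b0 B)
  have indB: "indf \<phi> B" using indf_subset[OF insert.prems] by blast
  obtain J f where J: "finite J"
    "\<And>b b'. b \<in> B \<Longrightarrow> b' \<in> B \<Longrightarrow> (\<Sum>i\<in>J. f b i * \<phi> b' i) = (if b = b' then 1 else 0)"
    using insert.IH[OF indB] by blast
  define g where "g b = (\<Sum>i\<in>J. f b i * \<phi> b0 i)" for b
  define v where "v i = \<phi> b0 i - (\<Sum>b\<in>B. g b * \<phi> b i)" for i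
  have "\<exists>i. v i \<noteq> 0"
  proof (rule ccontr)
    assume "\<not> ?thesis"
    then have z: "\<phi> b0 i - (\<Sum>b\<in>B. g b * \<phi> b i) = 0" for i by (simp add: v_def)
    have "(\<Sum>b\<in>insert b0 B. (if b = b0 then 1 else - g b) * \<phi> b i) = 0" for i
    proof -
      have "(\<Sum>b\<in>B. (if b = b0 then 1 else - g b) * \<phi> b i) = (\<Sum>b\<in>B. - (g b * \<phi> b i))"
        using insert.hyps by (intro sum.cong) auto
      then show ?thesis using z[of i] insert.hyps by (simp add: sum_negf)
    qed
    from indfD[OF insert.prems, of "\<lambda>b. if b = b0 then 1 else - g b" b0, OF this] show False by simp
  qed
  then obtain i0 where i0: "v i0 \<noteq> 0" by blast
  define J' where "J' = insert i0 J"
  define f1 where "f1 b i = (if i \<in> J then f b i else 0)" for b i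
  have finJ': "finite J'" using J J'_def by simp
  have f1: "(\<Sum>i\<in>J'. f1 b i * \<phi> b' i) = (\<Sum>i\<in>J. f b i * \<phi> b' i)" for b b'
  proof -
    have "(\<Sum>i\<in>J'. f1 b i * \<phi> b' i) = (\<Sum>i\<in>J. f1 b i * \<phi> b' i)"
      using J(1) by (intro sum.mono_neutral_right) (auto simp: J'_def f1_def)
    then show ?thesis by (simp add: f1_def)
  qed
  \<comment> \<open>Evaluation at \<open>i0\<close>, corrected to vanish on \<open>B\<close> and
    normalised to be 1 on \<open>b0\<close>.\<close>
  define e where "e i = ((if i = i0 then 1 else 0) - (\<Sum>b\<in>B. \<phi> b i0 * f1 b i)) / v i0" for i
  have e: "(\<Sum>i\<in>J'. e i * \<phi> b' i) = (\<phi> b' i0 - (\<Sum>b\<in>B. \<phi> b i0 * (\<Sum>i\<in>J. f b i * \<phi> b' i))) / v i0" for b'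
  proof -
    have "e i * \<phi> b' i = ((if i = i0 then \<phi> b' i else 0) - (\<Sum>b\<in>B. \<phi> b i0 * (f1 b i * \<phi> b' i))) / v i0" for i
    proof -
      have "(\<Sum>b\<in>B. \<phi> b i0 * f1 b i) * \<phi> b' i = (\<Sum>b\<in>B. \<phi> b i0 * (f1 b i * \<phi> b' i))"
        by (simp add: sum_distrib_right mult.assoc)
      then show ?thesis by (simp add: e_def left_diff_distrib)
    qed
    then have "(\<Sum>i\<in>J'. e i * \<phi> b' i)
       = (\<Sum>i\<in>J'. ((if i = i0 then \<phi> b' i else 0) - (\<Sum>b\<in>B. \<phi> b i0 * (f1 b i * \<phi> b' i)))) / v i0"
      by (simp only: sum_divide_distrib)
    also have "(\<Sum>i\<in>J'. ((if i = i0 then \<phi> b' i else 0) - (\<Sum>b\<in>B. \<phi> b i0 * (f1 b i * \<phi> b' i))))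
       = \<phi> b' i0 - (\<Sum>i\<in>J'. \<Sum>b\<in>B. \<phi> b i0 * (f1 b i * \<phi> b' i))"
      using finJ' by (simp add: sum_subtractf J'_def)
    also have "(\<Sum>i\<in>J'. \<Sum>b\<in>B. \<phi> b i0 * (f1 b i * \<phi> b' i)) = (\<Sum>b\<in>B. \<phi> b i0 * (\<Sum>i\<in>J'. f1 b i * \<phi> b' i))"
      by (subst sum.swap) (simp add: sum_distrib_left)
    finally show ?thesis by (simp add: f1)
  qed
  have eB: "(\<Sum>i\<in>J'. e i * \<phi> b' i) = 0" if "b' \<in> B" for b'
  proof -
    have "(\<Sum>b\<in>B. \<phi> b i0 * (\<Sum>i\<in>J. f b i * \<phi> b' i)) = (\<Sum>b\<in>B. if b = b' then \<phi> b i0 else 0)"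
      using J(2) that by (intro sum.cong) auto
    also have "\<dots> = \<phi> b' i0" using insert.hyps that by simp
    finally show ?thesis by (simp add: e)
  qed
  have e0: "(\<Sum>i\<in>J'. e i * \<phi> b0 i) = 1"
    using i0 unfolding e by (simp add: v_def g_def mult.commute)
  define F where "F b i = (if b = b0 then e i else f1 b i - g b * e i)" for b i
  have FB: "(\<Sum>i\<in>J'. F b i * \<phi> b' i) = (\<Sum>i\<in>J. f b i * \<phi> b' i) - g b * (\<Sum>i\<in>J'. e i * \<phi> b' i)"
    if "b \<noteq> b0" for b b'
    using that by (simp add: F_def f1[symmetric] left_diff_distrib sum_subtractf sum_distrib_left mult.assoc)
  show ?case
  proof (intro exI[of _ J'] exI[of _ F] conjI ballI finJ')
    fix b b' assume b: "b \<in> insert b0 B" "b' \<in> insert b0 B"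
    consider "b = b0" "b' = b0" | "b = b0" "b' \<in> B" "b' \<noteq> b0" | "b \<in> B" "b \<noteq> b0" "b' = b0"
      | "b \<in> B" "b \<noteq> b0" "b' \<in> B" using b insert.hyps by blast
    then show "(\<Sum>i\<in>J'. F b i * \<phi> b' i) = (if b = b' then 1 else 0)"
    proof cases
      case 1 then show ?thesis using e0 by (simp add: F_def)
    next
      case 2 then show ?thesis using eB by (simp add: F_def)
    next
      case 3 then show ?thesis using e0 by (simp add: FB g_def)
    next
      case 4 then show ?thesis using eB J(2) by (simp add: FB)
    qed
  qed
qed

lemma separating_functional:
  assumes "bd \<phi>" "v \<notin> fv.span (\<phi> ` C)"
  shows "\<exists>J f. finite J \<and> (\<forall>c\<in>C. (\<Sum>i\<in>J. f i * \<phi> c i) = 0) \<and> (\<Sum>i\<in>J. f i * v i) = 1"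
proof -
  obtain B where B: "B \<subseteq> C" "indf \<phi> B" "card B = rk \<phi> C" using rk_witness[OF assms(1)] .
  define \<Phi> where "\<Phi> = case_option v \<phi>"
  have fin: "finite B" using B indf_finite by auto
  have "indf \<Phi> (Some ` B)"
  proof (rule indfI)
    fix \<beta> b assume z: "\<And>i. (\<Sum>b\<in>Some ` B. \<beta> b * \<Phi> b i) = 0" and b: "b \<in> Some ` B"
    have "(\<Sum>b\<in>B. \<beta> (Some b) * \<phi> b i) = 0" for i using z[of i] by (simp add: sum.reindex \<Phi>_def)
    then show "\<beta> b = 0" using indfD[OF B(2), of "\<lambda>b. \<beta> (Some b)"] b by blast
  qed (use fin in auto)
  moreover have "\<Phi> None \<notin> fv.span (\<Phi> ` Some ` B)"
  proof -
    have "\<Phi> ` Some ` B = \<phi> ` B" by (auto simp: \<Phi>_def image_iff)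
    moreover have "fv.span (\<phi> ` B) \<subseteq> fv.span (\<phi> ` C)" using B by (intro fv.span_mono) auto
    ultimately show ?thesis using assms(2) by (auto simp: \<Phi>_def)
  qed
  ultimately have "indf \<Phi> (insert None (Some ` B))" by (rule indf_insert)
  from dual_functionals[OF this] obtain J f where J: "finite J"
    "\<And>b b'. b \<in> insert None (Some ` B) \<Longrightarrow> b' \<in> insert None (Some ` B) \<Longrightarrow>
       (\<Sum>i\<in>J. f b i * \<Phi> b' i) = (if b = b' then 1 else 0)" by metis
  show ?thesis
  proof (intro exI[of _ J] exI[of _ "f None"] conjI ballI)
    show "(\<Sum>i\<in>J. f None i * v i) = 1" using J(2)[of None None] by (simp add: \<Phi>_def)
    fix c assume "c \<in> C"
    then have "\<phi> c \<in> fv.span (\<phi> ` B)" by (rule rk_span[OF assms(1) B])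
    then obtain \<beta> where \<beta>: "\<forall>i. \<phi> c i = (\<Sum>b\<in>B. \<beta> b * \<phi> b i)"
      using span_fam_ex[OF fin] by blast
    have "(\<Sum>i\<in>J. f None i * \<phi> c i) = (\<Sum>i\<in>J. \<Sum>b\<in>B. \<beta> b * (f None i * \<phi> b i))"
      by (simp add: \<beta> sum_distrib_left mult.left_commute)
    also have "\<dots> = (\<Sum>b\<in>B. \<beta> b * (\<Sum>i\<in>J. f None i * \<phi> b i))"
      by (subst sum.swap) (simp add: sum_distrib_left)
    also have "\<dots> = 0" using J(2)[of None "Some _"] by (intro sum.neutral) (auto simp: \<Phi>_def)
    finally show "(\<Sum>i\<in>J. f None i * \<phi> c i) = 0" .
  qed (use J in auto)
qed

lemma functional_span_zero:
  assumes "\<forall>c\<in>C. (\<Sum>i\<in>J. f i * \<phi> c i) = 0" "v \<in> fv.span (\<phi> ` C)"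
  shows "(\<Sum>i\<in>J. f i * v i) = 0"
proof -
  obtain F \<beta> where F: "finite F" "F \<subseteq> C" "\<And>i. v i = (\<Sum>c\<in>F. \<beta> c * \<phi> c i)"
    using assms(2) unfolding span_fam by blast
  have "(\<Sum>i\<in>J. f i * v i) = (\<Sum>i\<in>J. \<Sum>c\<in>F. \<beta> c * (f i * \<phi> c i))"
    by (simp add: F sum_distrib_left mult.left_commute)
  also have "\<dots> = (\<Sum>c\<in>F. \<beta> c * (\<Sum>i\<in>J. f i * \<phi> c i))" by (subst sum.swap) (simp add: sum_distrib_left)
  also have "\<dots> = 0" using F(2) assms(1) by (intro sum.neutral) auto
  finally show ?thesis .
qed

section \<open>Polynomial dependence on a real parameter\<close>

text \<open>A real parameter makes this class closed under complex conjugation.\<close>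

definition rpoly :: "(real \<Rightarrow> complex) \<Rightarrow> bool" where
  "rpoly f \<longleftrightarrow> (\<exists>p. \<forall>t. f t = poly p (of_real t))"

lemma rpoly_const [intro, simp]: "rpoly (\<lambda>t. c)"
  unfolding rpoly_def by (rule exI[of _ "[:c:]"]) simp

lemma rpoly_id [intro, simp]: "rpoly (\<lambda>t. of_real t)"
  unfolding rpoly_def by (rule exI[of _ "[:0, 1:]"]) simp

lemma rpoly_add [intro]: "rpoly f \<Longrightarrow> rpoly g \<Longrightarrow> rpoly (\<lambda>t. f t + g t)"
  unfolding rpoly_def by (metis poly_add)

lemma rpoly_mult [intro]: "rpoly f \<Longrightarrow> rpoly g \<Longrightarrow> rpoly (\<lambda>t. f t * g t)"
  unfolding rpoly_def by (metis poly_mult)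

lemma rpoly_diff [intro]: "rpoly f \<Longrightarrow> rpoly g \<Longrightarrow> rpoly (\<lambda>t. f t - g t)"
  unfolding rpoly_def by (metis poly_diff)

lemma rpoly_sum [intro]: "(\<And>x. x \<in> S \<Longrightarrow> rpoly (f x)) \<Longrightarrow> rpoly (\<lambda>t. \<Sum>x\<in>S. f x t)"
  by (induction S rule: infinite_finite_induct) auto

lemma rpoly_power [intro]: "rpoly f \<Longrightarrow> rpoly (\<lambda>t. f t ^ k)"
  by (induction k) auto

lemma rpoly_cnj [intro]: "rpoly f \<Longrightarrow> rpoly (\<lambda>t. cnj (f t))"
proof -
  assume "rpoly f"
  then obtain p where "\<forall>t. f t = poly p (of_real t)" unfolding rpoly_def by blast
  then have "\<forall>t. cnj (f t) = poly (map_poly cnj p) (of_real t)" by simp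
  then show ?thesis unfolding rpoly_def by blast
qed

lemma rpoly_finite:
  assumes "rpoly f" "f t0 \<noteq> 0"
  shows "finite {t. f t = 0}"
proof -
  obtain p where p: "\<And>t. f t = poly p (of_real t)" using assms unfolding rpoly_def by blast
  then have "p \<noteq> 0" using assms by auto
  then have "finite {x. poly p x = 0}" by (rule poly_roots_finite)
  then have "finite (of_real -` {x. poly p x = 0} :: real set)"
    by (intro finite_vimageI) (auto simp: inj_on_def)
  then show ?thesis by (simp add: p vimage_def)
qed

lemma rpoly_zero:
  assumes "rpoly f" "finite {t. f t \<noteq> 0}"
  shows "f t = 0"
proof (rule ccontr)
  assume "f t \<noteq> 0"
  then have "finite ({t. f t = 0} \<union> {t. f t \<noteq> 0})" using rpoly_finite[OF assms(1)] assms(2) by blast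
  moreover have "{t. f t = 0} \<union> {t. f t \<noteq> 0} = UNIV" by auto
  ultimately show False using infinite_UNIV_char_0[where 'a = real] by simp
qed

lemma cofinite_ex:
  assumes "finite {t::real. \<not> P t}"
  shows "\<exists>t. P t"
proof (rule ccontr)
  assume "\<not> ?thesis"
  then have "{t::real. \<not> P t} = UNIV" by auto
  then show False using assms infinite_UNIV_char_0[where 'a = real] by simp
qed

lemma cofinite_conj:
  assumes "finite {t. \<not> P t}" "finite {t. \<not> Q t}"
  shows "finite {t. \<not> (P t \<and> Q t)}"
  by (rule finite_subset[OF _ finite_UnI[OF assms]]) auto

lemma cofinite_mono:
  assumes "finite {t. \<not> P t}" "\<And>t. P t \<Longrightarrow> Q t"
  shows "finite {t. \<not> Q t}"
  by (rule finite_subset[OF _ assms(1)]) (use assms(2) in auto)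

text \<open>The usual argument is that a nonzero minor stays nonzero for almost all
  \<open>t\<close>; here elimination takes the place of determinants.\<close>

lemma indf_cofinite:
  assumes "\<And>b i. b \<in> B \<Longrightarrow> rpoly (\<lambda>t. \<Phi> t b i)" "indf (\<Phi> t0) B"
  shows "finite {t. \<not> indf (\<Phi> t) B}"
  using indf_finite[OF assms(2)] assms
proof (induction B arbitrary: \<Phi> rule: finite_induct)
  case empty
  then show ?case by simp
next
  case (insert b0 B)
  have "\<exists>i0. \<Phi> t0 b0 i0 \<noteq> 0"
  proof (rule ccontr)
    assume "\<not> ?thesis"
    then have z: "\<Phi> t0 b0 i = 0" for i by blast
    have "indf (\<Phi> t0) {b0}" using indf_subset[OF insert.prems(2)] by blast
    from indfD[OF this, of "\<lambda>_. 1" b0] z show False by simp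
  qed
  then obtain i0 where i0: "\<Phi> t0 b0 i0 \<noteq> 0" by blast
  \<comment> \<open>Coordinate \<open>i0\<close> is cleared by cross-multiplication with the pivot;
    the absence of division keeps the entries polynomial in \<open>t\<close>.\<close>
  define \<Psi> where "\<Psi> t b i = \<Phi> t b0 i0 * \<Phi> t b i - \<Phi> t b i0 * \<Phi> t b0 i" for t b i
  have rp: "rpoly (\<lambda>t. \<Psi> t b i)" if "b \<in> B" for b i
    unfolding \<Psi>_def using insert.prems(1) that by (intro rpoly_diff rpoly_mult) auto
  have ind: "indf (\<Psi> t0) B"
  proof (rule indfI)
    fix \<beta> b assume z: "\<And>i. (\<Sum>b\<in>B. \<beta> b * \<Psi> t0 b i) = 0" and b: "b \<in> B"
    let ?\<gamma> = "\<lambda>c. if c = b0 then - (\<Sum>b\<in>B. \<beta> b * \<Phi> t0 b i0) else \<Phi> t0 b0 i0 * \<beta> c"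
    have "(\<Sum>c\<in>insert b0 B. ?\<gamma> c * \<Phi> t0 c i) = 0" for i
    proof -
      have "(\<Sum>c\<in>B. ?\<gamma> c * \<Phi> t0 c i) = (\<Sum>c\<in>B. \<Phi> t0 b0 i0 * \<beta> c * \<Phi> t0 c i)"
        using insert.hyps by (intro sum.cong) auto
      moreover have "(\<Sum>b\<in>B. \<beta> b * \<Psi> t0 b i)
          = (\<Sum>c\<in>B. \<Phi> t0 b0 i0 * \<beta> c * \<Phi> t0 c i) - (\<Sum>b\<in>B. \<beta> b * \<Phi> t0 b i0) * \<Phi> t0 b0 i"
        by (simp add: \<Psi>_def right_diff_distrib sum_subtractf sum_distrib_left sum_distrib_right mult_ac)
      ultimately show ?thesis using z[of i] insert.hyps by simp
    qed
    then have "?\<gamma> b = 0" using indfD[OF insert.prems(2), of ?\<gamma> b] b by blast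
    then show "\<beta> b = 0" using insert.hyps b i0 by (auto split: if_splits)
  qed (use insert in auto)
  have "finite {t. \<not> indf (\<Psi> t) B}" using insert.IH[of \<Psi>] rp ind by blast
  moreover have "finite {t. \<not> \<Phi> t b0 i0 \<noteq> 0}"
    using rpoly_finite[of "\<lambda>t. \<Phi> t b0 i0" t0] insert.prems(1) i0 by auto
  ultimately have "finite {t. \<not> (indf (\<Psi> t) B \<and> \<Phi> t b0 i0 \<noteq> 0)}" by (rule cofinite_conj)
  then show ?case
  proof (rule cofinite_mono)
    fix t assume t: "indf (\<Psi> t) B \<and> \<Phi> t b0 i0 \<noteq> 0"
    show "indf (\<Phi> t) (insert b0 B)"
    proof (rule indfI)
      fix \<beta> b assume z: "\<And>i. (\<Sum>b\<in>insert b0 B. \<beta> b * \<Phi> t b i) = 0" and b: "b \<in> insert b0 B"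
      have e: "(\<Sum>b\<in>B. \<beta> b * \<Phi> t b i) = - (\<beta> b0 * \<Phi> t b0 i)" for i
        using z[of i] insert.hyps by (simp add: add_eq_0_iff)
      have "(\<Sum>b\<in>B. \<beta> b * \<Psi> t b i) = 0" for i
      proof -
        have "(\<Sum>b\<in>B. \<beta> b * \<Psi> t b i)
          = \<Phi> t b0 i0 * (\<Sum>b\<in>B. \<beta> b * \<Phi> t b i) - (\<Sum>b\<in>B. \<beta> b * \<Phi> t b i0) * \<Phi> t b0 i"
          by (simp add: \<Psi>_def right_diff_distrib sum_subtractf sum_distrib_right sum_distrib_left mult_ac)
        then show ?thesis unfolding e by simp
      qed
      then have B0: "\<beta> b = 0" if "b \<in> B" for b using indfD[OF _ , of "\<Psi> t" B \<beta> b] t that by blast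
      then have "\<beta> b0 * \<Phi> t b0 i0 = 0" using e[of i0] by simp
      then show "\<beta> b = 0" using B0 b t by auto
    qed (use insert in auto)
  qed
qed

section \<open>Generic parameters and maximal ranks\<close>

definition pline :: "('q \<Rightarrow> complex) \<Rightarrow> ('q \<Rightarrow> complex) \<Rightarrow> real \<Rightarrow> 'q \<Rightarrow> complex" where
  "pline x y t = (\<lambda>q. x q + of_real t * (y q - x q))"

lemma pline_rev: "pline y x (1 - t) = pline x y t"
  by (auto simp: pline_def fun_eq_iff algebra_simps)

lemma pline_0 [simp]: "pline x y 0 = x"
  by (simp add: pline_def)

lemma pline_1 [simp]: "pline x y 1 = y"
  by (simp add: pline_def)

lemma rpoly_pline [intro]: "rpoly (\<lambda>t. pline x y t q)"
  unfolding pline_def by (intro rpoly_add rpoly_mult rpoly_const rpoly_id)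

text \<open>Genericity is tested along real lines only, so that conditions involving complex
  conjugates of the parameters qualify as well.\<close>

definition gen :: "(('q \<Rightarrow> complex) \<Rightarrow> bool) \<Rightarrow> bool" where
  "gen P \<longleftrightarrow> (\<forall>x y. P x \<longrightarrow> finite {t. \<not> P (pline x y t)})"

lemma gen_conj: "gen P \<Longrightarrow> gen Q \<Longrightarrow> gen (\<lambda>x. P x \<and> Q x)"
  unfolding gen_def by (intro allI impI cofinite_conj) auto

text \<open>On the real line joining \<open>x\<close> and \<open>y\<close> each property fails at
  finitely many points only. Generic configurations are obtained throughout by combining separate
  witnesses in this way.\<close>

lemma gen_ex_conj:
  assumes "gen P" "gen Q" "P x" "Q y"
  shows "\<exists>z. P z \<and> Q z"
proof -
  have "finite {t. \<not> Q (pline y x t)}" using assms unfolding gen_def by blast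
  then have "finite ((\<lambda>t. 1 - t) ` {t. \<not> Q (pline y x t)})" by simp
  moreover have "{t. \<not> Q (pline x y t)} \<subseteq> (\<lambda>t. 1 - t) ` {t. \<not> Q (pline y x t)}"
  proof
    fix t assume "t \<in> {t. \<not> Q (pline x y t)}"
    then show "t \<in> (\<lambda>t. 1 - t) ` {t. \<not> Q (pline y x t)}"
      by (intro image_eqI[of _ _ "1 - t"]) (auto simp: pline_rev)
  qed
  ultimately have "finite {t. \<not> Q (pline x y t)}" using finite_subset by blast
  moreover have "finite {t. \<not> P (pline x y t)}" using assms unfolding gen_def by blast
  ultimately have "\<exists>t. P (pline x y t) \<and> Q (pline x y t)"
    by (intro cofinite_ex cofinite_conj)
  then show ?thesis by blast
qed

lemma gen_True [simp]: "gen (\<lambda>x. True)"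
  by (simp add: gen_def)

lemma gen_ball: "finite I \<Longrightarrow> (\<And>i. i \<in> I \<Longrightarrow> gen (P i)) \<Longrightarrow> gen (\<lambda>x. \<forall>i\<in>I. P i x)"
  by (induction I rule: finite_induct) (auto intro: gen_conj)

lemma gen_ball_ex:
  assumes "finite I" "\<And>i. i \<in> I \<Longrightarrow> gen (P i)" "\<And>i. i \<in> I \<Longrightarrow> \<exists>x. P i x"
  shows "\<exists>x. \<forall>i\<in>I. P i x"
  using assms
proof (induction I rule: finite_induct)
  case (insert i I)
  obtain x where "\<forall>i\<in>I. P i x" using insert by blast
  moreover obtain y where "P i y" using insert by blast
  ultimately have "\<exists>z. (\<forall>i\<in>I. P i z) \<and> P i z"
    using insert by (intro gen_ex_conj[of _ _ x y] gen_ball) auto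
  then show ?case by auto
qed auto

lemma gen_indf:
  assumes "\<And>x y b i. b \<in> B \<Longrightarrow> rpoly (\<lambda>t. \<Phi> (pline x y t) b i)"
  shows "gen (\<lambda>x. indf (\<Phi> x) B)"
  unfolding gen_def
proof (intro allI impI)
  fix x y assume "indf (\<Phi> x) B"
  then show "finite {t. \<not> indf (\<Phi> (pline x y t)) B}"
    using indf_cofinite[of B "\<lambda>t. \<Phi> (pline x y t)" 0] assms by auto
qed

lemma gen_nonzero:
  assumes "\<And>x y. rpoly (\<lambda>t. f (pline x y t))"
  shows "gen (\<lambda>x. f x \<noteq> 0)"
  unfolding gen_def
proof (intro allI impI)
  fix x y assume "f x \<noteq> 0"
  then show "finite {t. \<not> f (pline x y t) \<noteq> 0}"
    using rpoly_finite[OF assms, of x y 0] by simp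
qed

text \<open>The version of \<open>bd\<close> that is uniform in the parameter; it bounds the ranks
  over all parameters, as \<open>maxrk\<close> requires.\<close>

definition ubd :: "('x \<Rightarrow> 'c \<Rightarrow> 'i \<Rightarrow> complex) \<Rightarrow> bool" where
  "ubd \<Phi> \<longleftrightarrow> (\<exists>I. finite I \<and> (\<forall>x c i. i \<notin> I \<longrightarrow> \<Phi> x c i = 0))"

lemma ubd_bd: "ubd \<Phi> \<Longrightarrow> bd (\<Phi> x)"
  unfolding ubd_def bd_def by blast

lemma gen_rk:
  assumes "ubd \<Phi>" "\<And>x y c i. c \<in> C \<Longrightarrow> rpoly (\<lambda>t. \<Phi> (pline x y t) c i)"
  shows "gen (\<lambda>x. r \<le> rk (\<Phi> x) C)"
  unfolding gen_def
proof (intro allI impI)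
  fix x y assume "r \<le> rk (\<Phi> x) C"
  then obtain B where B: "B \<subseteq> C" "indf (\<Phi> x) B" "card B = r"
    using rk_geE[OF ubd_bd[OF assms(1)]] by blast
  have "finite {t. \<not> indf (\<Phi> (pline x y t)) B}"
    by (rule indf_cofinite[where ?t0.0 = 0]) (use assms(2) B in auto)
  then show "finite {t. \<not> r \<le> rk (\<Phi> (pline x y t)) C}"
    by (rule cofinite_mono) (use rk_ge[OF ubd_bd[OF assms(1)] B(1)] B(3) in auto)
qed

definition maxrk :: "('x \<Rightarrow> 'c \<Rightarrow> 'i \<Rightarrow> complex) \<Rightarrow> 'c set \<Rightarrow> nat" where
  "maxrk \<Phi> C = Max (range (\<lambda>x. rk (\<Phi> x) C))"

lemma maxrk_finite: 
  assumes "ubd \<Phi>"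
  shows "finite (range (\<lambda>x. rk (\<Phi> x) C))"
proof -
  obtain I where I: "finite I" "\<And>x c i. i \<notin> I \<Longrightarrow> \<Phi> x c i = 0" using assms unfolding ubd_def by blast
  have "rk (\<Phi> x) C \<le> card I" for x
    
  proof (rule rk_le_card[OF ubd_bd[OF assms] I(1)])
    fix c
    show "\<Phi> x c \<in> fv.span ((\<lambda>j i. if i = j then 1 else 0) ` I)"
      by (rule bd_span[OF I(1)]) (rule I(2))
  qed
  then have "range (\<lambda>x. rk (\<Phi> x) C) \<subseteq> {..card I}" by (intro image_subsetI) simp
  then show ?thesis by (rule finite_subset) simp
qed

lemma maxrk_ge: "ubd \<Phi> \<Longrightarrow> rk (\<Phi> x) C \<le> maxrk \<Phi> C"
  unfolding maxrk_def by (rule Max_ge[OF maxrk_finite]) auto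

lemma maxrk_attained:
  assumes "ubd \<Phi>"
  shows "\<exists>x. rk (\<Phi> x) C = maxrk \<Phi> C"
proof -
  have "maxrk \<Phi> C \<in> range (\<lambda>x. rk (\<Phi> x) C)"
    unfolding maxrk_def using maxrk_finite[OF assms] by (intro Max_in) auto
  then show ?thesis by auto
qed

text \<open>A functional that vanishes on the span and is 1 at \<open>v t0\<close> would be, along
  \<open>v\<close>, a nonzero polynomial with infinitely many zeros.\<close>

lemma span_closed:
  assumes "bd \<psi>" "\<And>i. rpoly (\<lambda>t. v t i)" "finite {t. \<not> v t \<in> fv.span (\<psi> ` C)}"
  shows "v t0 \<in> fv.span (\<psi> ` C)"
proof (rule ccontr)
  assume n: "v t0 \<notin> fv.span (\<psi> ` C)"
  obtain J f where J: "finite J" "\<forall>c\<in>C. (\<Sum>i\<in>J. f i * \<psi> c i) = 0" "(\<Sum>i\<in>J. f i * v t0 i) = 1"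
    using separating_functional[OF assms(1) n] by blast
  have "finite {t. (\<Sum>i\<in>J. f i * v t i) \<noteq> 0}"
    by (rule finite_subset[OF _ assms(3)]) (use functional_span_zero[OF J(2)] in blast)
  moreover have "rpoly (\<lambda>t. \<Sum>i\<in>J. f i * v t i)" by (intro rpoly_sum rpoly_mult rpoly_const assms(2))
  ultimately have "(\<Sum>i\<in>J. f i * v t0 i) = 0" using rpoly_zero by blast
  then show False using J by simp
qed

text \<open>The classical lemma on pencils of maximal rank: adjoining the variation of a relation divided
  by \<open>t\<close> would otherwise raise the rank for almost all \<open>t\<close>.\<close>

lemma pencil_relation:
  assumes "ubd \<Phi>" "\<And>t. rk (\<Phi> t) C \<le> rk (\<Phi> 0) C"
    and "\<And>t c i. \<Phi> t c i = \<Phi> 0 c i + of_real t * \<Phi>1 c i + of_real t ^ 2 * r t c i"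
    and "\<And>c i. rpoly (\<lambda>t. r t c i)"
    and "finite F" "F \<subseteq> C" "\<And>i. (\<Sum>c\<in>F. \<beta> c * \<Phi> 0 c i) = 0"
  shows "(\<lambda>i. \<Sum>c\<in>F. \<beta> c * \<Phi>1 c i) \<in> fv.span (\<Phi> 0 ` C)"
proof (rule ccontr)
  \<comment> \<open>The given relation applied to \<open>\<Phi> t\<close> and divided by
    \<open>t\<close>. The formula makes sense at \<open>t = 0\<close>, where it is the vector in
    question.\<close>
  define k where "k t i = (\<Sum>c\<in>F. \<beta> c * (\<Phi>1 c i + of_real t * r t c i))" for t i
  assume "(\<lambda>i. \<Sum>c\<in>F. \<beta> c * \<Phi>1 c i) \<notin> fv.span (\<Phi> 0 ` C)"
  then have n: "k 0 \<notin> fv.span (\<Phi> 0 ` C)" by (simp add: k_def[abs_def])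
  obtain I where I: "finite I" "\<And>t c i. i \<notin> I \<Longrightarrow> \<Phi> t c i = 0" using assms(1) unfolding ubd_def by blast
  obtain B where B: "B \<subseteq> C" "indf (\<Phi> 0) B" "card B = rk (\<Phi> 0) C" using rk_witness[OF ubd_bd[OF assms(1)]] .
  define \<Psi> where "\<Psi> t = case_option (k t) (\<Phi> t)" for t
  let ?B = "insert None (Some ` B)"
  have fin: "finite B" using B indf_finite by auto
  have "indf (\<Psi> 0) (Some ` B)"
  proof (rule indfI)
    fix \<beta> b assume z: "\<And>i. (\<Sum>b\<in>Some ` B. \<beta> b * \<Psi> 0 b i) = 0" and b: "b \<in> Some ` B"
    have "(\<Sum>b\<in>B. \<beta> (Some b) * \<Phi> 0 b i) = 0" for i using z[of i] by (simp add: sum.reindex \<Psi>_def)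
    then show "\<beta> b = 0" using indfD[OF B(2), of "\<lambda>b. \<beta> (Some b)"] b by blast
  qed (use fin in auto)
  moreover have "\<Psi> 0 None \<notin> fv.span (\<Psi> 0 ` Some ` B)"
  proof -
    have "\<Psi> 0 ` Some ` B = \<Phi> 0 ` B" by (auto simp: \<Psi>_def image_iff)
    moreover have "fv.span (\<Phi> 0 ` B) \<subseteq> fv.span (\<Phi> 0 ` C)" by (intro fv.span_mono image_mono B(1))
    moreover have "\<Psi> 0 None = k 0" by (simp add: \<Psi>_def)
    ultimately show ?thesis using n by auto
  qed
  ultimately have "indf (\<Psi> 0) ?B" by (rule indf_insert)
  moreover have "rpoly (\<lambda>t. \<Psi> t b i)" for b i
  proof (cases b)
    case None
    then have "(\<lambda>t. \<Psi> t b i) = (\<lambda>t. \<Sum>c\<in>F. \<beta> c * (\<Phi>1 c i + of_real t * r t c i))"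
      by (simp add: \<Psi>_def k_def)
    moreover have "rpoly (\<lambda>t. \<Sum>c\<in>F. \<beta> c * (\<Phi>1 c i + of_real t * r t c i))"
      by (intro rpoly_sum rpoly_mult rpoly_add rpoly_const rpoly_id assms(4))
    ultimately show ?thesis by simp
  next
    case (Some c)
    have "(\<lambda>t. \<Psi> t b i) = (\<lambda>t. \<Phi> 0 c i + of_real t * \<Phi>1 c i + of_real t ^ 2 * r t c i)"
      by (rule ext, simp only: \<Psi>_def Some option.case) (rule assms(3))
    moreover have "rpoly (\<lambda>t. \<Phi> 0 c i + of_real t * \<Phi>1 c i + of_real t ^ 2 * r t c i)"
      by (intro rpoly_mult rpoly_add rpoly_const rpoly_power rpoly_id assms(4))
    ultimately show ?thesis by simp
  qed
  ultimately have "finite {t. \<not> indf (\<Psi> t) ?B}" by (intro indf_cofinite) auto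
  then have "finite {t. \<not> (indf (\<Psi> t) ?B \<and> t \<noteq> 0)}" by (intro cofinite_conj) auto
  then have "\<exists>t. indf (\<Psi> t) ?B \<and> t \<noteq> 0" by (rule cofinite_ex)
  then obtain t where t: "indf (\<Psi> t) ?B" "t \<noteq> 0" by blast
  have kt: "k t i = (\<Sum>c\<in>F. (\<beta> c / of_real t) * \<Phi> t c i)" for i
  proof -
    have "(\<Sum>c\<in>F. (\<beta> c / of_real t) * \<Phi> t c i)
        = (\<Sum>c\<in>F. (\<beta> c * \<Phi> 0 c i) / of_real t + \<beta> c * (\<Phi>1 c i + of_real t * r t c i))"
      using t(2) by (intro sum.cong refl, subst assms(3)) (simp add: field_simps power2_eq_square)
    also have "\<dots> = (\<Sum>c\<in>F. \<beta> c * \<Phi> 0 c i) / of_real t + k t i"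
      by (simp add: sum.distrib sum_divide_distrib k_def)
    finally show ?thesis using assms(7) by simp
  qed
  have bdt: "bd (\<Psi> t)"
    unfolding bd_def using I by (intro exI[of _ I]) (auto simp: \<Psi>_def kt split: option.splits)
  have "\<Psi> t d \<in> fv.span (\<Phi> t ` C)" if "d \<in> ?B" for d
  proof (cases d)
    case None
    show ?thesis using assms(5,6) kt
      by (intro span_famI[of F C _ "\<lambda>c. \<beta> c / of_real t"]) (auto simp: \<Psi>_def None)
  next
    case (Some c)
    then show ?thesis using that B by (auto simp: \<Psi>_def intro!: span_fam_base)
  qed
  then have "rk (\<Psi> t) ?B \<le> rk (\<Phi> t) C" by (intro rk_le_span ubd_bd[OF assms(1)] bdt)
  moreover have "card ?B \<le> rk (\<Psi> t) ?B" using rk_ge[OF bdt _ t(1)] by blast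
  moreover have "card ?B = Suc (card B)" using fin by (simp add: card_image)
  ultimately show False using assms(2)[of t] B(3) by simp
qed

section \<open>Polynomial functions and their jets along a direction\<close>

inductive polyfun :: "((nat \<Rightarrow> complex) \<Rightarrow> complex) \<Rightarrow> bool" where
  polyfun_const: "polyfun (\<lambda>x. c)"
| polyfun_coord: "polyfun (\<lambda>x. x j)"
| polyfun_add: "polyfun f \<Longrightarrow> polyfun g \<Longrightarrow> polyfun (\<lambda>x. f x + g x)"
| polyfun_mult: "polyfun f \<Longrightarrow> polyfun g \<Longrightarrow> polyfun (\<lambda>x. f x * g x)"

lemma polyfun_sum: "(\<And>a. a \<in> S \<Longrightarrow> polyfun (f a)) \<Longrightarrow> polyfun (\<lambda>x. \<Sum>a\<in>S. f a x)"
  by (induction S rule: infinite_finite_induct) (auto intro: polyfun.intros)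

lemma polyfun_prod: "(\<And>a. a \<in> S \<Longrightarrow> polyfun (f a)) \<Longrightarrow> polyfun (\<lambda>x. \<Prod>a\<in>S. f a x)"
  by (induction S rule: infinite_finite_induct) (auto intro: polyfun.intros)

lemma polyfun_power: "polyfun f \<Longrightarrow> polyfun (\<lambda>x. f x ^ k)"
  by (induction k) (auto intro: polyfun.intros)

lemma polyfun_rpoly:
  assumes "polyfun f" "\<And>j. rpoly (\<lambda>t. z t j)"
  shows "rpoly (\<lambda>t. f (z t))"
  using assms by (induction rule: polyfun.induct) auto

text \<open>The expansion of \<open>f\<close> at \<open>y\<close> in the direction \<open>e\<close>.
  Besides existence, two uniform facts are carried through the induction: a degree bound, for
  writing values as finite sums of jets, and polynomial dependence on \<open>y\<close> and
  \<open>e\<close>, for genericity of ranks of jets.\<close>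

lemma polyfun_jets:
  assumes "polyfun f"
  shows "\<exists>P K. (\<forall>y e s. poly (P y e) s = f (\<lambda>a. y a + s * e a)) \<and> (\<forall>y e. degree (P y e) \<le> (K::nat)) \<and>
    (\<forall>y e l. (\<forall>j. rpoly (\<lambda>t. y t j)) \<longrightarrow> (\<forall>j. rpoly (\<lambda>t. e t j)) \<longrightarrow> rpoly (\<lambda>t. coeff (P (y t) (e t)) l))"
  using assms
proof (induction rule: polyfun.induct)
  case (polyfun_const c)
  show ?case by (rule exI[of _ "\<lambda>y e. [:c:]"], rule exI[of _ 0]) auto
next
  case (polyfun_coord j)
  show ?case
  proof (rule exI[of _ "\<lambda>y e. [:y j, e j:]"], rule exI[of _ 1], intro conjI allI impI)
    fix y e :: "real \<Rightarrow> nat \<Rightarrow> complex" and l :: nat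
    assume a: "\<forall>j. rpoly (\<lambda>t. y t j)" "\<forall>j. rpoly (\<lambda>t. e t j)"
    show "rpoly (\<lambda>t. coeff [:y t j, e t j:] l)"
    proof (cases l)
      case 0
      then show ?thesis using a by simp
    next
      case (Suc k)
      then show ?thesis using a by (cases k) auto
    qed
  qed auto
next
  case (polyfun_add f g)
  obtain P K Q L where
    P: "\<forall>y e s. poly (P y e) s = f (\<lambda>a. y a + s * e a)" "\<forall>y e. degree (P y e) \<le> (K::nat)"
       "\<forall>y e l. (\<forall>j. rpoly (\<lambda>t. y t j)) \<longrightarrow> (\<forall>j. rpoly (\<lambda>t. e t j)) \<longrightarrow> rpoly (\<lambda>t. coeff (P (y t) (e t)) l)"
    and Q: "\<forall>y e s. poly (Q y e) s = g (\<lambda>a. y a + s * e a)" "\<forall>y e. degree (Q y e) \<le> (L::nat)"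
       "\<forall>y e l. (\<forall>j. rpoly (\<lambda>t. y t j)) \<longrightarrow> (\<forall>j. rpoly (\<lambda>t. e t j)) \<longrightarrow> rpoly (\<lambda>t. coeff (Q (y t) (e t)) l)"
    using polyfun_add.IH by blast
  show ?case
  proof (rule exI[of _ "\<lambda>y e. P y e + Q y e"], rule exI[of _ "max K L"], intro conjI allI impI)
    fix y e show "degree (P y e + Q y e) \<le> max K L"
      using P(2) Q(2) by (meson degree_add_le_max le_trans max.mono)
  qed (use P Q in auto)
next
  case (polyfun_mult f g)
  obtain P K Q L where
    P: "\<forall>y e s. poly (P y e) s = f (\<lambda>a. y a + s * e a)" "\<forall>y e. degree (P y e) \<le> (K::nat)"
       "\<forall>y e l. (\<forall>j. rpoly (\<lambda>t. y t j)) \<longrightarrow> (\<forall>j. rpoly (\<lambda>t. e t j)) \<longrightarrow> rpoly (\<lambda>t. coeff (P (y t) (e t)) l)"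
    and Q: "\<forall>y e s. poly (Q y e) s = g (\<lambda>a. y a + s * e a)" "\<forall>y e. degree (Q y e) \<le> (L::nat)"
       "\<forall>y e l. (\<forall>j. rpoly (\<lambda>t. y t j)) \<longrightarrow> (\<forall>j. rpoly (\<lambda>t. e t j)) \<longrightarrow> rpoly (\<lambda>t. coeff (Q (y t) (e t)) l)"
    using polyfun_mult.IH by blast
  show ?case
  proof (rule exI[of _ "\<lambda>y e. P y e * Q y e"], rule exI[of _ "K + L"], intro conjI allI impI)
    fix y e show "degree (P y e * Q y e) \<le> K + L"
      using P(2) Q(2) by (meson degree_mult_le le_trans add_mono)
  next
    fix y e :: "real \<Rightarrow> nat \<Rightarrow> complex" and l
    assume "\<forall>j. rpoly (\<lambda>t. y t j)" "\<forall>j. rpoly (\<lambda>t. e t j)"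
    then show "rpoly (\<lambda>t. coeff (P (y t) (e t) * Q (y t) (e t)) l)"
      unfolding coeff_mult by (intro rpoly_sum rpoly_mult) (use P(3) Q(3) in blast)+
  qed (use P Q in auto)
qed

definition jpoly :: "((nat \<Rightarrow> complex) \<Rightarrow> complex) \<Rightarrow> (nat \<Rightarrow> complex) \<Rightarrow> (nat \<Rightarrow> complex) \<Rightarrow> complex poly" where
  "jpoly f y e = (THE p. \<forall>s. poly p s = f (\<lambda>a. y a + s * e a))"

lemma jpoly_eqI:
  assumes "\<And>s. poly p s = f (\<lambda>a. y a + s * e a)"
  shows "jpoly f y e = p"
  unfolding jpoly_def
proof (rule the_equality)
  show "\<forall>s. poly p s = f (\<lambda>a. y a + s * e a)" using assms by blast
  fix q assume "\<forall>s. poly q s = f (\<lambda>a. y a + s * e a)"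
  then have "poly q = poly p" using assms by auto
  then show "q = p" by (simp add: poly_eq_poly_eq_iff)
qed

lemma polyfun_jpoly:
  assumes "polyfun f"
  shows "poly (jpoly f y e) s = f (\<lambda>a. y a + s * e a)"
    and "\<exists>K. \<forall>y e. degree (jpoly f y e) \<le> K"
    and "(\<And>j. rpoly (\<lambda>t. z t j)) \<Longrightarrow> (\<And>j. rpoly (\<lambda>t. w t j)) \<Longrightarrow> rpoly (\<lambda>t. coeff (jpoly f (z t) (w t)) l)"
proof -
  obtain P K where P: "\<forall>y e s. poly (P y e) s = f (\<lambda>a. y a + s * e a)" "\<forall>y e. degree (P y e) \<le> (K::nat)"
       "\<forall>y e l. (\<forall>j. rpoly (\<lambda>t. y t j)) \<longrightarrow> (\<forall>j. rpoly (\<lambda>t. e t j)) \<longrightarrow> rpoly (\<lambda>t. coeff (P (y t) (e t)) l)"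
    using polyfun_jets[OF assms] by blast
  have eq: "jpoly f y e = P y e" for y e using P(1) by (intro jpoly_eqI) auto
  show "poly (jpoly f y e) s = f (\<lambda>a. y a + s * e a)" "\<exists>K. \<forall>y e. degree (jpoly f y e) \<le> K"
    "(\<And>j. rpoly (\<lambda>t. z t j)) \<Longrightarrow> (\<And>j. rpoly (\<lambda>t. w t j)) \<Longrightarrow> rpoly (\<lambda>t. coeff (jpoly f (z t) (w t)) l)"
    using P by (auto simp: eq)
qed

lemma jpoly_shift:
  assumes "polyfun f"
  shows "jpoly f (\<lambda>a. y a + \<tau> * e a) e = pcompose (jpoly f y e) [:\<tau>, 1:]"
  by (rule jpoly_eqI) (simp add: poly_pcompose polyfun_jpoly(1)[OF assms] algebra_simps)

text \<open>Taylor expansion in the shift \<open>\<tau>\<close>: to first order the coefficient of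
  \<open>s ^ l\<close> changes by \<open>l + 1\<close> times the next one. The remainder has to be
  polynomial in \<open>\<tau>\<close> for \<open>pencil_relation\<close>.\<close>

lemma coeff_shift_expansion:
  fixes p :: "complex poly"
  shows "\<exists>R. \<forall>\<tau>. coeff (pcompose p [:\<tau>, 1:]) l
      = coeff p l + \<tau> * (of_nat (Suc l) * coeff p (Suc l)) + \<tau>^2 * poly R \<tau>"
proof (induction p arbitrary: l)
  case 0
  show ?case by (rule exI[of _ 0]) simp
next
  case (pCons a p)
  have c: "coeff (pcompose (pCons a p) [:\<tau>, 1:]) l = (if l = 0 then a else coeff (pcompose p [:\<tau>, 1:]) (l - 1))
      + \<tau> * coeff (pcompose p [:\<tau>, 1:]) l" for \<tau>
    by (cases l) (auto simp: pcompose_pCons coeff_pCons)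
  obtain R where R: "\<forall>\<tau>. coeff (pcompose p [:\<tau>, 1:]) l
      = coeff p l + \<tau> * (of_nat (Suc l) * coeff p (Suc l)) + \<tau>^2 * poly R \<tau>"
    using pCons.IH by blast
  show ?case
  proof (cases l)
    case 0
    show ?thesis
    proof (rule exI[of _ "[:coeff p 1:] + [:0, 1:] * R"], rule allI)
      fix \<tau>
      show "coeff (pcompose (pCons a p) [:\<tau>, 1:]) l = coeff (pCons a p) l
        + \<tau> * (of_nat (Suc l) * coeff (pCons a p) (Suc l)) + \<tau>^2 * poly ([:coeff p 1:] + [:0, 1:] * R) \<tau>"
        unfolding c R[rule_format] using 0 by (simp add: algebra_simps power2_eq_square)
    qed
  next
    case (Suc k)
    obtain R' where R': "\<forall>\<tau>. coeff (pcompose p [:\<tau>, 1:]) k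
      = coeff p k + \<tau> * (of_nat (Suc k) * coeff p (Suc k)) + \<tau>^2 * poly R' \<tau>"
      using pCons.IH by blast
    show ?thesis
    proof (rule exI[of _ "[:of_nat (Suc l) * coeff p (Suc l):] + [:0, 1:] * R + R'"], rule allI)
      fix \<tau>
      have "coeff (pcompose p [:\<tau>, 1:]) (l - 1)
         = coeff p k + \<tau> * (of_nat (Suc k) * coeff p (Suc k)) + \<tau>^2 * poly R' \<tau>"
        using Suc R' by simp
      then show "coeff (pcompose (pCons a p) [:\<tau>, 1:]) l = coeff (pCons a p) l
        + \<tau> * (of_nat (Suc l) * coeff (pCons a p) (Suc l))
        + \<tau>^2 * poly ([:of_nat (Suc l) * coeff p (Suc l):] + [:0, 1:] * R + R') \<tau>"
        unfolding c R[rule_format] using Suc by (simp add: algebra_simps power2_eq_square)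
    qed
  qed
qed

section \<open>Ranks along generic linear subspaces\<close>

definition unit :: "nat \<Rightarrow> nat \<Rightarrow> complex" where
  "unit j = (\<lambda>i. if i = j then 1 else 0)"

text \<open>A configuration \<open>q\<close> lists vectors \<open>q (0, _), q (1, _), \<dots>\<close>, and \<open>pt b q\<close> parametrises the span
  of the first \<open>b\<close> of them. Thus \<open>mr h b\<close> is the rank of \<open>h\<close> on a generic subspace of dimension \<open>b\<close>.\<close>

definition pt :: "nat \<Rightarrow> (nat \<times> nat \<Rightarrow> complex) \<Rightarrow> (nat \<Rightarrow> complex) \<Rightarrow> nat \<Rightarrow> complex" where
  "pt b q c = (\<lambda>a. \<Sum>j<b. c j * q (j, a))"

text \<open>Vector-valued polynomial maps, with polynomiality tested along curves. In this form it
  passes to compositions with \<open>pt\<close> and to quotients without an algebra of polynomials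
  in several variables.\<close>

definition rvec :: "((nat \<Rightarrow> complex) \<Rightarrow> 'i \<Rightarrow> complex) \<Rightarrow> bool" where
  "rvec \<psi> \<longleftrightarrow> bd \<psi> \<and> (\<forall>z. (\<forall>j. rpoly (\<lambda>t. z t j)) \<longrightarrow> (\<forall>i. rpoly (\<lambda>t. \<psi> (z t) i)))"

definition mr :: "((nat \<Rightarrow> complex) \<Rightarrow> 'i \<Rightarrow> complex) \<Rightarrow> nat \<Rightarrow> nat" where
  "mr h b = maxrk (\<lambda>q c. h (pt b q c)) UNIV"

lemma rvec_bd: "rvec h \<Longrightarrow> bd h"
  by (simp add: rvec_def)

lemma rvec_rpoly: "rvec h \<Longrightarrow> (\<And>j. rpoly (\<lambda>t. z t j)) \<Longrightarrow> rpoly (\<lambda>t. h (z t) i)"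
  by (simp add: rvec_def)

lemma rpoly_pt:
  assumes "\<And>j a. rpoly (\<lambda>t. q t (j, a))" "\<And>j. rpoly (\<lambda>t. c t j)"
  shows "rpoly (\<lambda>t. pt b (q t) (c t) a)"
  unfolding pt_def by (intro rpoly_sum rpoly_mult assms)

lemma pt_unit: "j < b \<Longrightarrow> pt b q (unit j) = (\<lambda>a. q (j, a))"
proof
  fix a assume "j < b"
  have "(\<Sum>i<b. unit j i * q (i, a)) = (\<Sum>i<b. if i = j then q (i, a) else 0)"
    by (intro sum.cong) (auto simp: unit_def)
  then show "pt b q (unit j) a = q (j, a)" using \<open>j < b\<close> by (simp add: pt_def)
qed

lemma pt_cong: "(\<And>j. j < b \<Longrightarrow> c j = c' j) \<Longrightarrow> pt b q c = pt b q c'"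
  by (simp add: pt_def)

lemma pt_cong_q: "(\<And>j a. j < b \<Longrightarrow> q (j, a) = q' (j, a)) \<Longrightarrow> pt b q c = pt b q' c"
  by (simp add: pt_def)

lemma pt_restrict:
  assumes "i \<le> b" "\<And>j. i \<le> j \<Longrightarrow> j < b \<Longrightarrow> c j = 0"
  shows "pt b q c = pt i q c"
proof
  fix a
  show "pt b q c a = pt i q c a"
    unfolding pt_def using assms by (intro sum.mono_neutral_right) auto
qed

lemma pt_Suc: "pt (Suc b) q c = (\<lambda>a. pt b q c a + c b * q (b, a))"
  by (simp add: pt_def)

lemma pt_pt: "pt m q (pt k p c) = pt k (\<lambda>(j, a). pt m q (\<lambda>i. p (j, i)) a) c"
proof
  fix a
  have "pt m q (pt k p c) a = (\<Sum>j<m. \<Sum>l<k. c l * (p (l, j) * q (j, a)))"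
    by (simp add: pt_def sum_distrib_right mult.assoc)
  also have "\<dots> = (\<Sum>l<k. \<Sum>j<m. c l * (p (l, j) * q (j, a)))" by (rule sum.swap)
  also have "\<dots> = pt k (\<lambda>(j, a). pt m q (\<lambda>i. p (j, i)) a) c a"
    by (simp add: pt_def sum_distrib_left)
  finally show "pt m q (pt k p c) a = pt k (\<lambda>(j, a). pt m q (\<lambda>i. p (j, i)) a) c a" .
qed

lemma rvec_pt:
  assumes "rvec h"
  shows "rvec (\<lambda>c. h (pt b q c))"
  unfolding rvec_def
proof (intro conjI allI impI)
  show "bd (\<lambda>c. h (pt b q c))" using rvec_bd[OF assms] unfolding bd_def by blast
  fix z :: "real \<Rightarrow> nat \<Rightarrow> complex" and i assume "\<forall>j. rpoly (\<lambda>t. z t j)"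
  then show "rpoly (\<lambda>t. h (pt b q (z t)) i)"
    by (intro rvec_rpoly[OF assms] rpoly_pt) auto
qed

lemma ubd_pt: "rvec h \<Longrightarrow> ubd (\<lambda>q c. h (pt b q c))"
  using rvec_bd[of h] unfolding bd_def ubd_def by blast

lemma bd_pt: "rvec h \<Longrightarrow> bd (\<lambda>c. h (pt b q c))"
  using rvec_bd[OF rvec_pt] .

lemma mr_ge: "rvec h \<Longrightarrow> rk (\<lambda>c. h (pt b q c)) UNIV \<le> mr h b"
  unfolding mr_def by (rule maxrk_ge[OF ubd_pt])

lemma gen_mr:
  assumes "rvec h"
  shows "gen (\<lambda>q. r \<le> rk (\<lambda>c. h (pt b q c)) C)"
  by (rule gen_rk[OF ubd_pt[OF assms]]) (intro rvec_rpoly[OF assms] rpoly_pt rpoly_pline rpoly_const)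

lemma mr_ex:
  assumes "rvec h"
  shows "\<exists>q. mr h b \<le> rk (\<lambda>c. h (pt b q c)) UNIV"
  using maxrk_attained[OF ubd_pt[OF assms], of b UNIV] unfolding mr_def by (metis order_refl)

lemma rk_pt_mono:
  assumes "rvec h" "i \<le> b"
  shows "rk (\<lambda>c. h (pt i q c)) UNIV \<le> rk (\<lambda>c. h (pt b q c)) {c. \<forall>j\<ge>i. c j = 0}"
proof (rule rk_le_image[OF bd_pt[OF assms(1)] bd_pt[OF assms(1)]])
  fix c :: "nat \<Rightarrow> complex"
  let ?c = "\<lambda>j. if j < i then c j else 0"
  have "pt b q ?c = pt i q ?c" using assms(2) by (intro pt_restrict) auto
  also have "pt i q ?c = pt i q c" by (intro pt_cong) auto
  finally show "\<exists>d\<in>{c. \<forall>j\<ge>i. c j = 0}. h (pt i q c) = h (pt b q d)"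
    by (intro bexI[of _ ?c]) auto
qed

lemma rk_pt_less:
  assumes "rvec h" "i \<le> b" "\<And>c. c \<in> C \<Longrightarrow> \<forall>j. i \<le> j \<longrightarrow> j < b \<longrightarrow> c j = 0"
  shows "rk (\<lambda>c. h (pt b q c)) C \<le> rk (\<lambda>c. h (pt i q c)) UNIV"
proof (rule rk_le_image[OF bd_pt[OF assms(1)] bd_pt[OF assms(1)]])
  fix c assume "c \<in> C"
  then have "pt b q c = pt i q c" using assms by (intro pt_restrict) auto
  then show "\<exists>d\<in>UNIV. h (pt b q c) = h (pt i q d)" by auto
qed

lemma indf_reindex:
  assumes "inj_on e J" "indf \<phi> (e ` J)"
  shows "indf (\<lambda>j. \<phi> (e j)) J"
proof (rule indfI)
  show "finite J" using indf_finite[OF assms(2)] assms(1) by (simp add: finite_image_iff)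
  fix \<beta> b assume z: "\<And>i. (\<Sum>j\<in>J. \<beta> j * \<phi> (e j) i) = 0" and b: "b \<in> J"
  have "(\<Sum>x\<in>e ` J. \<beta> (inv_into J e x) * \<phi> x i) = 0" for i
  proof -
    have "(\<Sum>x\<in>e ` J. \<beta> (inv_into J e x) * \<phi> x i) = (\<Sum>j\<in>J. \<beta> (inv_into J e (e j)) * \<phi> (e j) i)"
      using assms(1) by (simp add: sum.reindex)
    also have "\<dots> = (\<Sum>j\<in>J. \<beta> j * \<phi> (e j) i)" using assms(1) by (intro sum.cong) auto
    finally show ?thesis using z by simp
  qed
  from indfD[OF assms(2), of "\<lambda>x. \<beta> (inv_into J e x)" "e b", OF this] b assms(1)
  show "\<beta> b = 0" by simp
qed

lemma indf_image:
  assumes "indf (\<lambda>j. \<phi> (e j)) J"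
  shows "inj_on e J" "indf \<phi> (e ` J)"
proof -
  show inj: "inj_on e J" using indf_inj[OF assms] by (auto simp: inj_on_def)
  show "indf \<phi> (e ` J)"
  proof (rule indfI)
    show "finite (e ` J)" using indf_finite[OF assms] by simp
    fix \<beta> b assume z: "\<And>i. (\<Sum>b\<in>e ` J. \<beta> b * \<phi> b i) = 0" and b: "b \<in> e ` J"
    have "(\<Sum>j\<in>J. \<beta> (e j) * \<phi> (e j) i) = 0" for i using z[of i] inj by (simp add: sum.reindex)
    then show "\<beta> b = 0" using indfD[OF assms, of "\<lambda>j. \<beta> (e j)"] b by blast
  qed
qed

lemma full_span:
  assumes "finite I" "indf \<phi> B" "card B = card I" "\<And>b i. b \<in> B \<Longrightarrow> i \<notin> I \<Longrightarrow> \<phi> b i = 0"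
    "\<And>i. i \<notin> I \<Longrightarrow> v i = 0"
  shows "v \<in> fv.span (\<phi> ` B)"
proof (rule ccontr)
  assume n: "v \<notin> fv.span (\<phi> ` B)"
  have "indf (\<lambda>x. x) (\<phi> ` B)" using indf_image(2)[of "\<lambda>x. x" \<phi> B] assms(2) by simp
  moreover have "v \<notin> fv.span ((\<lambda>x. x) ` \<phi> ` B)" using n by simp
  ultimately have ind: "indf (\<lambda>x. x) (insert v (\<phi> ` B))" by (rule indf_insert)
  have "v \<notin> \<phi> ` B" using n fv.span_superset by blast
  then have "card (insert v (\<phi> ` B)) = Suc (card B)"
    using indf_finite[OF assms(2)] indf_inj[OF assms(2)] by (simp add: card_image)
  moreover have "card (insert v (\<phi> ` B)) \<le> card I"
  proof (rule indf_card_le[OF ind assms(1)])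
    fix x assume "x \<in> insert v (\<phi> ` B)"
    then have "x i = 0" if "i \<notin> I" for i using assms(4,5) that by blast
    then show "x \<in> fv.span ((\<lambda>j i. if i = j then 1 else 0) ` I)" by (intro bd_span[OF assms(1)])
  qed
  ultimately show False using assms(3) by simp
qed

lemma indf_extend_ex:
  assumes "bd \<phi>" "indf \<phi> B"
  shows "\<exists>B'. B \<subseteq> B' \<and> indf \<phi> B' \<and> card B' = rk \<phi> UNIV"
  by (rule indf_extend[OF assms(1) subset_UNIV assms(2)]) blast

lemma points_rank:
  assumes "rvec h" "indf h B" "card B \<le> b"
  shows "card B \<le> mr h b"
proof -
  obtain e where e: "bij_betw e {..<card B} B"
    using indf_finite[OF assms(2)] ex_bij_betw_nat_finite[of B] by (auto simp: atLeast0LessThan)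
  define q where "q = (\<lambda>(j, a). e j a)"
  have "card B \<le> rk h B" using rk_ge[OF rvec_bd[OF assms(1)] order_refl assms(2)] .
  also have "\<dots> \<le> rk (\<lambda>c. h (pt b q c)) UNIV"
  proof (rule rk_le_image[OF bd_pt[OF assms(1)] rvec_bd[OF assms(1)]])
    fix x assume "x \<in> B"
    then obtain j where j: "j < card B" "x = e j" using e unfolding bij_betw_def by auto
    then have "pt b q (unit j) = x" using assms(3) by (subst pt_unit) (auto simp: q_def)
    then show "\<exists>c\<in>UNIV. h x = h (pt b q c)" by (intro bexI[of _ "unit j"]) auto
  qed
  also have "\<dots> \<le> mr h b" by (rule mr_ge[OF assms(1)])
  finally show ?thesis .
qed

lemma mr_ge_min: 
  assumes "rvec h"
  shows "min b (rk h UNIV) \<le> mr h b"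
proof -
  obtain B where B: "indf h B" "card B = min b (rk h UNIV)"
    using rk_geE[OF rvec_bd[OF assms], of "min b (rk h UNIV)" UNIV] by auto
  then show ?thesis using points_rank[OF assms B(1), of b] by simp
qed

text \<open>One value is gained over \<open>mr_ge_min\<close>: two vectors spanning the special
  plane account for three independent values, and each further value costs one vector.\<close>

lemma mr_ge_min_line:
  assumes "rvec h" "3 \<le> rk (\<lambda>c. h (pt 2 q c)) UNIV" "2 \<le> i"
  shows "min (i + 1) (rk h UNIV) \<le> mr h i"
proof -
  obtain B3 where B3: "indf (\<lambda>c. h (pt 2 q c)) B3" "card B3 = 3"
    using rk_geE[OF bd_pt[OF assms(1)] assms(2)] by auto
  let ?P = "pt 2 q ` B3"
  have P: "indf h ?P" "card ?P = 3" using indf_image[of h "pt 2 q" B3] B3 by (auto simp: card_image)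
  obtain B where B: "?P \<subseteq> B" "indf h B" "card B = rk h UNIV"
    using indf_extend_ex[OF rvec_bd[OF assms(1)] P(1)] by blast
  have finB: "finite B" using indf_finite[OF B(2)] .
  have "3 \<le> card B" using card_mono[OF finB B(1)] P(2) by simp
  then obtain B' where B': "?P \<subseteq> B'" "B' \<subseteq> B" "card B' = min (i + 1) (card B)"
    using exists_subset_between[of ?P "min (i + 1) (card B)" B] P(2) finB assms(3) B(1) by auto
  have indB': "indf h B'" using indf_subset[OF B(2) B'(2)] .
  have finB': "finite B'" using indf_finite[OF indB'] .
  let ?D = "B' - ?P"
  have cD: "card ?D \<le> i - 2"
    using B'(1,3) P(2) finB' by (subst card_Diff_subset) (auto intro: finite_subset)
  obtain e where e: "bij_betw e {..<card ?D} ?D"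
    using finB' ex_bij_betw_nat_finite[of ?D] by (auto simp: atLeast0LessThan)
  define q' where "q' = (\<lambda>(j, a). if j < 2 then q (j, a) else e (j - 2) a)"
  have "min (i + 1) (rk h UNIV) = card B'" using B' B(3) by simp
  also have "\<dots> \<le> rk h B'" using rk_ge[OF rvec_bd[OF assms(1)] order_refl indB'] .
  also have "\<dots> \<le> rk (\<lambda>c. h (pt i q' c)) UNIV"
  proof (rule rk_le_image[OF bd_pt[OF assms(1)] rvec_bd[OF assms(1)]])
    fix x assume x: "x \<in> B'"
    have "\<exists>c. pt i q' c = x"
    proof (cases "x \<in> ?P")
      case True
      then obtain c where c: "x = pt 2 q c" by blast
      let ?c = "\<lambda>j. if j < 2 then c j else 0"
      have "pt i q' ?c = pt 2 q' ?c" using assms(3) by (intro pt_restrict) auto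
      also have "\<dots> = pt 2 q c" by (simp add: pt_def q'_def)
      finally show ?thesis using c by blast
    next
      case False
      then obtain j where j: "j < card ?D" "x = e j" using e x unfolding bij_betw_def by blast
      then have "pt i q' (unit (j + 2)) = x" using cD assms(3) by (subst pt_unit) (auto simp: q'_def)
      then show ?thesis by blast
    qed
    then show "\<exists>c\<in>UNIV. h x = h (pt i q' c)" by auto
  qed
  also have "\<dots> \<le> mr h i" by (rule mr_ge[OF assms(1)])
  finally show ?thesis .
qed

text \<open>Multiplication by a scalar function does not shrink the span: a point where
  \<open>l\<close> vanishes is a limit along \<open>z\<close> of points where it does not.\<close>

lemma scale_span:
  assumes "bd \<phi>" "\<And>i. rpoly (\<lambda>t. \<phi> (z t) i)" "finite {t. l (z t) = 0}"
  shows "\<phi> (z t0) \<in> fv.span ((\<lambda>c i. l c * \<phi> c i) ` UNIV)"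
proof (rule span_closed)
  show "bd (\<lambda>c i. l c * \<phi> c i)" using assms(1) unfolding bd_def by force
  show "finite {t. \<not> \<phi> (z t) \<in> fv.span ((\<lambda>c i. l c * \<phi> c i) ` UNIV)}"
  proof (rule finite_subset[OF _ assms(3)], rule subsetI, rule ccontr)
    fix t assume "t \<in> {t. \<not> \<phi> (z t) \<in> fv.span ((\<lambda>c i. l c * \<phi> c i) ` UNIV)}" "t \<notin> {t. l (z t) = 0}"
    moreover have "\<phi> (z t) \<in> fv.span ((\<lambda>c i. l c * \<phi> c i) ` UNIV)" if "l (z t) \<noteq> 0"
      using that by (intro span_famI[of "{z t}" _ _ "\<lambda>_. inverse (l (z t))"]) auto
    ultimately show False by blast
  qed
qed (rule assms(2))

text \<open>The family \<open>z \<otimes> k z\<close> for \<open>z = pt b q c\<close>, in coordinates.\<close>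

definition tfam :: "((nat \<Rightarrow> complex) \<Rightarrow> 'i \<Rightarrow> complex) \<Rightarrow> nat \<Rightarrow> (nat \<times> nat \<Rightarrow> complex) \<Rightarrow>
    (nat \<Rightarrow> complex) \<Rightarrow> nat \<times> 'i \<Rightarrow> complex" where
  "tfam k b q c = (\<lambda>(j, i). if j < b then c j * k (pt b q c) i else 0)"

lemma bd_tfam: "rvec k \<Longrightarrow> bd (tfam k b q)"
proof -
  assume "rvec k"
  then obtain I where I: "finite I" "\<forall>c i. i \<notin> I \<longrightarrow> k c i = 0" using rvec_bd unfolding bd_def by blast
  have "tfam k b q c p = 0" if "p \<notin> {..<b} \<times> I" for c p
    using that I(2) by (cases p) (auto simp: tfam_def)
  then show ?thesis unfolding bd_def using I(1) by (intro exI[of _ "{..<b} \<times> I"]) auto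
qed

text \<open>Induction on the last vector. On the hyperplane \<open>c b = 0\<close> the family is the
  one of the first \<open>b\<close> vectors, and the component \<open>c b * k\<close>, which
  vanishes there, still has the full rank of \<open>k\<close> on \<open>b + 1\<close>
  vectors.\<close>

lemma tensor_rank:
  assumes "rvec k"
  shows "(\<Sum>i=1..b. rk (\<lambda>c. k (pt i q c)) UNIV) \<le> rk (tfam k b q) UNIV"
proof (induction b)
  case (Suc b)
  let ?\<psi> = "\<lambda>c i. c b * k (pt (Suc b) q c) i"
  have "rk (tfam k b q) UNIV \<le> rk (tfam k (Suc b) q) {c. c b = 0}"
  proof (rule rk_le_image[OF bd_tfam[OF assms] bd_tfam[OF assms]])
    fix c :: "nat \<Rightarrow> complex"
    have "pt (Suc b) q (c(b := 0)) = pt b q (c(b := 0))" by (simp add: pt_Suc)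
    also have "\<dots> = pt b q c" by (intro pt_cong) auto
    finally have eq: "pt (Suc b) q (c(b := 0)) = pt b q c" .
    have "tfam k b q c = tfam k (Suc b) q (c(b := 0))"
      by (rule ext) (auto simp: tfam_def eq less_Suc_eq split: prod.splits)
    then show "\<exists>d\<in>{c. c b = 0}. tfam k b q c = tfam k (Suc b) q d" by (intro bexI[of _ "c(b := 0)"]) auto
  qed
  moreover have "rk (\<lambda>c. k (pt (Suc b) q c)) UNIV \<le> rk ?\<psi> UNIV"
  proof (rule rk_le_span[OF _ bd_pt[OF assms]])
    show bd\<psi>: "bd ?\<psi>" using bd_pt[OF assms, of "Suc b" q] unfolding bd_def by force
    fix c :: "nat \<Rightarrow> complex"
    let ?z = "\<lambda>t::real. \<lambda>j. c j + of_real t * unit b j"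
    have r: "rpoly (\<lambda>t. ?z t j)" for j by (intro rpoly_add rpoly_mult rpoly_const rpoly_id)
    have "rpoly (\<lambda>t. ?z t b)" by (rule r)
    moreover have "?z (1 + \<bar>Re (c b)\<bar>) b \<noteq> 0" by (auto simp: unit_def complex_eq_iff)
    ultimately have "finite {t. ?z t b = 0}" by (rule rpoly_finite)
    then have "k (pt (Suc b) q (?z 0)) \<in> fv.span ((\<lambda>c i. c b * k (pt (Suc b) q c) i) ` UNIV)"
      using r by (intro scale_span[where l = "\<lambda>c. c b" and z = ?z and \<phi> = "\<lambda>c. k (pt (Suc b) q c)"]
        bd_pt[OF assms] rvec_rpoly[OF rvec_pt[OF assms]])
    then show "k (pt (Suc b) q c) \<in> fv.span (?\<psi> ` UNIV)" by simp
  qed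
  moreover have "rk (tfam k (Suc b) q) {c. c b = 0} + rk ?\<psi> UNIV \<le> rk (tfam k (Suc b) q) UNIV"
  proof (rule rk_add[OF bd_tfam[OF assms]])
    show "bd ?\<psi>" using bd_pt[OF assms, of "Suc b" q] unfolding bd_def by force
    show "relfac (tfam k (Suc b) q) ?\<psi> UNIV"
      unfolding relfac_def
    proof (intro allI impI)
      fix F :: "(nat \<Rightarrow> complex) set" and \<beta> i assume "\<forall>p. (\<Sum>c\<in>F. \<beta> c * tfam k (Suc b) q c p) = 0"
      from this[rule_format, of "(b, i)"]
      show "(\<Sum>c\<in>F. \<beta> c * (c b * k (pt (Suc b) q c) i)) = 0" by (simp add: tfam_def)
    qed
  qed auto
  ultimately show ?case using Suc.IH by simp
qed simp

text \<open>If every line of the parameter space has rank at most two, then the span of the values at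
  independent points contains the values on the whole space that these points span.\<close>

lemma line_lemma:
  assumes "rvec \<psi>" "\<And>c c'. (\<And>j. j < m \<Longrightarrow> c j = c' j) \<Longrightarrow> \<psi> c = \<psi> c'" "2 \<le> m"
    and lines: "\<And>q. rk (\<lambda>c. \<psi> (pt 2 q c)) UNIV \<le> 2"
  shows "rk \<psi> UNIV \<le> m"
proof (rule ccontr)
  assume "\<not> rk \<psi> UNIV \<le> m"
  then obtain B where B: "indf \<psi> B" "card B = m"
    using rk_geE[OF rvec_bd[OF assms(1)], of m UNIV] by auto
  obtain e where e: "bij_betw e {..<m} B"
    using indf_finite[OF B(1)] ex_bij_betw_nat_finite[of B] B(2) by (auto simp: atLeast0LessThan)
  let ?P = "\<lambda>q. indf (\<lambda>j. \<psi> (\<lambda>a. q (j, a))) {..<m}"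
  let ?R = "\<lambda>q j a. if a < m then q (j, a) else (0::complex)"
  \<comment> \<open>Independent values do not make the points themselves independent;
    \<open>?Q\<close> adds that the points form a basis of the first \<open>m\<close>
    coordinates.\<close>
  let ?Q = "\<lambda>q. indf (?R q) {..<m}"
  have "?P (\<lambda>(j, a). e j a)"
    using indf_reindex[of e "{..<m}" \<psi>] e B(1) by (simp add: bij_betw_def)
  moreover have "?Q (\<lambda>(j, a). unit j a)"
  proof (rule indfI)
    fix \<beta> b assume z: "\<And>i. (\<Sum>j<m. \<beta> j * ?R (\<lambda>(j, a). unit j a) j i) = 0" and b: "b \<in> {..<m}"
    have "(\<Sum>j<m. \<beta> j * ?R (\<lambda>(j, a). unit j a) j b) = (\<Sum>j<m. if j = b then \<beta> j else 0)"
      using b by (intro sum.cong) (auto simp: unit_def)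
    then show "\<beta> b = 0" using z[of b] b by simp
  qed auto
  moreover have "gen ?P"
    by (rule gen_indf) (intro rvec_rpoly[OF assms(1)] rpoly_pline)
  moreover have "gen ?Q"
  proof (rule gen_indf)
    fix x y :: "nat \<times> nat \<Rightarrow> complex" and b i
    show "rpoly (\<lambda>t. ?R (pline x y t) b i)" by (cases "i < m") (auto intro: rpoly_pline)
  qed
  ultimately obtain q where q: "?P q" "?Q q" using gen_ex_conj[of ?P ?Q] by blast
  define X where "X j = (\<lambda>a. q (j, a))" for j
  have iX: "indf (\<lambda>j. \<psi> (X j)) {..<m}" using q(1) by (simp add: X_def)
  have two: "\<psi> (\<lambda>a. s * u a + t * v a) \<in> fv.span ((\<lambda>x. \<psi> x) ` {u, v})"
    if uv: "indf \<psi> {u, v}" "u \<noteq> v" for u v s t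
  proof -
    define p where "p = (\<lambda>(j :: nat, a). if j = 0 then u a else v a :: complex)"
    have pp: "pt 2 p c = (\<lambda>a. c 0 * u a + c 1 * v a)" for c
      by (simp add: pt_def p_def numeral_2_eq_2)
    have p0: "pt 2 p (unit 0) = u" "pt 2 p (unit 1) = v" by (auto simp: pp unit_def)
    have "unit 0 \<noteq> unit 1" by (auto simp: unit_def fun_eq_iff)
    have i2: "indf (\<lambda>c. \<psi> (pt 2 p c)) {unit 0, unit 1}"
      using uv p0 \<open>unit 0 \<noteq> unit 1\<close> indf_reindex[of "pt 2 p" "{unit 0, unit 1}" \<psi>] by (auto simp: inj_on_def)
    have "card {unit 0, unit 1} = rk (\<lambda>c. \<psi> (pt 2 p c)) UNIV"
      using rk_ge[OF bd_pt[OF assms(1)] _ i2, of UNIV] lines[of p] \<open>unit 0 \<noteq> unit 1\<close> by simp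
    from rk_span[OF bd_pt[OF assms(1)] _ i2 this, of "unit 0 + unit 1"]
    have sp: "\<psi> (pt 2 p c) \<in> fv.span ((\<lambda>c. \<psi> (pt 2 p c)) ` {unit 0, unit 1})" for c
      using rk_span[OF bd_pt[OF assms(1)] _ i2 \<open>card {unit 0, unit 1} = rk (\<lambda>c. \<psi> (pt 2 p c)) UNIV\<close>, of c]
      by simp
    have "(\<lambda>c. \<psi> (pt 2 p c)) ` {unit 0, unit 1} = \<psi> ` {u, v}" using p0 by auto
    then have "\<psi> (pt 2 p c) \<in> fv.span (\<psi> ` {u, v})" for c using sp[of c] by simp
    from this[of "\<lambda>j. if j = 0 then s else t"] show ?thesis by (simp add: pp)
  qed
  have main: "\<psi> (pt i q c) \<in> fv.span ((\<lambda>j. \<psi> (X j)) ` {..<i})" if "2 \<le> i" "i \<le> m" for i c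
    using that
  proof (induction i arbitrary: c rule: dec_induct)
    case base
    have inj: "X 0 \<noteq> X 1" 
    proof
      assume "X 0 = X 1"
      then have "(0::nat) = 1"
        by (rule inj_onD[OF indf_image(1)[of \<psi> X "{..<m}", OF iX]]) (use base in simp_all)
      then show False by simp
    qed
    have "indf (\<lambda>j. \<psi> (X j)) {0, 1}" using indf_subset[OF iX] base by auto
    then have "indf \<psi> {X 0, X 1}" using indf_image(2)[of \<psi> X "{0, 1}"] by simp
    then have "\<psi> (\<lambda>a. c 0 * X 0 a + c 1 * X 1 a) \<in> fv.span (\<psi> ` {X 0, X 1})"
      using two[of "X 0" "X 1" "c 0" "c 1"] inj by simp
    moreover have "\<psi> ` {X 0, X 1} = (\<lambda>j. \<psi> (X j)) ` {..<2}" by (auto simp: less_2_cases_iff)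
    ultimately show ?case by (simp add: pt_def X_def numeral_2_eq_2)
  next
    case (step i)
    let ?S = "fv.span ((\<lambda>j. \<psi> (X j)) ` {..<Suc i})"
    have sub: "fv.span ((\<lambda>j. \<psi> (X j)) ` {..<i}) \<subseteq> ?S" by (intro fv.span_mono) auto
    have nz: "\<psi> (\<lambda>a. pt i q d a + c i * X i a) \<in> ?S" if "\<psi> (pt i q d) \<noteq> 0" for d
    proof -
      let ?u = "pt i q d"
      have u: "\<psi> ?u \<in> fv.span ((\<lambda>j. \<psi> (X j)) ` {..<i})" using step.IH step.prems by simp
      have "indf (\<lambda>j. \<psi> (X j)) {..<i}" using indf_subset[OF iX] step.prems by auto
      have Xi: "\<psi> (X i) \<notin> fv.span ((\<lambda>j. \<psi> (X j)) ` {..<i})"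
      proof
        assume "\<psi> (X i) \<in> fv.span ((\<lambda>j. \<psi> (X j)) ` {..<i})"
        then obtain \<beta> where \<beta>: "\<forall>l. \<psi> (X i) l = (\<Sum>j<i. \<beta> j * \<psi> (X j) l)"
          using span_fam_ex[of "{..<i}"] by blast
        have "indf (\<lambda>j. \<psi> (X j)) {..<Suc i}" using indf_subset[OF iX] step.prems by auto
        from indfD[OF this, of "\<lambda>j. if j = i then -1 else \<beta> j" i] \<beta> show False by simp
      qed
      have "indf \<psi> {?u}"
      proof (rule indfI)
        fix \<beta> b assume z: "\<And>l. (\<Sum>b\<in>{?u}. \<beta> b * \<psi> b l) = 0" and b: "b \<in> {?u}"
        have "\<exists>l. \<psi> ?u l \<noteq> 0" using that by (auto simp: fun_eq_iff)
        then obtain l where "\<psi> ?u l \<noteq> 0" by blast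
        then show "\<beta> b = 0" using z[of l] b by simp
      qed simp
      moreover have "\<psi> (X i) \<notin> fv.span (\<psi> ` {?u})"
      proof -
        have "fv.span (\<psi> ` {?u}) \<subseteq> fv.span ((\<lambda>j. \<psi> (X j)) ` {..<i})"
          using u by (intro fv.span_minimal) auto
        then show ?thesis using Xi by blast
      qed
      ultimately have ind: "indf \<psi> {X i, ?u}" by (rule indf_insert)
      have "X i \<noteq> ?u" using Xi u by auto
      then have "\<psi> (\<lambda>a. c i * X i a + 1 * ?u a) \<in> fv.span (\<psi> ` {X i, ?u})" using two ind by blast
      moreover have "fv.span (\<psi> ` {X i, ?u}) \<subseteq> ?S"
      proof (rule fv.span_minimal)
        show "\<psi> ` {X i, ?u} \<subseteq> ?S" using u sub by (auto intro: span_fam_base[of i "{..<Suc i}" "\<lambda>j. \<psi> (X j)"])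
      qed simp
      ultimately show ?thesis by (auto simp: add.commute)
    qed
    \<comment> \<open>The argument with planes needs a nonzero value at the point of the earlier
      subspace. Other points are approached along the line towards \<open>X 0\<close>, where the
      value is nonzero.\<close>
    define z where "z t = pline c (unit 0) t" for t
    have rz: "rpoly (\<lambda>t. z t j)" for j unfolding z_def by (rule rpoly_pline)
    let ?v = "\<lambda>t. \<psi> (\<lambda>a. pt i q (z t) a + c i * X i a)"
    have "?v 0 \<in> ?S"
    proof (rule span_closed)
      show "bd (\<lambda>j. \<psi> (X j))" using rvec_bd[OF assms(1)] unfolding bd_def by blast
      show "rpoly (\<lambda>t. ?v t l)" for l
        by (intro rvec_rpoly[OF assms(1)] rpoly_add rpoly_mult rpoly_const rpoly_pt rz)
      have "\<psi> (pt i q (z 1)) \<noteq> 0"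
      proof
        assume "\<psi> (pt i q (z 1)) = 0"
        then have "\<psi> (X 0) = 0" using step.hyps by (simp add: z_def pt_unit X_def)
        moreover have "indf (\<lambda>j. \<psi> (X j)) {0}" using indf_subset[OF iX] step.prems by auto
        ultimately show False using indfD[of "\<lambda>j. \<psi> (X j)" "{0}" "\<lambda>_. 1" 0] by simp
      qed
      then obtain l where l: "\<psi> (pt i q (z 1)) l \<noteq> 0" by (auto simp: fun_eq_iff)
      have "finite {t. \<psi> (pt i q (z t)) l = 0}"
        by (rule rpoly_finite[where f = "\<lambda>t. \<psi> (pt i q (z t)) l" and ?t0.0 = 1, OF _ l]) (intro rvec_rpoly[OF assms(1)] rpoly_pt rpoly_const rz)
      then show "finite {t. \<not> ?v t \<in> ?S}"
        by (rule rev_finite_subset) (use nz in \<open>auto simp: fun_eq_iff\<close>)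
    qed
    then show ?case by (simp add: z_def pt_Suc X_def)
  qed
  have "rk \<psi> UNIV \<le> card {..<m}"
  proof (rule rk_le_card[OF rvec_bd[OF assms(1)]])
    fix c :: "nat \<Rightarrow> complex"
    have "(\<lambda>a. if a < m then c a else 0) \<in> fv.span (?R q ` {..<m})"
      using q(2) by (intro full_span[of "{..<m}"]) auto
    then obtain d where d: "\<forall>a. (if a < m then c a else 0) = (\<Sum>j<m. d j * ?R q j a)"
      using span_fam_ex[of "{..<m}"] by blast
    have "\<psi> c = \<psi> (pt m q d)"
    proof (rule assms(2))
      fix a assume "a < m"
      then show "c a = pt m q d a" using d[rule_format, of a] by (simp add: pt_def)
    qed
    then show "\<psi> c \<in> fv.span ((\<lambda>j. \<psi> (X j)) ` {..<m})" using main[of m d] assms(3) by simp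
  qed simp
  then show False using \<open>\<not> rk \<psi> UNIV \<le> m\<close> by simp
qed

section \<open>Quotients by the values on a subset, and the propagation of large increments\<close>

lemma relfac_comp:
  assumes "relfac \<phi> \<psi> UNIV"
  shows "relfac (\<lambda>c. \<phi> (g c)) (\<lambda>c. \<psi> (g c)) C"
  unfolding relfac_def
proof (intro allI impI)
  fix F \<beta> i
  assume F: "finite F" and z: "\<forall>i. (\<Sum>c\<in>F. \<beta> c * \<phi> (g c) i) = 0"
  \<comment> \<open>\<open>g\<close> need not be injective, so the coefficients are summed over its
    fibres.\<close>
  define \<beta>' where "\<beta>' x = (\<Sum>c | c \<in> F \<and> g c = x. \<beta> c)" for x
  have s: "(\<Sum>x\<in>g ` F. \<beta>' x * f x) = (\<Sum>c\<in>F. \<beta> c * f (g c))" for f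
  proof -
    have "(\<Sum>c\<in>F. \<beta> c * f (g c)) = (\<Sum>x\<in>g ` F. \<Sum>c | c \<in> F \<and> g c = x. \<beta> c * f (g c))"
      by (rule sum.image_gen[OF F])
    also have "\<dots> = (\<Sum>x\<in>g ` F. \<beta>' x * f x)"
      by (intro sum.cong refl) (auto simp: \<beta>'_def sum_distrib_right intro: sum.cong)
    finally show ?thesis by simp
  qed
  have "(\<Sum>x\<in>g ` F. \<beta>' x * \<psi> x i) = 0"
    using z F s[of "\<lambda>x. \<phi> x _"] by (intro relfacD[OF assms]) auto
  then show "(\<Sum>c\<in>F. \<beta> c * \<psi> (g c) i) = 0" using s[of "\<lambda>x. \<psi> x i"] by simp
qed

text \<open>A basis of the span over \<open>P\<close> is extended to one over \<open>C\<close>; the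
  functionals dual to the added members are coordinates on the quotient of the two spans.\<close>

lemma quotient_functionals:
  assumes "bd \<phi>" "P \<subseteq> C"
  shows "\<exists>D J f. finite D \<and> finite J \<and> (\<forall>b i. b \<notin> D \<longrightarrow> f b i = 0) \<and>
    (\<forall>x\<in>P. \<forall>b. (\<Sum>i\<in>J. f b i * \<phi> x i) = 0) \<and>
    rk \<phi> C \<le> rk \<phi> P + rk (\<lambda>x (b :: 'c). \<Sum>i\<in>J. f b i * \<phi> (x :: 'c) i) C"
proof -
  obtain B0 where B0: "B0 \<subseteq> P" "indf \<phi> B0" "card B0 = rk \<phi> P" using rk_witness[OF assms(1)] .
  have "B0 \<subseteq> C" using B0(1) assms(2) by blast
  have "\<exists>B. B0 \<subseteq> B \<and> B \<subseteq> C \<and> indf \<phi> B \<and> card B = rk \<phi> C"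
    by (rule indf_extend[OF assms(1) \<open>B0 \<subseteq> C\<close> B0(2)]) blast
  then obtain B where B: "B0 \<subseteq> B" "B \<subseteq> C" "indf \<phi> B" "card B = rk \<phi> C" by blast
  have finB: "finite B" using indf_finite[OF B(3)] .
  obtain J f0 where J: "finite J"
    "\<forall>b\<in>B. \<forall>b'\<in>B. (\<Sum>i\<in>J. f0 b i * \<phi> b' i) = (if b = b' then 1 else 0)"
    using dual_functionals[OF B(3)] by blast
  define f where "f b i = (if b \<in> B - B0 then f0 b i else 0)" for b i
  let ?\<psi> = "\<lambda>x b. \<Sum>i\<in>J. f b i * \<phi> x i"
  have f: "?\<psi> x b = (if b \<in> B - B0 then \<Sum>i\<in>J. f0 b i * \<phi> x i else 0)" for x b
    by (cases "b \<in> B"; cases "b \<in> B0") (simp_all add: f_def)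
  have bd\<psi>: "bd ?\<psi>" unfolding bd_def using finB by (intro exI[of _ B]) (auto simp: f_def)
  show ?thesis
  proof (intro exI[of _ B] exI[of _ J] exI[of _ f] conjI ballI allI impI finB J(1))
    show "f b i = 0" if "b \<notin> B" for b i using that by (simp add: f_def)
    show "?\<psi> c b = 0" if "c \<in> P" for c b
    proof (cases "b \<in> B - B0")
      case True
      have "\<forall>c\<in>B0. (\<Sum>i\<in>J. f0 b i * \<phi> c i) = 0" using True J(2) B(1) by auto
      then have "(\<Sum>i\<in>J. f0 b i * \<phi> c i) = 0"
        by (rule functional_span_zero) (rule rk_span[OF assms(1) B0 that])
      then show ?thesis by (simp only: f if_cancel)
    next
      case False
      then show ?thesis by (simp only: f if_False)
    qed
    have "indf ?\<psi> (B - B0)"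
    proof (rule indfI)
      fix \<beta> b assume z: "\<And>i. (\<Sum>c\<in>B - B0. \<beta> c * ?\<psi> c i) = 0" and b: "b \<in> B - B0"
      have "(\<Sum>c\<in>B - B0. \<beta> c * ?\<psi> c b) = (\<Sum>c\<in>B - B0. if c = b then \<beta> c else 0)"
      proof (rule sum.cong[OF refl])
        fix c assume "c \<in> B - B0"
        then have "?\<psi> c b = (if b = c then 1 else 0)" using J(2) b by (simp only: f) simp
        then show "\<beta> c * ?\<psi> c b = (if c = b then \<beta> c else 0)" by simp
      qed
      then show "\<beta> b = 0" using z[of b] b finB by simp
    qed (use finB in simp)
    then have "card (B - B0) \<le> rk ?\<psi> C" using B(2) by (intro rk_ge[OF bd\<psi>]) auto
    moreover have "card (B - B0) = card B - card B0" using B(1) finB by (intro card_Diff_subset) (auto intro: finite_subset)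
    ultimately show "rk \<phi> C \<le> rk \<phi> P + rk ?\<psi> C" using B(4) B0(3) by simp
  qed
qed

lemma quotient_family:
  assumes "rvec \<phi>"
  obtains \<psi> :: "(nat \<Rightarrow> complex) \<Rightarrow> (nat \<Rightarrow> complex) \<Rightarrow> complex"
  where "rvec \<psi>" "relfac \<phi> \<psi> UNIV" "\<And>c i. c \<in> P \<Longrightarrow> \<psi> c i = 0" "rk \<phi> UNIV \<le> rk \<phi> P + rk \<psi> UNIV"
    "\<And>c c'. \<phi> c = \<phi> c' \<Longrightarrow> \<psi> c = \<psi> c'"
proof -
  obtain D J f where F: "finite D \<and> finite J \<and> (\<forall>b i. b \<notin> D \<longrightarrow> f b i = 0) \<and>
    (\<forall>x\<in>P. \<forall>b. (\<Sum>i\<in>J. f b i * \<phi> x i) = 0) \<and>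
    rk \<phi> UNIV \<le> rk \<phi> P + rk (\<lambda>x (b :: nat \<Rightarrow> complex). \<Sum>i\<in>J. f b i * \<phi> x i) UNIV"
    using quotient_functionals[OF rvec_bd[OF assms] subset_UNIV[of P]] by (elim exE)
  note f = F[THEN conjunct1] F[THEN conjunct2, THEN conjunct1]
    F[THEN conjunct2, THEN conjunct2, THEN conjunct1]
    F[THEN conjunct2, THEN conjunct2, THEN conjunct2, THEN conjunct1]
    F[THEN conjunct2, THEN conjunct2, THEN conjunct2, THEN conjunct2]
  define \<psi> where "\<psi> = (\<lambda>x b. \<Sum>i\<in>J. f b i * \<phi> x i)"
  show ?thesis
  proof (rule that[of \<psi>])
    have "bd \<psi>" unfolding bd_def \<psi>_def using f(1,3) by (intro exI[of _ D]) auto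
    then show "rvec \<psi>" unfolding rvec_def \<psi>_def
      by (auto intro!: rpoly_sum rpoly_mult rvec_rpoly[OF assms])
    show "relfac \<phi> \<psi> UNIV" unfolding relfac_def
    proof (intro allI impI)
      fix F \<beta> b assume z: "\<forall>i. (\<Sum>c\<in>F. \<beta> c * \<phi> c i) = 0"
      have "(\<Sum>c\<in>F. \<beta> c * (\<Sum>i\<in>J. f b i * \<phi> c i)) = (\<Sum>i\<in>J. f b i * (\<Sum>c\<in>F. \<beta> c * \<phi> c i))"
        by (simp add: sum_distrib_left mult.left_commute) (rule sum.swap)
      then show "(\<Sum>c\<in>F. \<beta> c * \<psi> c b) = 0" using z by (simp add: \<psi>_def)
    qed
  qed (use f(4,5) in \<open>auto simp: \<psi>_def\<close>)
qed

text \<open>Let \<open>\<psi>\<close> be \<open>h\<close> on a generic \<open>m\<close>-space modulo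
  its values on a hyperplane. Its rank exceeds \<open>m\<close>, so by \<open>line_lemma\<close>
  some plane has rank three and a generic \<open>k\<close>-space has rank at least
  \<open>k + 1\<close> for \<open>\<psi>\<close>. The hyperplane cuts the \<open>k\<close>-space in
  a space of dimension \<open>k - 1\<close> that is again generic, and the two ranks add.\<close>

lemma rank_growth:
  assumes h: "rvec h" and m: "mr h (m - 1) + m + 1 \<le> mr h m" and k: "2 \<le> k" "k \<le> m"
  shows "mr h (k - 1) + k + 1 \<le> mr h k"
proof -
  have "\<exists>q. \<forall>i\<in>{k - 1, m - 1, m}. mr h i \<le> rk (\<lambda>c. h (pt i q c)) UNIV"
    by (rule gen_ball_ex) (auto intro: gen_mr[OF h] mr_ex[OF h])
  then obtain q where q: "mr h (k - 1) \<le> rk (\<lambda>c. h (pt (k - 1) q c)) UNIV"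
    "mr h m \<le> rk (\<lambda>c. h (pt m q c)) UNIV" by auto
  define \<phi> where "\<phi> c = h (pt m q c)" for c
  have r\<phi>: "rvec \<phi>" unfolding \<phi>_def by (rule rvec_pt[OF h])
  let ?P = "{c :: nat \<Rightarrow> complex. c (m - 1) = 0}"
  obtain \<psi> :: "(nat \<Rightarrow> complex) \<Rightarrow> (nat \<Rightarrow> complex) \<Rightarrow> complex" where \<psi>: "rvec \<psi>" "relfac \<phi> \<psi> UNIV"
    "\<And>c i. c \<in> ?P \<Longrightarrow> \<psi> c i = 0" "rk \<phi> UNIV \<le> rk \<phi> ?P + rk \<psi> UNIV" "\<And>c c'. \<phi> c = \<phi> c' \<Longrightarrow> \<psi> c = \<psi> c'"
    by (rule quotient_family[OF r\<phi>, of ?P]) blast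
  have "rk \<phi> ?P \<le> rk (\<lambda>c. h (pt (m - 1) q c)) UNIV"
    unfolding \<phi>_def
  proof (rule rk_pt_less[OF h])
    show "\<forall>j. m - 1 \<le> j \<longrightarrow> j < m \<longrightarrow> c j = 0" if "c \<in> ?P" for c
    proof (intro allI impI)
      fix j assume "m - 1 \<le> j" "j < m"
      then have "j = m - 1" by simp
      then show "c j = 0" using that by simp
    qed
  qed simp
  also have "\<dots> \<le> mr h (m - 1)" by (rule mr_ge[OF h])
  finally have big: "m + 1 \<le> rk \<psi> UNIV" using \<psi>(4) q(2) m unfolding \<phi>_def by simp
  have "\<exists>p. \<not> rk (\<lambda>c. \<psi> (pt 2 p c)) UNIV \<le> 2"
  proof (rule ccontr)
    assume n: "\<not> ?thesis"
    have "rk \<psi> UNIV \<le> m"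
    proof (rule line_lemma[OF \<psi>(1)])
      fix c c' :: "nat \<Rightarrow> complex" assume "\<And>j. j < m \<Longrightarrow> c j = c' j"
      then show "\<psi> c = \<psi> c'" unfolding \<phi>_def by (intro \<psi>(5)) (simp add: \<phi>_def pt_cong[of m c c' q])
    qed (use n k in auto)
    then show False using big by simp
  qed
  then obtain p2 where "\<not> rk (\<lambda>c. \<psi> (pt 2 p2 c)) UNIV \<le> 2" by blast
  then have "3 \<le> rk (\<lambda>c. \<psi> (pt 2 p2 c)) UNIV" by simp
  then have "min (k + 1) (rk \<psi> UNIV) \<le> mr \<psi> k" by (rule mr_ge_min_line[OF \<psi>(1) _ k(1)])
  then have mk: "k + 1 \<le> mr \<psi> k" using big k by simp
  obtain p3 where p3: "mr \<psi> k \<le> rk (\<lambda>c. \<psi> (pt k p3 c)) UNIV" using mr_ex[OF \<psi>(1)] by blast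
  \<comment> \<open>Combinations of the first vector of \<open>p\<close> with each of the others in
    which coordinate \<open>m - 1\<close> cancels. They describe the section by the hyperplane
    without division.\<close>
  define tw where "tw p = (\<lambda>(j, a). p (0, m - 1) * p (Suc j, a) - p (Suc j, m - 1) * p (0, a) :: complex)"
    for p :: "nat \<times> nat \<Rightarrow> complex"
  let ?c1 = "\<lambda>p. k + 1 \<le> rk (\<lambda>c. \<psi> (pt k p c)) UNIV"
  let ?c2 = "\<lambda>p. mr h (k - 1) \<le> rk (\<lambda>c. h (pt m q (pt (k - 1) (tw p) c))) UNIV"
  have g1: "gen ?c1" by (rule gen_mr[OF \<psi>(1)])
  have g2: "gen ?c2"
  proof (rule gen_rk)
    show "ubd (\<lambda>p c. h (pt m q (pt (k - 1) (tw p) c)))"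
      using rvec_bd[OF h] unfolding bd_def ubd_def by blast
    fix x y :: "nat \<times> nat \<Rightarrow> complex" and c :: "nat \<Rightarrow> complex" and i
    show "rpoly (\<lambda>t. h (pt m q (pt (k - 1) (tw (pline x y t)) c)) i)"
      unfolding tw_def prod.case
      by (intro rvec_rpoly[OF h] rpoly_pt rpoly_const) (simp, intro rpoly_diff rpoly_mult rpoly_pline)
  qed
  have e1: "?c1 p3" using p3 mk by simp
  \<comment> \<open>Chosen so that \<open>tw\<close> returns the unit vectors; the section is then
    the span of the first \<open>k - 1\<close> vectors of \<open>q\<close>.\<close>
  define p4 where "p4 = (\<lambda>(j, a). case j of 0 \<Rightarrow> unit (m - 1) a | Suc j' \<Rightarrow> unit j' a)"
  have e2: "?c2 p4"
  proof -
    have "pt m q (pt (k - 1) (tw p4) c) = pt (k - 1) q c" for c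
    proof -
      have t: "tw p4 (j, a) = unit j a" if "j < k - 1" for j a
      proof -
        have "m - 1 \<noteq> j" using that k by linarith
        then show ?thesis by (simp add: tw_def p4_def unit_def)
      qed
      have "pt (k - 1) (tw p4) c = pt (k - 1) (\<lambda>(j, a). unit j a) c"
        by (rule pt_cong_q) (simp add: t)
      also have "\<dots> = (\<lambda>a. if a < k - 1 then c a else 0)"
      proof
        fix a
        have "(\<Sum>j<k - 1. c j * unit j a) = (\<Sum>j<k - 1. if j = a then c j else 0)"
          by (intro sum.cong) (auto simp: unit_def)
        then show "pt (k - 1) (\<lambda>(j, a). unit j a) c a = (if a < k - 1 then c a else 0)"
          by (simp add: pt_def)
      qed
      finally have "pt m q (pt (k - 1) (tw p4) c) = pt m q (\<lambda>a. if a < k - 1 then c a else 0)" by simp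
      also have "\<dots> = pt (k - 1) q (\<lambda>a. if a < k - 1 then c a else 0)"
        using k by (intro pt_restrict) auto
      also have "\<dots> = pt (k - 1) q c" by (intro pt_cong) auto
      finally show ?thesis .
    qed
    then show ?thesis using q(1) by simp
  qed
  have "\<exists>p. ?c1 p \<and> ?c2 p" by (rule gen_ex_conj[where P = ?c1 and Q = ?c2 and x = p3 and y = p4, OF g1 g2 e1 e2])
  then obtain p where "?c1 p \<and> ?c2 p" by (rule exE)
  then have p: "?c1 p" "?c2 p" by (rule conjunct1, rule conjunct2)
  let ?\<phi> = "\<lambda>c. \<phi> (pt k p c)" and ?\<psi> = "\<lambda>c. \<psi> (pt k p c)"
  let ?C = "{c. (pt k p c) (m - 1) = 0}"
  have "rk ?\<phi> ?C + rk ?\<psi> UNIV \<le> rk ?\<phi> UNIV"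
  proof (rule rk_add[OF bd_pt[OF r\<phi>] bd_pt[OF \<psi>(1)]])
    show "relfac ?\<phi> ?\<psi> UNIV" by (rule relfac_comp[OF \<psi>(2)])
    show "\<psi> (pt k p c) i = 0" if "c \<in> ?C" for c i using that \<psi>(3) by simp
  qed simp
  moreover have "rk (\<lambda>c. h (pt m q (pt (k - 1) (tw p) c))) UNIV \<le> rk ?\<phi> ?C"
  proof (rule rk_le_image[OF bd_pt[OF r\<phi>]])
    show "bd (\<lambda>c. h (pt m q (pt (k - 1) (tw p) c)))" using rvec_bd[OF h] unfolding bd_def by blast
    fix d :: "nat \<Rightarrow> complex"
    define c where "c j = (case j of 0 \<Rightarrow> - (\<Sum>i<k - 1. d i * p (Suc i, m - 1)) | Suc i \<Rightarrow> d i * p (0, m - 1))" for j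
    have kk: "k = Suc (k - 1)" using k by simp
    have e: "pt k p c = pt (k - 1) (tw p) d"
    proof
      fix a
      have "pt k p c a = c 0 * p (0, a) + (\<Sum>j<k - 1. c (Suc j) * p (Suc j, a))"
        unfolding pt_def by (subst kk) (rule sum.lessThan_Suc_shift)
      also have "\<dots> = pt (k - 1) (tw p) d a"
        by (simp add: c_def pt_def tw_def right_diff_distrib sum_subtractf
            sum_distrib_left sum_distrib_right mult_ac)
      finally show "pt k p c a = pt (k - 1) (tw p) d a" .
    qed
    have "pt k p c (m - 1) = 0" unfolding e by (simp add: pt_def tw_def mult.commute)
    then show "\<exists>c\<in>?C. h (pt m q (pt (k - 1) (tw p) d)) = \<phi> (pt k p c)"
      unfolding \<phi>_def using e by (intro bexI[of _ c]) auto
  qed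
  moreover have "rk ?\<phi> UNIV \<le> mr h k"
    unfolding \<phi>_def pt_pt by (rule mr_ge[OF h])
  ultimately show ?thesis using p by simp
qed

section \<open>Orthogonality-preserving polynomial maps\<close>

definition ip :: "nat \<Rightarrow> (nat \<Rightarrow> complex) \<Rightarrow> (nat \<Rightarrow> complex) \<Rightarrow> complex" where
  "ip n x w = (\<Sum>j<n. x j * cnj (w j))"

lemma nonneg_limit:
  assumes "rpoly f" "finite {t. \<not> 0 \<le> Re (f t)}"
  shows "0 \<le> Re (f t0)"
proof -
  obtain p where p: "\<And>t. f t = poly p (of_real t)" using assms(1) unfolding rpoly_def by blast
  let ?g = "\<lambda>t::real. Re (poly p (of_real t))"
  have "continuous_on UNIV ?g" by (intro continuous_intros)
  then have "(?g \<longlongrightarrow> ?g t0) (at t0)" by (simp add: continuous_on_def)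
  moreover have "eventually (\<lambda>t. 0 \<le> ?g t) (at t0)"
  proof -
    have "open (- ({t. \<not> 0 \<le> Re (f t)} - {t0}))"
      using assms(2) by (intro open_Compl finite_imp_closed) simp
    then have "eventually (\<lambda>t. t \<in> - ({t. \<not> 0 \<le> Re (f t)} - {t0})) (at t0)"
      unfolding eventually_at_topological
      by (intro exI[of _ "- ({t. \<not> 0 \<le> Re (f t)} - {t0})"]) auto
    then show ?thesis
      by (rule eventually_mono[OF eventually_conj[OF _ eventually_neq_at_within[of t0 t0]]]) (auto simp: p)
  qed
  ultimately show ?thesis using tendsto_lowerbound[of ?g "?g t0" "at t0" 0] by (simp add: p)
qed

text \<open>Common zeros of \<open>p\<close> and \<open>q\<close> are divided out; without them, any root of \<open>p - \<tau> q\<close> will do.\<close>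

lemma finite_bad_ratios:
  fixes p q :: "complex poly"
  assumes "\<And>a b. smult a p + smult b q = 0 \<Longrightarrow> a = 0 \<and> b = 0"
  shows "finite {\<tau>. \<not> (\<exists>s. poly p s = \<tau> * poly q s \<and> poly q s \<noteq> 0)}"
  using assms
proof (induction "degree q" arbitrary: p q rule: less_induct)
  case less
  note ind = less.prems
  have q0: "q \<noteq> 0" using ind[of 0 1] by auto
  have p0: "p \<noteq> 0" using ind[of 1 0] by auto
  show ?case
  proof (cases "\<exists>r. poly p r = 0 \<and> poly q r = 0")
    case True
    then obtain r where r: "poly p r = 0" "poly q r = 0" by blast
    obtain p1 where p1: "p = [:- r, 1:] * p1" using r poly_eq_0_iff_dvd dvdE by metis
    obtain q1 where q1: "q = [:- r, 1:] * q1" using r poly_eq_0_iff_dvd dvdE by metis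
    have "q1 \<noteq> 0" using q0 q1 by auto
    then have deg: "degree q1 < degree q" unfolding q1 by (subst degree_mult_eq) auto
    have "a = 0 \<and> b = 0" if "smult a p1 + smult b q1 = 0" for a b
    proof (rule ind)
      have "smult a p + smult b q = [:- r, 1:] * (smult a p1 + smult b q1)"
        by (simp only: p1 q1 distrib_left mult_smult_right)
      then show "smult a p + smult b q = 0" using that by simp
    qed
    then have fin: "finite {\<tau>. \<not> (\<exists>s. poly p1 s = \<tau> * poly q1 s \<and> poly q1 s \<noteq> 0)}"
      using less.hyps[OF deg] by blast
    have "{\<tau>. \<not> (\<exists>s. poly p s = \<tau> * poly q s \<and> poly q s \<noteq> 0)}
        \<subseteq> insert (poly p1 r / poly q1 r) {\<tau>. \<not> (\<exists>s. poly p1 s = \<tau> * poly q1 s \<and> poly q1 s \<noteq> 0)}"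
    proof (rule subsetI, rule ccontr)
      fix \<tau> assume a: "\<tau> \<in> {\<tau>. \<not> (\<exists>s. poly p s = \<tau> * poly q s \<and> poly q s \<noteq> 0)}"
        "\<tau> \<notin> insert (poly p1 r / poly q1 r) {\<tau>. \<not> (\<exists>s. poly p1 s = \<tau> * poly q1 s \<and> poly q1 s \<noteq> 0)}"
      then obtain s where s: "poly p1 s = \<tau> * poly q1 s" "poly q1 s \<noteq> 0" by blast
      have "s \<noteq> r" using s a(2) by auto
      then have "poly p s = \<tau> * poly q s \<and> poly q s \<noteq> 0" using s unfolding p1 q1 by (simp add: algebra_simps)
      then show False using a(1) by blast
    qed
    then show ?thesis using fin finite_subset by blast
  next
    case False
    have "degree (p - smult \<tau> q) = 0" if "\<not> (\<exists>s. poly p s = \<tau> * poly q s \<and> poly q s \<noteq> 0)" for \<tau>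
    proof (rule ccontr)
      assume "degree (p - smult \<tau> q) \<noteq> 0"
      then have "\<not> constant (poly (p - smult \<tau> q))" by (simp add: constant_degree)
      then obtain s where "poly (p - smult \<tau> q) s = 0" using fundamental_theorem_of_algebra by blast
      then have "poly p s = \<tau> * poly q s" by simp
      moreover from this have "poly q s \<noteq> 0" using False by auto
      ultimately show False using that by blast
    qed
    moreover have "\<tau> = \<tau>'" if d: "degree (p - smult \<tau> q) = 0" "degree (p - smult \<tau>' q) = 0" for \<tau> \<tau>'
    proof (rule ccontr)
      assume n: "\<tau> \<noteq> \<tau>'"
      obtain c where c: "p - smult \<tau> q = [:c:]" using d(1) degree_eq_zeroE by blast
      obtain c' where c': "p - smult \<tau>' q = [:c':]" using d(2) degree_eq_zeroE by blast
      have "smult (c' - c) p + smult (c * \<tau>' - c' * \<tau>) q = smult c' (p - smult \<tau> q) - smult c (p - smult \<tau>' q)"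
        by (simp add: smult_diff_left smult_diff_right smult_add_left algebra_simps)
      also have "\<dots> = 0" unfolding c c' by simp
      finally have "c' - c = 0" "c * \<tau>' - c' * \<tau> = 0" using ind by blast+
      then have "c * (\<tau>' - \<tau>) = 0" by (simp add: algebra_simps)
      then have "c = 0" using n by simp
      then have "smult 1 p + smult (- \<tau>) q = 0" using c by simp
      then show False using ind[of 1 "- \<tau>"] by simp
    qed
    ultimately have "{\<tau>. \<not> (\<exists>s. poly p s = \<tau> * poly q s \<and> poly q s \<noteq> 0)} = {} \<or>
      (\<exists>\<tau>. {\<tau>. \<not> (\<exists>s. poly p s = \<tau> * poly q s \<and> poly q s \<noteq> 0)} = {\<tau>})" by blast
    moreover have "finite X" if "X = {} \<or> (\<exists>\<tau>. X = {\<tau>})" for X :: "complex set" using that by auto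
    ultimately show ?thesis by blast
  qed
qed

text \<open>By \<open>h_A\<close>, the map \<open>h\<close> preserves orthogonality. The vector \<open>k x\<close> consists of the coefficients of
  \<open>A x\<close> with respect to the functions \<open>cnj (v w \<beta>)\<close>, \<open>\<beta> \<in> S\<close>; in the application these are the
  conjugates of monomials.\<close>

locale orth_map =
  fixes n N :: nat and h :: "(nat \<Rightarrow> complex) \<Rightarrow> nat \<Rightarrow> complex"
    and k v :: "(nat \<Rightarrow> complex) \<Rightarrow> 'b \<Rightarrow> complex" and S :: "'b set"
    and A :: "(nat \<Rightarrow> complex) \<Rightarrow> (nat \<Rightarrow> complex) \<Rightarrow> complex"
  assumes n2: "2 \<le> n" and finS: "finite S"
    and poly_h: "polyfun (\<lambda>x. h x \<mu>)" and poly_k: "polyfun (\<lambda>x. k x \<beta>)" and poly_v: "polyfun (\<lambda>x. v x \<beta>)"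
    and supp_h: "N \<le> \<mu> \<Longrightarrow> h x \<mu> = 0" and supp_k: "\<beta> \<notin> S \<Longrightarrow> k x \<beta> = 0"
    and h_cong: "(\<And>j. j < n \<Longrightarrow> x j = y j) \<Longrightarrow> h x = h y"
    and k_cong: "(\<And>j. j < n \<Longrightarrow> x j = y j) \<Longrightarrow> k x = k y"
    and A_def: "A x w = (\<Sum>\<beta>\<in>S. k x \<beta> * cnj (v w \<beta>))"
    and v_sep: "(\<And>w. (\<Sum>\<beta>\<in>S. f \<beta> * cnj (v w \<beta>)) = 0) \<Longrightarrow> \<beta> \<in> S \<Longrightarrow> f \<beta> = 0"
    and A_herm: "A w x = cnj (A x w)"
    and h_A: "(\<Sum>\<mu><N. h x \<mu> * cnj (h w \<mu>)) = ip n x w * A x w"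
begin

lemma rvec_h: "rvec h"
  unfolding rvec_def bd_def
  by (intro conjI exI[of _ "{..<N}"] allI impI polyfun_rpoly[OF poly_h]) (auto intro: supp_h)

lemma rvec_k: "rvec k"
  unfolding rvec_def bd_def using supp_k finS
  by (auto intro!: polyfun_rpoly[OF poly_k] exI[of _ S])

lemma rpoly_A:
  assumes "\<And>j. rpoly (\<lambda>t. z t j)" "\<And>j. rpoly (\<lambda>t. w t j)"
  shows "rpoly (\<lambda>t. A (z t) (w t))"
  unfolding A_def
  by (intro rpoly_sum rpoly_mult rpoly_cnj polyfun_rpoly[OF poly_k] polyfun_rpoly[OF poly_v] assms)

lemma sum_A: "(\<Sum>c\<in>F. \<gamma> c * A (g c) w) = (\<Sum>\<beta>\<in>S. (\<Sum>c\<in>F. \<gamma> c * k (g c) \<beta>) * cnj (v w \<beta>))"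
  unfolding A_def by (simp add: sum_distrib_left sum_distrib_right mult.assoc) (rule sum.swap)

lemma sum_A_eq:
  assumes "\<And>\<beta>. (\<Sum>c\<in>F. \<gamma> c * k (g c) \<beta>) = s * (\<Sum>d\<in>F'. \<gamma>' d * k (g' d) \<beta>)"
  shows "(\<Sum>c\<in>F. \<gamma> c * A (g c) w) = s * (\<Sum>d\<in>F'. \<gamma>' d * A (g' d) w)"
  by (simp only: sum_A assms sum_distrib_left[of s _ S] mult.assoc)

lemma sum_A_zero: "(\<And>\<beta>. (\<Sum>c\<in>F. \<gamma> c * k (g c) \<beta>) = 0) \<Longrightarrow> (\<Sum>c\<in>F. \<gamma> c * A (g c) w) = 0"
  unfolding sum_A by simp

lemma sum_k_zero:
  assumes "\<And>w. (\<Sum>c\<in>F. \<gamma> c * A (g c) w) = 0"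
  shows "(\<Sum>c\<in>F. \<gamma> c * k (g c) \<beta>) = 0"
proof (cases "\<beta> \<in> S")
  case True
  show ?thesis
    by (rule v_sep[of "\<lambda>\<beta>. \<Sum>c\<in>F. \<gamma> c * k (g c) \<beta>", OF _ True]) (use assms in \<open>simp add: sum_A\<close>)
qed (simp add: supp_k)

section \<open>The Hermitian form of \<open>A\<close> on the span of the values of
  \<open>k\<close>\<close>

definition Q :: "'c set \<Rightarrow> ('c \<Rightarrow> complex) \<Rightarrow> ('c \<Rightarrow> nat \<Rightarrow> complex) \<Rightarrow> complex" where
  "Q F \<gamma> g = (\<Sum>c\<in>F. \<Sum>d\<in>F. \<gamma> c * cnj (\<gamma> d) * A (g c) (g d))"

lemma Q_alt: "Q F \<gamma> g = (\<Sum>d\<in>F. cnj (\<gamma> d) * (\<Sum>c\<in>F. \<gamma> c * A (g c) (g d)))"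
  unfolding Q_def by (subst sum.swap) (simp add: sum_distrib_left mult_ac)

lemma Q_herm: "cnj (\<Sum>d\<in>F. \<gamma> d * A (g d) x) = (\<Sum>d\<in>F. cnj (\<gamma> d) * A x (g d))"
  by (simp add: A_herm[of x])

text \<open>\<open>Q\<close> depends only on the vector represented by the combination, not on the
  combination itself, and scales by a squared modulus. This allows the number of terms to be
  changed.\<close>

lemma Q_eq:
  assumes e: "\<And>\<beta>. (\<Sum>c\<in>F. \<gamma> c * k (g c) \<beta>) = s * (\<Sum>d\<in>F'. \<gamma>' d * k (g' d) \<beta>)"
  shows "Q F \<gamma> g = s * cnj s * Q F' \<gamma>' g'"
proof -
  have "Q F \<gamma> g = s * (\<Sum>d\<in>F. cnj (\<gamma> d) * (\<Sum>c\<in>F'. \<gamma>' c * A (g' c) (g d)))"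
    unfolding Q_alt sum_A_eq[OF e] by (simp add: sum_distrib_left mult.left_commute)
  also have "(\<Sum>d\<in>F. cnj (\<gamma> d) * (\<Sum>c\<in>F'. \<gamma>' c * A (g' c) (g d)))
      = (\<Sum>c\<in>F'. \<gamma>' c * (\<Sum>d\<in>F. cnj (\<gamma> d) * A (g' c) (g d)))"
    by (simp add: sum_distrib_left mult.left_commute) (rule sum.swap)
  also have "\<dots> = (\<Sum>c\<in>F'. \<gamma>' c * cnj (s * (\<Sum>d\<in>F'. \<gamma>' d * A (g' d) (g' c))))"
    unfolding Q_herm[symmetric] sum_A_eq[OF e] ..
  also have "\<dots> = cnj s * (\<Sum>c\<in>F'. \<gamma>' c * (\<Sum>d\<in>F'. cnj (\<gamma>' d) * A (g' c) (g' d)))"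
    unfolding complex_cnj_mult Q_herm by (simp add: sum_distrib_left mult.left_commute)
  also have "(\<Sum>c\<in>F'. \<gamma>' c * (\<Sum>d\<in>F'. cnj (\<gamma>' d) * A (g' c) (g' d))) = Q F' \<gamma>' g'"
    unfolding Q_def by (simp add: sum_distrib_left mult.assoc)
  finally show ?thesis by (simp add: mult.assoc)
qed

lemma Q_eq1:
  assumes "\<And>\<beta>. (\<Sum>c\<in>F. \<gamma> c * k (g c) \<beta>) = (\<Sum>d\<in>F'. \<gamma>' d * k (g' d) \<beta>)"
  shows "Q F \<gamma> g = Q F' \<gamma>' g'"
  using Q_eq[where F = F and \<gamma> = \<gamma> and g = g and s = 1 and F' = F' and \<gamma>' = \<gamma>' and g' = g'] assms by simp

text \<open>The link between \<open>h\<close> and \<open>A\<close>: the combination of the z (x)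
  k(z) with coefficients \<open>\<gamma>\<close> has one component for each of the \<open>n\<close>
  coordinates, and the form of \<open>A\<close> is summed over these components.\<close>

lemma norm_h:
  "(\<Sum>j<n. Q F (\<lambda>c. \<gamma> c * g c j) g) = of_real (\<Sum>\<mu><N. (cmod (\<Sum>c\<in>F. \<gamma> c * h (g c) \<mu>))\<^sup>2)"
proof -
  have "of_real (\<Sum>\<mu><N. (cmod (\<Sum>c\<in>F. \<gamma> c * h (g c) \<mu>))\<^sup>2)
      = (\<Sum>\<mu><N. (\<Sum>c\<in>F. \<gamma> c * h (g c) \<mu>) * cnj (\<Sum>c\<in>F. \<gamma> c * h (g c) \<mu>))"
    unfolding of_real_sum complex_norm_square ..
  also have "\<dots> = (\<Sum>\<mu><N. \<Sum>c\<in>F. \<Sum>d\<in>F. \<gamma> c * cnj (\<gamma> d) * (h (g c) \<mu> * cnj (h (g d) \<mu>)))"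
    by (simp add: sum_product mult_ac)
  also have "\<dots> = (\<Sum>c\<in>F. \<Sum>d\<in>F. \<Sum>\<mu><N. \<gamma> c * cnj (\<gamma> d) * (h (g c) \<mu> * cnj (h (g d) \<mu>)))"
    by (subst sum.swap, intro sum.cong refl) (rule sum.swap)
  also have "\<dots> = (\<Sum>c\<in>F. \<Sum>d\<in>F. \<gamma> c * cnj (\<gamma> d) * (ip n (g c) (g d) * A (g c) (g d)))"
    by (simp only: h_A[symmetric] sum_distrib_left)
  also have "\<dots> = (\<Sum>c\<in>F. \<Sum>d\<in>F. \<Sum>j<n. \<gamma> c * g c j * cnj (\<gamma> d * g d j) * A (g c) (g d))"
    unfolding ip_def by (simp add: sum_distrib_left sum_distrib_right mult_ac)
  also have "\<dots> = (\<Sum>c\<in>F. \<Sum>j<n. \<Sum>d\<in>F. \<gamma> c * g c j * cnj (\<gamma> d * g d j) * A (g c) (g d))"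
    by (intro sum.cong refl) (rule sum.swap)
  also have "\<dots> = (\<Sum>j<n. Q F (\<lambda>c. \<gamma> c * g c j) g)"
    unfolding Q_def by (rule sum.swap)
  finally show ?thesis by simp
qed

text \<open>Index sets \<open>{..<m}\<close> are used because the definition cannot quantify over
  index types; \<open>psdD\<close> transfers it to all finite index sets.\<close>

definition psd :: bool where
  "psd \<longleftrightarrow> (\<forall>m \<gamma> g. 0 \<le> Re (Q {..<m::nat} \<gamma> g))"

lemma psdD:
  fixes F :: "'c set"
  assumes "psd" "finite F"
  shows "0 \<le> Re (Q F \<gamma> g)"
proof -
  obtain e where e: "bij_betw e {..<card F} F"
    using ex_bij_betw_nat_finite[OF assms(2)] by (auto simp: atLeast0LessThan)
  have "Q F \<gamma> g = Q {..<card F} (\<lambda>i. \<gamma> (e i)) (\<lambda>i. g (e i))"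
    unfolding Q_def using e by (simp add: sum.reindex_bij_betw[OF e, symmetric])
  then show ?thesis using assms(1) unfolding psd_def by simp
qed

text \<open>The Cauchy-Schwarz argument: a null vector of a nonnegative form lies in its radical,
  since otherwise adding a small multiple of another vector makes the form negative.\<close>

lemma psd_null:
  fixes F :: "'c set"
  assumes "psd" "finite F" "Re (Q F \<gamma> g) = 0"
  shows "(\<Sum>c\<in>F. \<gamma> c * A (g c) w) = 0"
proof (rule ccontr)
  define u where "u = (\<Sum>c\<in>F. \<gamma> c * A (g c) w)"
  assume "(\<Sum>c\<in>F. \<gamma> c * A (g c) w) \<noteq> 0"
  then have u0: "u \<noteq> 0" by (simp add: u_def)
  define a where "a = Re (A w w)"
  have Aww: "A w w = of_real a" using A_herm[of w w] by (simp add: a_def complex_eq_iff)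
  have a0: "0 \<le> a" using psdD[OF assms(1), of "{()}" "\<lambda>_. 1" "\<lambda>_. w"] by (simp add: Q_def a_def)
  \<comment> \<open>The choice gives \<open>r * a < 2\<close>, so that the linear term in
    \<open>s\<close> outweighs the quadratic one, also for \<open>a = 0\<close>.\<close>
  define r where "r = 1 / (a + 1)"
  define s where "s = - of_real r * u"
  let ?F = "insert None (Some ` F)"
  let ?\<gamma> = "case_option s \<gamma>" and ?g = "case_option w g"
  have "Q ?F ?\<gamma> ?g = Q F \<gamma> g + cnj s * u + s * cnj u + s * cnj s * A w w"
  proof -
    have "(\<Sum>d\<in>F. cnj (\<gamma> d) * A w (g d)) = cnj u" unfolding u_def Q_herm[symmetric] ..
    then have 1: "(\<Sum>d\<in>F. s * cnj (\<gamma> d) * A w (g d)) = s * cnj u"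
      by (simp add: sum_distrib_left[symmetric] mult.assoc)
    have 2: "(\<Sum>c\<in>F. \<gamma> c * cnj s * A (g c) w) = cnj s * u"
      by (simp add: u_def sum_distrib_left mult_ac)
    show ?thesis unfolding Q_def using assms(2)
      by (simp add: sum.reindex sum.distrib 1 2)
  qed
  moreover have "cnj s * u = - of_real r * (u * cnj u)" "s * cnj u = - of_real r * (u * cnj u)"
    "s * cnj s = of_real r * of_real r * (u * cnj u)"
    by (simp_all add: s_def mult_ac)
  then have "cnj s * u = of_real (- r * (cmod u)\<^sup>2)" "s * cnj u = of_real (- r * (cmod u)\<^sup>2)"
    "s * cnj s = of_real (r\<^sup>2 * (cmod u)\<^sup>2)"
    unfolding complex_norm_square[symmetric] by (simp_all add: power2_eq_square)
  ultimately have "Re (Q ?F ?\<gamma> ?g) = - 2 * r * (cmod u)\<^sup>2 + r\<^sup>2 * (cmod u)\<^sup>2 * a"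
    using assms(3) by (simp only: Aww plus_complex.sel Re_complex_of_real flip: of_real_mult)
  also have "\<dots> = (cmod u)\<^sup>2 * r * (r * a - 2)" by (simp add: algebra_simps power2_eq_square)
  also have "\<dots> < 0"
  proof -
    have "r > 0" "r * a < 2" using a0 by (auto simp: r_def field_simps)
    then show ?thesis using u0 by (simp add: mult_pos_neg)
  qed
  finally show False using psdD[OF assms(1), of ?F ?\<gamma> ?g] assms(2) by simp
qed

section \<open>The family z (x) k(z) on the whole space and its relation to \<open>h\<close>\<close>

abbreviation uq :: "nat \<times> nat \<Rightarrow> complex" where
  "uq \<equiv> (\<lambda>(j, a). unit j a)"

lemma pt_uq: "pt b uq c = (\<lambda>a. if a < b then c a else 0)"
proof
  fix a
  have "(\<Sum>j<b. c j * unit j a) = (\<Sum>j<b. if j = a then c j else 0)"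
    by (intro sum.cong) (auto simp: unit_def)
  then show "pt b uq c a = (if a < b then c a else 0)" by (simp add: pt_def)
qed

lemma mr_n: "mr h n = rk h UNIV" "mr k n = rk k UNIV"
proof -
  have 1: "mr f n \<le> rk f UNIV" if rf: "rvec f" for f :: "(nat \<Rightarrow> complex) \<Rightarrow> 'z \<Rightarrow> complex"
  proof -
    obtain q where "mr f n \<le> rk (\<lambda>c. f (pt n q c)) UNIV" using mr_ex[OF rf] by blast
    also have "\<dots> \<le> rk f UNIV" by (rule rk_le_image[OF rvec_bd bd_pt]) (use that in auto)
    finally show ?thesis .
  qed
  have 2: "rk f UNIV \<le> mr f n" if "rvec f" "\<And>c. f c = f (pt n uq c)" for f :: "(nat \<Rightarrow> complex) \<Rightarrow> 'z \<Rightarrow> complex"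
  proof -
    have "rk f UNIV \<le> rk (\<lambda>c. f (pt n uq c)) UNIV"
      by (rule rk_le_image[OF bd_pt rvec_bd]) (use that in auto)
    also have "\<dots> \<le> mr f n" by (rule mr_ge[OF that(1)])
    finally show ?thesis .
  qed
  have "h c = h (pt n uq c)" for c by (rule h_cong) (simp add: pt_uq)
  moreover have "k c = k (pt n uq c)" for c by (rule k_cong) (simp add: pt_uq)
  ultimately show "mr h n = rk h UNIV" "mr k n = rk k UNIV"
    using 1[OF rvec_h] 1[OF rvec_k] 2[OF rvec_h] 2[OF rvec_k] by (auto intro: antisym)
qed

definition T :: "(nat \<Rightarrow> complex) \<Rightarrow> nat \<times> 'b \<Rightarrow> complex" where
  "T x = (\<lambda>(j, \<beta>). if j < n then x j * k x \<beta> else 0)"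

lemma bd_T: "bd T"
  unfolding bd_def by (rule exI[of _ "{..<n} \<times> S"]) (auto simp: T_def finS supp_k)

abbreviation idv :: "nat \<Rightarrow> (nat \<times> nat \<Rightarrow> complex) \<Rightarrow> bool" where
  "idv b q \<equiv> indf (\<lambda>j a. if a < n then q (j, a) else 0) {..<b}"

lemma gen_idv: "gen (idv b)"
proof (rule gen_indf)
  fix x y :: "nat \<times> nat \<Rightarrow> complex" and b i
  show "rpoly (\<lambda>t. if i < n then pline x y t (b, i) else 0)" by (cases "i < n") (auto intro: rpoly_pline)
qed

lemma idv_uq: 
  assumes "b \<le> n"
  shows "idv b uq"
proof (rule indfI)
  fix \<beta> c assume z: "\<And>i. (\<Sum>j<b. \<beta> j * (if i < n then uq (j, i) else 0)) = 0" and c: "c \<in> {..<b}"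
  have "(\<Sum>j<b. \<beta> j * (if c < n then uq (j, c) else 0)) = (\<Sum>j<b. if j = c then \<beta> j else 0)"
    using c assms by (intro sum.cong) (auto simp: unit_def)
  then show "\<beta> c = 0" using z[of c] c by simp
qed simp

text \<open>Relations in the coordinates of C^n can be read off in the coordinates \<open>c\<close>,
  because the vectors of \<open>q\<close> are independent.\<close>

lemma relfac_T_tfam:
  assumes "idv b q"
  shows "relfac (\<lambda>c. T (pt b q c)) (tfam k b q) UNIV"
  unfolding relfac_def
proof (intro allI impI)
  fix F :: "(nat \<Rightarrow> complex) set" and \<beta> and p :: "nat \<times> 'b"
  assume F: "finite F" and z: "\<forall>i. (\<Sum>c\<in>F. \<beta> c * T (pt b q c) i) = 0"
  obtain j l where p: "p = (j, l)" by fastforce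
  have "(\<Sum>c\<in>F. \<beta> c * (c j * k (pt b q c) l)) = 0" if "j < b"
  proof (rule indfD[OF assms, of "\<lambda>j. \<Sum>c\<in>F. \<beta> c * (c j * k (pt b q c) l)"])
    fix a
    show "(\<Sum>j<b. (\<Sum>c\<in>F. \<beta> c * (c j * k (pt b q c) l)) * (if a < n then q (j, a) else 0)) = 0"
    proof (cases "a < n")
      case True
      have "(\<Sum>j<b. (\<Sum>c\<in>F. \<beta> c * (c j * k (pt b q c) l)) * q (j, a))
          = (\<Sum>c\<in>F. \<beta> c * ((\<Sum>j<b. c j * q (j, a)) * k (pt b q c) l))"
        by (simp add: sum_distrib_left sum_distrib_right mult_ac) (rule sum.swap)
      also have "\<dots> = (\<Sum>c\<in>F. \<beta> c * T (pt b q c) (a, l))" using True by (simp add: T_def pt_def)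
      finally show ?thesis using z True by simp
    qed simp
  qed (use that in simp)
  then show "(\<Sum>c\<in>F. \<beta> c * tfam k b q c p) = 0" by (cases "j < b") (simp_all add: tfam_def p)
qed

lemma tensor_mr:
  assumes "relfac (\<lambda>c. h (pt b q c)) (tfam k b q) UNIV" "i \<le> b"
  shows "(\<Sum>i'=1..i. rk (\<lambda>c. k (pt i' q c)) UNIV) \<le> mr h i"
proof -
  let ?r = "\<lambda>c. \<lambda>j. if j < i then c j else (0::complex)"
  have r: "pt b q (?r c) = pt i q c" for c
  proof -
    have "pt b q (?r c) = pt i q (?r c)" using assms(2) by (intro pt_restrict) auto
    also have "\<dots> = pt i q c" by (intro pt_cong) auto
    finally show ?thesis .
  qed
  have t: "tfam k b q (?r c) = tfam k i q c" for c
    using assms(2) by (auto simp: tfam_def r fun_eq_iff)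
  have "relfac (\<lambda>c. h (pt b q (?r c))) (\<lambda>c. tfam k b q (?r c)) UNIV"
    by (rule relfac_comp[OF assms(1)])
  then have rf: "relfac (\<lambda>c. h (pt i q c)) (tfam k i q) UNIV" unfolding r t by simp
  have "(\<Sum>i'=1..i. rk (\<lambda>c. k (pt i' q c)) UNIV) \<le> rk (tfam k i q) UNIV" by (rule tensor_rank[OF rvec_k])
  also have "\<dots> \<le> rk (\<lambda>c. h (pt i q c)) UNIV" by (rule rk_le_relfac[OF bd_pt[OF rvec_h] bd_tfam[OF rvec_k] rf])
  also have "\<dots> \<le> mr h i" by (rule mr_ge[OF rvec_h])
  finally show ?thesis .
qed

lemma T_rank_lower: "(\<Sum>i=1..n. mr k i) \<le> rk T UNIV"
proof -
  have "\<exists>q. (\<forall>i\<in>{1..n}. mr k i \<le> rk (\<lambda>c. k (pt i q c)) UNIV) \<and> idv n q"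
  proof -
    have "\<exists>q. \<forall>i\<in>{1..n}. mr k i \<le> rk (\<lambda>c. k (pt i q c)) UNIV"
      by (rule gen_ball_ex) (auto intro: gen_mr[OF rvec_k] mr_ex[OF rvec_k])
    then obtain q where q: "\<forall>i\<in>{1..n}. mr k i \<le> rk (\<lambda>c. k (pt i q c)) UNIV" ..
    have g: "gen (\<lambda>q. \<forall>i\<in>{1..n}. mr k i \<le> rk (\<lambda>c. k (pt i q c)) UNIV)"
      by (rule gen_ball) (auto intro: gen_mr[OF rvec_k])
    show ?thesis
      by (rule gen_ex_conj[where P = "\<lambda>q. \<forall>i\<in>{1..n}. mr k i \<le> rk (\<lambda>c. k (pt i q c)) UNIV"
          and Q = "idv n" and x = q and y = uq, OF g gen_idv q idv_uq]) simp
  qed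
  then obtain q where q: "\<forall>i\<in>{1..n}. mr k i \<le> rk (\<lambda>c. k (pt i q c)) UNIV" "idv n q" by blast
  have "(\<Sum>i=1..n. mr k i) \<le> (\<Sum>i=1..n. rk (\<lambda>c. k (pt i q c)) UNIV)" using q(1) by (intro sum_mono) auto
  also have "\<dots> \<le> rk (tfam k n q) UNIV" by (rule tensor_rank[OF rvec_k])
  also have "\<dots> \<le> rk (\<lambda>c. T (pt n q c)) UNIV"
    by (rule rk_le_relfac[OF _ bd_tfam[OF rvec_k] relfac_T_tfam[OF q(2)]])
       (use bd_T in \<open>auto simp: bd_def\<close>)
  also have "\<dots> \<le> rk T UNIV"
    by (rule rk_le_image[OF bd_T]) (use bd_T in \<open>auto simp: bd_def\<close>)
  finally show ?thesis .
qed

lemma T_in_span: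
  assumes "B \<subseteq> UNIV" "indf k B" "card B = rk k UNIV"
  shows "(\<lambda>(j, \<beta>). if j = j0 \<and> j < n then s * k x \<beta> else 0)
    \<in> fv.span ((\<lambda>(j, b) (j', \<beta>). if j' = j then k b \<beta> else 0) ` ({..<n} \<times> B))"
proof -
  have "k x \<in> fv.span (k ` B)" by (rule rk_span[OF rvec_bd[OF rvec_k] assms]) simp
  then obtain c where c: "\<forall>\<beta>. k x \<beta> = (\<Sum>b\<in>B. c b * k b \<beta>)"
    using span_fam_ex[OF indf_finite[OF assms(2)]] by blast
  show ?thesis
  proof (rule span_famI[of "{..<n} \<times> B" _ _ "\<lambda>(j, b). if j = j0 then s * c b else 0"])
    fix p :: "nat \<times> 'b"
    obtain j \<beta> where p: "p = (j, \<beta>)" by fastforce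
    have "(\<Sum>q\<in>{..<n} \<times> B. (case q of (j, b) \<Rightarrow> if j = j0 then s * c b else 0) *
        (case q of (j, b) \<Rightarrow> \<lambda>(j', \<beta>). if j' = j then k b \<beta> else 0) p)
      = (\<Sum>i<n. \<Sum>b\<in>B. (if i = j0 then s * c b else 0) * (if j = i then k b \<beta> else 0))"
      unfolding sum.cartesian_product by (intro sum.cong refl) (auto simp: p)
    also have "\<dots> = (\<Sum>i<n. if i = j \<and> j = j0 then s * (\<Sum>b\<in>B. c b * k b \<beta>) else 0)"
      by (intro sum.cong refl) (auto simp: sum_distrib_left mult.assoc intro!: sum.neutral)
    also have "\<dots> = (if j = j0 \<and> j < n then s * k x \<beta> else 0)"
      using c by (cases "j = j0") auto
    finally show "(case p of (j, \<beta>) \<Rightarrow> if j = j0 \<and> j < n then s * k x \<beta> else 0) =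
      (\<Sum>q\<in>{..<n} \<times> B. (case q of (j, b) \<Rightarrow> if j = j0 then s * c b else 0) *
        (case q of (j, b) \<Rightarrow> \<lambda>(j', \<beta>). if j' = j then k b \<beta> else 0) p)" by (simp add: p)
  qed (use indf_finite[OF assms(2)] in auto)
qed

lemma T_span_all:
  assumes "B \<subseteq> UNIV" "indf k B" "card B = rk k UNIV"
  shows "T x \<in> fv.span ((\<lambda>(j, b) (j', \<beta>). if j' = j then k b \<beta> else 0) ` ({..<n} \<times> B))"
proof -
  have "T x = (\<Sum>j0<n. (\<lambda>(j, \<beta>). if j = j0 \<and> j < n then x j0 * k x \<beta> else 0))"
  proof
    fix p :: "nat \<times> 'b"
    obtain j \<beta> where p: "p = (j, \<beta>)" by fastforce
    have "(\<Sum>j0<n. (\<lambda>(j, \<beta>). if j = j0 \<and> j < n then x j0 * k x \<beta> else 0)) p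
      = (\<Sum>j0<n. if j0 = j then (if j < n then x j * k x \<beta> else 0) else 0)"
      unfolding sum_fun_app by (intro sum.cong) (auto simp: p)
    then show "T x p = (\<Sum>j0<n. (\<lambda>(j, \<beta>). if j = j0 \<and> j < n then x j0 * k x \<beta> else 0)) p"
      by (auto simp: T_def p)
  qed
  also have "\<dots> \<in> fv.span ((\<lambda>(j, b) (j', \<beta>). if j' = j then k b \<beta> else 0) ` ({..<n} \<times> B))"
    by (intro fv.span_sum T_in_span[OF assms])
  finally show ?thesis .
qed

lemma T_rank_upper: "rk T UNIV \<le> n * rk k UNIV"
proof -
  obtain B where B: "B \<subseteq> UNIV" "indf k B" "card B = rk k UNIV" using rk_witness[OF rvec_bd[OF rvec_k]] .
  have "rk T UNIV \<le> card ({..<n} \<times> B)"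
    using indf_finite[OF B(2)] by (intro rk_le_card[OF bd_T _ T_span_all[OF B]]) auto
  then show ?thesis using B(3) by (simp add: card_cartesian_product)
qed

text \<open>By \<open>norm_h\<close>, a relation among the z (x) k(z) makes the squared norm of the
  same combination of values of \<open>h\<close> a sum of zeros.\<close>

lemma relfac_T_h: "relfac T h UNIV"
  unfolding relfac_def
proof (intro allI impI)
  fix F :: "(nat \<Rightarrow> complex) set" and \<beta> \<mu>
  assume F: "finite F" and z: "\<forall>i. (\<Sum>c\<in>F. \<beta> c * T c i) = 0"
  have "Q F (\<lambda>c. \<beta> c * c j) (\<lambda>c. c) = 0" if "j < n" for j
  proof -
    have "(\<Sum>c\<in>F. (\<beta> c * c j) * k c l) = 0" for l
      using z[rule_format, of "(j, l)"] that by (simp add: T_def mult.assoc)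
    then show ?thesis unfolding Q_alt using sum_A_zero[of "\<lambda>c. \<beta> c * c j" "\<lambda>c. c" F] by simp
  qed
  then have "of_real (\<Sum>\<mu><N. (cmod (\<Sum>c\<in>F. \<beta> c * h c \<mu>))\<^sup>2) = (0::complex)"
    using norm_h[of F \<beta> "\<lambda>c. c"] by simp
  then have "(\<Sum>\<mu><N. (cmod (\<Sum>c\<in>F. \<beta> c * h c \<mu>))\<^sup>2) = 0" using of_real_eq_0_iff by blast
  then have "\<mu> < N \<Longrightarrow> (cmod (\<Sum>c\<in>F. \<beta> c * h c \<mu>))\<^sup>2 = 0"
    by (subst (asm) sum_nonneg_eq_0_iff) auto
  then show "(\<Sum>c\<in>F. \<beta> c * h c \<mu>) = 0" by (cases "\<mu> < N") (auto simp: supp_h)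
qed

lemma rank_upper: "rk h UNIV \<le> n * rk k UNIV"
  using rk_le_relfac[OF bd_T rvec_bd[OF rvec_h] relfac_T_h] T_rank_upper by simp

text \<open>The converse of \<open>relfac_T_h\<close>, where positivity enters: nonnegative values
  of \<open>Q\<close> with sum zero vanish, and \<open>psd_null\<close> turns them into relations of
  \<open>k\<close>.\<close>

lemma psd_rank_lower:
  assumes psd
  shows "(\<Sum>i=1..n. mr k i) \<le> rk h UNIV"
proof -
  have "relfac h T UNIV"
    unfolding relfac_def
  proof (intro allI impI)
    fix F :: "(nat \<Rightarrow> complex) set" and \<beta> and p :: "nat \<times> 'b"
    assume F: "finite F" and z: "\<forall>i. (\<Sum>c\<in>F. \<beta> c * h c i) = 0"
    obtain j l where p: "p = (j, l)" by fastforce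
    have "(\<Sum>j<n. Q F (\<lambda>c. \<beta> c * c j) (\<lambda>c. c)) = 0" unfolding norm_h[of F \<beta> "\<lambda>c. c"] using z by simp
    then have "(\<Sum>j<n. Re (Q F (\<lambda>c. \<beta> c * c j) (\<lambda>c. c))) = 0" unfolding Re_sum[symmetric] by simp
    then have "j < n \<Longrightarrow> Re (Q F (\<lambda>c. \<beta> c * c j) (\<lambda>c. c)) = 0"
      using psdD[OF assms F] by (subst (asm) sum_nonneg_eq_0_iff) auto
    then have "j < n \<Longrightarrow> (\<Sum>c\<in>F. (\<beta> c * c j) * k c l) = 0"
      using psd_null[OF assms F, of "\<lambda>c. \<beta> c * c j" "\<lambda>c. c"] by (intro sum_k_zero) blast
    then show "(\<Sum>c\<in>F. \<beta> c * T c p) = 0" by (cases "j < n") (simp_all add: T_def p mult.assoc)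
  qed
  then have "rk T UNIV \<le> rk h UNIV" by (rule rk_le_relfac[OF rvec_bd[OF rvec_h] bd_T])
  then show ?thesis using T_rank_lower by simp
qed

text \<open>If \<open>z \<otimes> k\<^sub>z\<close> spans a subspace of codimension less than \<open>n\<close>, then that subspace meets
  \<open>\<complex>\<^sup>n \<otimes> \<phi>\<close> for every \<open>\<phi>\<close>; a negative \<open>\<phi>\<close> would make a squared norm negative.\<close>

lemma psd_of_large_T:
  assumes "n * rk k UNIV < rk T UNIV + n"
  shows psd
proof (rule ccontr)
  assume "\<not> psd"
  then obtain m :: nat and \<gamma> g where neg: "Re (Q {..<m} \<gamma> g) < 0" unfolding psd_def by (auto simp: not_le)
  define \<phi> where "\<phi> \<beta> = (\<Sum>i<m. \<gamma> i * k (g i) \<beta>)" for \<beta>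
  obtain B where B: "B \<subseteq> UNIV" "indf k B" "card B = rk k UNIV" using rk_witness[OF rvec_bd[OF rvec_k]] .
  obtain Bt where Bt: "indf T Bt" "card Bt = rk T UNIV" using rk_witness[OF bd_T] by metis
  have finBt: "finite Bt" using indf_finite[OF Bt(1)] .
  \<comment> \<open>A maximal independent family of values of \<open>T\<close> together with
    \<open>\<phi>\<close> placed in each of the \<open>n\<close> components: more vectors than the
    dimension \<open>n * rk k UNIV\<close> of the space containing them, hence dependent.\<close>
  define E where "E = case_sum T (\<lambda>j0 (j, \<beta>). if j = j0 \<and> j < n then \<phi> \<beta> else 0)"
  let ?I = "Inl ` Bt \<union> Inr ` {..<n}"
  let ?W = "(\<lambda>(j, b) (j', \<beta>). if j' = j then k b \<beta> else 0) ` ({..<n} \<times> B)"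
  have cI: "card ?I = rk T UNIV + n"
    using finBt Bt(2) by (subst card_Un_disjoint) (auto simp: card_image inj_on_def)
  have "\<not> indf E ?I"
  proof
    assume "indf E ?I"
    moreover have "E x \<in> fv.span ?W" for x
    proof (cases x)
      case (Inl y)
      then show ?thesis using T_span_all[OF B] by (simp add: E_def)
    next
      case (Inr j0)
      have "E x = (\<Sum>i<m. (\<lambda>(j, \<beta>). if j = j0 \<and> j < n then \<gamma> i * k (g i) \<beta> else 0))"
      proof
        fix p :: "nat \<times> 'b"
        obtain j \<beta> where p: "p = (j, \<beta>)" by fastforce
        show "E x p = (\<Sum>i<m. (\<lambda>(j, \<beta>). if j = j0 \<and> j < n then \<gamma> i * k (g i) \<beta> else 0)) p"
          unfolding sum_fun_app by (cases "j = j0"; cases "j < n") (simp_all add: E_def Inr \<phi>_def p)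
      qed
      also have "\<dots> \<in> fv.span ?W" by (intro fv.span_sum T_in_span[OF B])
      finally show ?thesis .
    qed
    ultimately have "card ?I \<le> card ({..<n} \<times> B)"
      using indf_finite[OF B(2)] by (intro indf_card_le[of E ?I "{..<n} \<times> B"]) auto
    then show False using assms B(3) cI by (simp add: card_cartesian_product)
  qed
  then obtain \<beta> x0 where b: "\<And>i. (\<Sum>x\<in>?I. \<beta> x * E x i) = 0" "x0 \<in> ?I" "\<beta> x0 \<noteq> 0"
    using finBt unfolding indf_def by blast
  have e: "(\<Sum>x\<in>Bt. \<beta> (Inl x) * T x i) + (\<Sum>j<n. \<beta> (Inr j) * E (Inr j) i) = 0" for i
  proof -
    have "(\<Sum>x\<in>?I. \<beta> x * E x i) = (\<Sum>x\<in>Inl ` Bt. \<beta> x * E x i) + (\<Sum>x\<in>Inr ` {..<n}. \<beta> x * E x i)"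
      using finBt by (intro sum.union_disjoint) auto
    then show ?thesis using b(1)[of i] by (simp add: sum.reindex E_def)
  qed
  have ej: "(\<Sum>x\<in>Bt. (\<beta> (Inl x) * x j) * k x l) = - \<beta> (Inr j) * \<phi> l" if "j < n" for j l
  proof -
    have "(\<Sum>j'<n. \<beta> (Inr j') * E (Inr j') (j, l)) = (\<Sum>j'<n. if j' = j then \<beta> (Inr j) * \<phi> l else 0)"
      using that by (intro sum.cong) (auto simp: E_def)
    also have "\<dots> = \<beta> (Inr j) * \<phi> l" using that by simp
    finally show ?thesis using e[of "(j, l)"] that by (simp add: T_def mult.assoc add_eq_0_iff2)
  qed
  have "\<exists>j<n. \<beta> (Inr j) \<noteq> 0"
  proof (rule ccontr)
    assume z: "\<not> (\<exists>j<n. \<beta> (Inr j) \<noteq> 0)"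
    have "(\<Sum>x\<in>Bt. \<beta> (Inl x) * T x i) = 0" for i using e[of i] z by simp
    then have "\<beta> (Inl x) = 0" if "x \<in> Bt" for x using indfD[OF Bt(1), of "\<lambda>x. \<beta> (Inl x)"] that by blast
    then show False using b(2,3) z by auto
  qed
  then obtain j0 where j0: "j0 < n" "\<beta> (Inr j0) \<noteq> 0" by blast
  have Qj: "Q Bt (\<lambda>x. \<beta> (Inl x) * x j) (\<lambda>x. x) = of_real ((cmod (\<beta> (Inr j)))\<^sup>2) * Q {..<m} \<gamma> g" if "j < n" for j
  proof -
    have "Q Bt (\<lambda>x. \<beta> (Inl x) * x j) (\<lambda>x. x) = (- \<beta> (Inr j)) * cnj (- \<beta> (Inr j)) * Q {..<m} \<gamma> g"
      by (rule Q_eq) (simp add: ej[OF that] \<phi>_def)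
    then show ?thesis unfolding complex_norm_square by simp
  qed
  have "0 \<le> Re (\<Sum>j<n. Q Bt (\<lambda>x. \<beta> (Inl x) * x j) (\<lambda>x. x))"
    unfolding norm_h[of Bt "\<lambda>x. \<beta> (Inl x)" "\<lambda>x. x"] by (simp add: sum_nonneg)
  also have "Re (\<Sum>j<n. Q Bt (\<lambda>x. \<beta> (Inl x) * x j) (\<lambda>x. x)) = (\<Sum>j<n. (cmod (\<beta> (Inr j)))\<^sup>2 * Re (Q {..<m} \<gamma> g))"
    unfolding Re_sum by (intro sum.cong) (auto simp: Qj)
  also have "\<dots> = (\<Sum>j<n. (cmod (\<beta> (Inr j)))\<^sup>2) * Re (Q {..<m} \<gamma> g)" by (simp add: sum_distrib_right)
  also have "\<dots> < 0"
  proof (rule mult_pos_neg[OF _ neg])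
    show "0 < (\<Sum>j<n. (cmod (\<beta> (Inr j)))\<^sup>2)" using j0 by (intro sum_pos2[of _ j0]) auto
  qed
  finally show False by simp
qed

section \<open>Positivity when \<open>k\<close> has rank at most two on every plane\<close>

lemma A_diag_nonneg: "0 \<le> Re (A x x)"
proof -
  have main: "0 \<le> Re (A x x)" if "x j \<noteq> 0" "j < n" for x j
  proof -
    have ipx: "ip n x x = of_real (\<Sum>j<n. (cmod (x j))\<^sup>2)"
      unfolding ip_def of_real_sum complex_norm_square ..
    have pos: "0 < (\<Sum>j<n. (cmod (x j))\<^sup>2)" using that by (intro sum_pos2[of _ j]) auto
    have "of_real (\<Sum>\<mu><N. (cmod (h x \<mu>))\<^sup>2) = of_real (\<Sum>j<n. (cmod (x j))\<^sup>2) * A x x"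
      using h_A[of x x] unfolding ipx of_real_sum complex_norm_square by simp
    then have "(\<Sum>\<mu><N. (cmod (h x \<mu>))\<^sup>2) = (\<Sum>j<n. (cmod (x j))\<^sup>2) * Re (A x x)"
      by (metis Re_complex_of_real Re_complex_of_real scaleR_conv_of_real scaleR_complex.sel(1))
    moreover have "0 \<le> (\<Sum>\<mu><N. (cmod (h x \<mu>))\<^sup>2)" by (simp add: sum_nonneg)
    ultimately show ?thesis using pos by (simp add: zero_le_mult_iff)
  qed
  let ?z = "\<lambda>t::real. \<lambda>j. x j + of_real t * unit 0 j"
  have r: "rpoly (\<lambda>t. ?z t j)" for j by (intro rpoly_add rpoly_mult rpoly_const rpoly_id)
  have "?z (1 + \<bar>Re (x 0)\<bar>) 0 \<noteq> 0" by (auto simp: unit_def complex_eq_iff)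
  then have "finite {t. ?z t 0 = 0}" using rpoly_finite[where f = "\<lambda>t. ?z t 0", OF r] by blast
  then have "finite {t. \<not> 0 \<le> Re (A (?z t) (?z t))}"
    by (rule rev_finite_subset) (use main[of "?z _" 0] n2 in force)
  then have "0 \<le> Re (A (?z 0) (?z 0))" by (intro nonneg_limit rpoly_A r)
  then show ?thesis by simp
qed

lemma Q_drop:
  fixes F :: "'c set"
  assumes "finite F" "i \<in> F"
    and e: "\<And>\<beta>. (\<Sum>c\<in>F. \<delta> c * k (a c) \<beta>) = (\<Sum>c\<in>F - {i}. \<delta>' c * k (a' c) \<beta>)"
    and "\<And>F' \<gamma> g. finite F' \<Longrightarrow> card F' < card F \<Longrightarrow> 0 \<le> Re (Q (F' :: 'c set) \<gamma> g)"
  shows "0 \<le> Re (Q F \<delta> a)"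
proof -
  have "Q F \<delta> a = Q (F - {i}) \<delta>' a'" by (rule Q_eq1[OF e])
  moreover have "card (F - {i}) < card F" using assms(1,2) by (intro psubset_card_mono) auto
  ultimately show ?thesis using assms(4)[of "F - {i}" \<delta>' a'] assms(1) by simp
qed

text \<open>If two values of \<open>k\<close> are independent, the values on the line through their
  points stay in the span of the two, and by \<open>finite_bad_ratios\<close> their ratios of
  coordinates omit only finitely many numbers. Two terms of a combination therefore merge into one
  after an arbitrarily small change of a coefficient, and a single term is nonnegative by
  \<open>A_diag_nonneg\<close>.\<close>

lemma psd_of_lines:
  assumes "\<And>q. rk (\<lambda>c. k (pt 2 q c)) UNIV \<le> 2"
  shows psd
proof -
  have "0 \<le> Re (Q F \<gamma> g)" if "finite F" for F :: "nat set" and \<gamma> g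
    using that
  proof (induction "card F" arbitrary: F \<gamma> g rule: less_induct)
    case less
    have IH: "0 \<le> Re (Q F' \<gamma> g)" if "finite F'" "card F' < card F" for F' :: "nat set" and \<gamma> g
      using less.hyps[OF that(2)] that(1) by blast
    consider "F = {}" | i where "F = {i}" | i j where "i \<in> F" "j \<in> F" "i \<noteq> j" by blast
    then show ?case
    proof cases
      case 1
      then show ?thesis by (simp add: Q_def)
    next
      case (2 i)
      have "Q F \<gamma> g = of_real ((cmod (\<gamma> i))\<^sup>2) * A (g i) (g i)"
        unfolding complex_norm_square by (simp add: 2 Q_def)
      then show ?thesis using A_diag_nonneg[of "g i"] by simp
    next
      case (3 i j)
      define R where "R \<gamma> \<beta> = (\<Sum>c\<in>F - {i, j}. \<gamma> c * k (g c) \<beta>)" for \<gamma> \<beta>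
      have split: "(\<Sum>c\<in>F. \<gamma> c * k (g c) \<beta>) = \<gamma> i * k (g i) \<beta> + \<gamma> j * k (g j) \<beta> + R \<gamma> \<beta>" for \<gamma> \<beta>
      proof -
        have "F = insert i (insert j (F - {i, j}))" using 3 by auto
        then have "(\<Sum>c\<in>F. \<gamma> c * k (g c) \<beta>) = (\<Sum>c\<in>insert i (insert j (F - {i, j})). \<gamma> c * k (g c) \<beta>)" by simp
        also have "\<dots> = \<gamma> i * k (g i) \<beta> + (\<gamma> j * k (g j) \<beta> + R \<gamma> \<beta>)"
          using 3 less.prems unfolding R_def by (subst sum.insert) (auto simp: sum.insert)
        finally show ?thesis by simp
      qed
      have split1: "(\<Sum>c\<in>F - {i}. \<gamma>' c * k (g' c) \<beta>) = \<gamma>' j * k (g' j) \<beta> + (\<Sum>c\<in>F - {i, j}. \<gamma>' c * k (g' c) \<beta>)" for \<gamma>' g' \<beta>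
      proof -
        have "F - {i} = insert j (F - {i, j})" using 3 by auto
        then show ?thesis using less.prems by simp
      qed
      show ?thesis
      proof (cases "indf (\<lambda>c. k (g c)) {i, j}")
        case False
        then obtain \<beta> b where b: "\<And>l. (\<Sum>c\<in>{i, j}. \<beta> c * k (g c) l) = 0" "b \<in> {i, j}" "\<beta> b \<noteq> 0"
          unfolding indf_def by auto
        have e: "\<beta> i * k (g i) l + \<beta> j * k (g j) l = 0" for l using b(1)[of l] 3(3) by simp
        show ?thesis
        proof (cases "\<beta> i = 0")
          case False
          show ?thesis
          proof (rule Q_drop[where \<delta> = \<gamma> and \<delta>' = "\<gamma>(j := \<gamma> j - \<gamma> i * \<beta> j / \<beta> i)" and a = g and a' = g, OF less.prems 3(1) _ IH])
            fix l
            have "k (g i) l = - \<beta> j * k (g j) l / \<beta> i" using e[of l] False by (simp add: field_simps add_eq_0_iff2)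
            moreover have "(\<Sum>c\<in>F - {i, j}. (\<gamma>(j := \<gamma> j - \<gamma> i * \<beta> j / \<beta> i)) c * k (g c) l) = R \<gamma> l"
              unfolding R_def by (intro sum.cong) auto
            ultimately show "(\<Sum>c\<in>F. \<gamma> c * k (g c) l) = (\<Sum>c\<in>F - {i}. (\<gamma>(j := \<gamma> j - \<gamma> i * \<beta> j / \<beta> i)) c * k (g c) l)"
              unfolding split split1 by (simp add: algebra_simps)
          qed
        next
          case True
          then have bj: "\<beta> j \<noteq> 0" using b(2,3) by auto
          have "k (g j) l = 0" for l using e[of l] True bj by simp
          then have "(\<Sum>c\<in>F. \<gamma> c * k (g c) l) = (\<Sum>c\<in>F - {j}. \<gamma> c * k (g c) l)" for l
            using 3(2) less.prems by (subst sum.remove[of F j]) auto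
          then show ?thesis by (rule Q_drop[where \<delta> = \<gamma> and \<delta>' = \<gamma> and a = g and a' = g, OF less.prems 3(2) _ IH])
        qed
      next
        case True
        note ind = True
        define q where "q = (\<lambda>(l :: nat, a). if l = 0 then g i a else g j a)"
        have pp: "pt 2 q c = (\<lambda>a. c 0 * g i a + c 1 * g j a)" for c
          by (simp add: pt_def q_def numeral_2_eq_2)
        have p0: "pt 2 q (unit 0) = g i" "pt 2 q (unit 1) = g j" by (auto simp: pp unit_def)
        have u01: "unit 0 \<noteq> unit 1" by (auto simp: unit_def fun_eq_iff)
        have gij: "inj_on g {i, j}" "indf k (g ` {i, j})" using indf_image[of k g "{i, j}"] ind by auto
        have i2: "indf (\<lambda>c. k (pt 2 q c)) {unit 0, unit 1}"
        proof (rule indf_reindex[of "pt 2 q" _ k])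
          show "inj_on (pt 2 q) {unit 0, unit 1}" using gij(1) 3(3) p0 by (auto simp: inj_on_def simp del: One_nat_def)
          show "indf k (pt 2 q ` {unit 0, unit 1})" using gij(2) by (simp add: p0 del: One_nat_def)
        qed
        have c2: "card {unit 0, unit 1} = rk (\<lambda>c. k (pt 2 q c)) UNIV"
          using rk_ge[OF bd_pt[OF rvec_k] _ i2, of UNIV] assms[of q] u01 by simp
        have sp: "k (pt 2 q c) \<in> fv.span ((\<lambda>c. k (pt 2 q c)) ` {unit 0, unit 1})" for c
          by (rule rk_span[OF bd_pt[OF rvec_k] _ i2 c2]) auto
        obtain J f where J: "finite J"
          "\<forall>b\<in>{i, j}. \<forall>b'\<in>{i, j}. (\<Sum>l\<in>J. f b l * k (g b') l) = (if b = b' then 1 else 0)"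
          using dual_functionals[OF ind] by blast
        \<comment> \<open>The coordinates of \<open>k (z s)\<close> with respect to
          \<open>k (g i)\<close> and \<open>k (g j)\<close>, as polynomials in
          \<open>s\<close>.\<close>
        define P where "P b = (\<Sum>l\<in>J. smult (f b l) (jpoly (\<lambda>x. k x l) (g i) (\<lambda>a. g j a - g i a)))" for b
        define z where "z s = (\<lambda>a. g i a + s * (g j a - g i a))" for s
        have P: "poly (P b) s = (\<Sum>l\<in>J. f b l * k (z s) l)" for b s
          unfolding P_def poly_sum z_def by (simp add: polyfun_jpoly(1)[OF poly_k])
        have kz: "k (z s) l = poly (P i) s * k (g i) l + poly (P j) s * k (g j) l" for s l
        proof -
          have "z s = pt 2 q (\<lambda>l. if l = 0 then 1 - s else s)"
            by (auto simp: z_def pp fun_eq_iff algebra_simps)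
          then have "k (z s) \<in> fv.span ((\<lambda>c. k (pt 2 q c)) ` {unit 0, unit 1})" using sp by simp
          also have "(\<lambda>c. k (pt 2 q c)) ` {unit 0, unit 1} = (\<lambda>c. k (g c)) ` {i, j}"
            by (simp add: p0 del: One_nat_def)
          finally obtain \<beta> where \<beta>: "\<forall>l. k (z s) l = (\<Sum>c\<in>{i, j}. \<beta> c * k (g c) l)"
            using span_fam_ex[of "{i, j}" "k (z s)" "\<lambda>c. k (g c)"] by blast
          have k2: "k (z s) l = \<beta> i * k (g i) l + \<beta> j * k (g j) l" for l using \<beta> 3(3) by simp
          have "poly (P b) s = \<beta> i * (\<Sum>l\<in>J. f b l * k (g i) l) + \<beta> j * (\<Sum>l\<in>J. f b l * k (g j) l)" for b
            unfolding P k2 by (simp add: distrib_left sum.distrib sum_distrib_left mult_ac)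
          then have "poly (P i) s = \<beta> i" "poly (P j) s = \<beta> j" using J(2) 3(3) by auto
          then show ?thesis using k2 by simp
        qed
        have z01: "z 0 = g i" "z 1 = g j" by (auto simp: z_def)
        have P01: "poly (P i) 0 = 1" "poly (P j) 0 = 0" "poly (P i) 1 = 0" "poly (P j) 1 = 1"
          unfolding P z01 using J(2) 3(3) by auto
        have "a = 0 \<and> b = 0" if "smult a (P i) + smult b (P j) = 0" for a b
        proof -
          have "poly (smult a (P i) + smult b (P j)) 0 = 0" "poly (smult a (P i) + smult b (P j)) 1 = 0"
            using that by simp_all
          then show ?thesis by (simp add: P01)
        qed
        then have fin: "finite {\<tau>. \<not> (\<exists>s. poly (P i) s = \<tau> * poly (P j) s \<and> poly (P j) s \<noteq> 0)}"
          by (rule finite_bad_ratios)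
        show ?thesis
        proof (cases "\<gamma> j = 0")
          case True
          then have "(\<Sum>c\<in>F. \<gamma> c * k (g c) l) = (\<Sum>c\<in>F - {j}. \<gamma> c * k (g c) l)" for l
            using 3(2) less.prems by (subst sum.remove[of F j]) auto
          then show ?thesis by (rule Q_drop[where \<delta> = \<gamma> and \<delta>' = \<gamma> and a = g and a' = g, OF less.prems 3(2) _ IH])
        next
          case False
          \<comment> \<open>The perturbation shifts the ratio of the two coefficients by
            \<open>t\<close>, away from the finitely many omitted ratios.\<close>
          define \<gamma>t where "\<gamma>t t = \<gamma>(i := \<gamma> i + of_real t * \<gamma> j)" for t :: real
          have good: "0 \<le> Re (Q F (\<gamma>t t) g)"
            if gd: "\<exists>s. poly (P i) s = (\<gamma> i / \<gamma> j + of_real t) * poly (P j) s \<and> poly (P j) s \<noteq> 0" for t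
          proof -
            obtain s where s: "poly (P i) s = (\<gamma> i / \<gamma> j + of_real t) * poly (P j) s" "poly (P j) s \<noteq> 0"
              using gd by blast
            show ?thesis
            proof (rule Q_drop[where \<delta> = "\<gamma>t t" and \<delta>' = "\<gamma>(j := \<gamma> j / poly (P j) s)" and a = g and a' = "g(j := z s)", OF less.prems 3(1) _ IH])
              fix l
              have "\<gamma> j / poly (P j) s * k (z s) l = \<gamma> j * (\<gamma> i / \<gamma> j + of_real t) * k (g i) l + \<gamma> j * k (g j) l"
                unfolding kz s(1) using s(2) by (simp add: field_simps)
              also have "\<gamma> j * (\<gamma> i / \<gamma> j + of_real t) = \<gamma> i + of_real t * \<gamma> j" using False by (simp add: field_simps)
              finally have "\<gamma> j / poly (P j) s * k (z s) l = (\<gamma> i + of_real t * \<gamma> j) * k (g i) l + \<gamma> j * k (g j) l" .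
              moreover have "(\<Sum>c\<in>F - {i, j}. (\<gamma>(j := \<gamma> j / poly (P j) s)) c * k ((g(j := z s)) c) l) = R \<gamma> l"
                "R (\<gamma>t t) l = R \<gamma> l"
                unfolding R_def by (auto intro!: sum.cong simp: \<gamma>t_def)
              moreover have gt: "\<gamma>t t i = \<gamma> i + of_real t * \<gamma> j" "\<gamma>t t j = \<gamma> j"
                using 3(3) by (auto simp: \<gamma>t_def)
              ultimately show "(\<Sum>c\<in>F. \<gamma>t t c * k (g c) l)
                  = (\<Sum>c\<in>F - {i}. (\<gamma>(j := \<gamma> j / poly (P j) s)) c * k ((g(j := z s)) c) l)"
                unfolding split split1 using 3(3) gt by simp
            qed
          qed
          have "finite ((\<lambda>t::real. \<gamma> i / \<gamma> j + of_real t) -` {\<tau>. \<not> (\<exists>s. poly (P i) s = \<tau> * poly (P j) s \<and> poly (P j) s \<noteq> 0)})"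
            by (rule finite_vimageI[OF fin]) (auto simp: inj_on_def)
          then have "finite {t. \<not> 0 \<le> Re (Q F (\<gamma>t t) g)}"
            by (rule rev_finite_subset) (use good in blast)
          moreover have "rpoly (\<lambda>t. Q F (\<gamma>t t) g)"
          proof -
            have "rpoly (\<lambda>t. \<gamma>t t c)" for c
              by (cases "c = i") (auto simp: \<gamma>t_def intro!: rpoly_add rpoly_mult)
            then show ?thesis unfolding Q_def by (intro rpoly_sum rpoly_mult rpoly_cnj rpoly_const)
          qed
          ultimately have "0 \<le> Re (Q F (\<gamma>t 0) g)" by (intro nonneg_limit)
          then show ?thesis by (simp add: \<gamma>t_def)
        qed
      qed
    qed
  qed
  then show ?thesis unfolding psd_def by blast
qed

end

section \<open>Additivity of the rank on generic orthogonal pairs of subspaces\<close>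

definition proj :: "nat \<Rightarrow> (nat \<Rightarrow> complex) \<Rightarrow> (nat \<Rightarrow> complex) \<Rightarrow> nat \<Rightarrow> complex" where
  "proj n u z = (\<lambda>a. ip n u u * z a - ip n z u * u a)"

text \<open>Gram--Schmidt without divisions, so that all vectors depend polynomially on the
  coordinates of \<open>q\<close> and their conjugates.\<close>

fun gs :: "nat \<Rightarrow> (nat \<times> nat \<Rightarrow> complex) \<Rightarrow> nat \<Rightarrow> (nat \<Rightarrow> complex) \<Rightarrow> nat \<Rightarrow> complex" where
  "gs n q 0 z = z"
| "gs n q (Suc k) z = proj n (gs n q k (\<lambda>a. q (k, a))) (gs n q k z)"

lemma ip_add_left: "ip n (\<lambda>a. x a + y a) w = ip n x w + ip n y w"
  by (simp add: ip_def distrib_right sum.distrib)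

lemma ip_diff_left: "ip n (\<lambda>a. x a - y a) w = ip n x w - ip n y w"
  by (simp add: ip_def left_diff_distrib sum_subtractf)

lemma ip_scale_left: "ip n (\<lambda>a. c * x a) w = c * ip n x w"
  by (simp add: ip_def sum_distrib_left mult.assoc)

lemma ip_sum_left: "ip n (\<lambda>a. \<Sum>j\<in>F. c j * x j a) w = (\<Sum>j\<in>F. c j * ip n (x j) w)"
  unfolding ip_def by (simp add: sum_distrib_left sum_distrib_right mult.assoc) (rule sum.swap)

lemma ip_cnj: "cnj (ip n x w) = ip n w x"
  by (simp add: ip_def mult.commute)

lemma ip_zero_sym: "ip n x w = 0 \<Longrightarrow> ip n w x = 0"
  using ip_cnj[of n x w] by simp

lemma ip_self_zero: "ip n x x = 0 \<longleftrightarrow> (\<forall>j<n. x j = 0)"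
proof -
  have "ip n x x = of_real (\<Sum>j<n. (cmod (x j))\<^sup>2)"
    unfolding ip_def of_real_sum complex_norm_square ..
  then have "ip n x x = 0 \<longleftrightarrow> (\<Sum>j<n. (cmod (x j))\<^sup>2) = 0" by (simp only: of_real_eq_0_iff)
  also have "\<dots> \<longleftrightarrow> (\<forall>j<n. x j = 0)" by (subst sum_nonneg_eq_0_iff) auto
  finally show ?thesis .
qed

lemma ip_cong: "(\<And>j. j < n \<Longrightarrow> x j = x' j) \<Longrightarrow> (\<And>j. j < n \<Longrightarrow> w j = w' j) \<Longrightarrow> ip n x w = ip n x' w'"
  by (simp add: ip_def)

lemma ip_pt: "ip n (pt b q c) w = (\<Sum>j<b. c j * ip n (\<lambda>a. q (j, a)) w)"
  unfolding pt_def by (rule ip_sum_left)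

lemma proj_orth: "ip n (proj n u z) u = 0"
  unfolding proj_def by (simp only: ip_diff_left ip_scale_left) (simp add: mult.commute)

lemma proj_orth_other: "ip n z w = 0 \<Longrightarrow> ip n u w = 0 \<Longrightarrow> ip n (proj n u z) w = 0"
  unfolding proj_def by (simp add: ip_diff_left ip_scale_left)

lemma gs_orth: "i < k \<Longrightarrow> ip n (gs n q k z) (gs n q i (\<lambda>a. q (i, a))) = 0"
proof (induction k arbitrary: z)
  case (Suc k)
  show ?case
  proof (cases "i = k")
    case True
    then show ?thesis by (simp add: proj_orth)
  next
    case False
    then show ?thesis using Suc by (simp add: proj_orth_other)
  qed
qed simp

lemma gs_zero:
  assumes "i < k" "\<forall>a<n. gs n q i (\<lambda>a. q (i, a)) a = 0"
  shows "\<forall>a<n. gs n q k z a = 0"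
  using assms(1)
proof (induction k arbitrary: z)
  case (Suc k)
  show ?case
  proof (cases "i = k")
    case True
    then have "ip n (gs n q k (\<lambda>a. q (k, a))) (gs n q k (\<lambda>a. q (k, a))) = 0"
      using assms(2) by (simp add: ip_self_zero)
    then show ?thesis using True assms(2) by (simp add: proj_def)
  next
    case False
    then have "\<forall>a<n. gs n q k z a = 0" "\<forall>a<n. gs n q k (\<lambda>a. q (k, a)) a = 0" using Suc by auto
    then show ?thesis by (simp add: proj_def)
  qed
qed simp

text \<open>Orthogonality to the orthogonalised vectors is carried back to the original one by
  undoing its projections one at a time, each time cancelling a squared norm. If such a norm is
  zero, \<open>gs_zero\<close> makes the claim trivial.\<close>

lemma gs_orth_orig:
  assumes "i < k"
  shows "ip n (\<lambda>a. q (i, a)) (gs n q k z) = 0"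
proof (cases "\<exists>j<k. \<forall>a<n. gs n q j (\<lambda>a. q (j, a)) a = 0")
  case True
  then have "\<forall>a<n. gs n q k z a = 0" using gs_zero by blast
  then show ?thesis by (simp add: ip_def)
next
  case False
  have "ip n (gs n q (i - d) (\<lambda>a. q (i, a))) (gs n q k z) = 0" for d
  proof (induction d)
    case 0
    show ?case using ip_zero_sym[OF gs_orth[OF assms]] by simp
  next
    case (Suc d)
    show ?case
    proof (cases "i - d")
      case 0
      then show ?thesis using Suc by simp
    next
      case (Suc j)
      then have j: "i - Suc d = j" "j < k" using assms by auto
      let ?v = "gs n q j (\<lambda>a. q (j, a))"
      have "ip n (proj n ?v (gs n q j (\<lambda>a. q (i, a)))) (gs n q k z) = 0" using Suc.IH Suc by simp
      then have "ip n ?v ?v * ip n (gs n q j (\<lambda>a. q (i, a))) (gs n q k z)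
          - ip n (gs n q j (\<lambda>a. q (i, a))) ?v * ip n ?v (gs n q k z) = 0"
        unfolding proj_def by (simp only: ip_diff_left ip_scale_left)
      moreover have "ip n ?v (gs n q k z) = 0" using gs_orth[OF j(2)] by (rule ip_zero_sym)
      moreover have "ip n ?v ?v \<noteq> 0" using False j(2) by (auto simp: ip_self_zero)
      ultimately show ?thesis unfolding j by simp
    qed
  qed
  from this[of i] show ?thesis by simp
qed

text \<open>The leading factor is a product of squared norms; where it is nonzero, the division-free
  process preserves independence.\<close>

lemma gs_expand:
  "\<exists>d. \<forall>a. gs n q k z a = (\<Prod>i<k. ip n (gs n q i (\<lambda>a. q (i, a))) (gs n q i (\<lambda>a. q (i, a)))) * z a
      + (\<Sum>i<k. d i * q (i, a))"
proof (induction k arbitrary: z)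
  case (Suc k)
  let ?c = "\<Prod>i<k. ip n (gs n q i (\<lambda>a. q (i, a))) (gs n q i (\<lambda>a. q (i, a)))"
  let ?v = "gs n q k (\<lambda>a. q (k, a))"
  obtain d where d: "\<forall>a. gs n q k z a = ?c * z a + (\<Sum>i<k. d i * q (i, a))" using Suc.IH by blast
  obtain d' where d': "\<forall>a. ?v a = ?c * q (k, a) + (\<Sum>i<k. d' i * q (i, a))"
    using Suc.IH[of "\<lambda>a. q (k, a)"] by blast
  let ?A = "ip n ?v ?v" and ?B = "ip n (gs n q k z) ?v"
  show ?case
  proof (rule exI[of _ "\<lambda>i. if i = k then - ?B * ?c else ?A * d i - ?B * d' i"], rule allI)
    fix a
    have "gs n q (Suc k) z a = ?A * (?c * z a + (\<Sum>i<k. d i * q (i, a)))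
        - ?B * (?c * q (k, a) + (\<Sum>i<k. d' i * q (i, a)))"
      unfolding d[rule_format, symmetric] d'[rule_format, symmetric] by (simp add: proj_def)
    also have "\<dots> = (\<Prod>i<Suc k. ip n (gs n q i (\<lambda>a. q (i, a))) (gs n q i (\<lambda>a. q (i, a)))) * z a
      + ((\<Sum>i<k. (?A * d i - ?B * d' i) * q (i, a)) + (- ?B * ?c) * q (k, a))"
      by (simp add: algebra_simps sum_distrib_left sum_distrib_right sum_subtractf)
    also have "(\<Sum>i<k. (?A * d i - ?B * d' i) * q (i, a)) + (- ?B * ?c) * q (k, a)
      = (\<Sum>i<Suc k. (if i = k then - ?B * ?c else ?A * d i - ?B * d' i) * q (i, a))"
      by simp
    finally show "gs n q (Suc k) z a = (\<Prod>i<Suc k. ip n (gs n q i (\<lambda>a. q (i, a))) (gs n q i (\<lambda>a. q (i, a)))) * z a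
      + (\<Sum>i<Suc k. (if i = k then - ?B * ?c else ?A * d i - ?B * d' i) * q (i, a))" .
  qed
qed simp

text \<open>For orthogonal vectors every projection is a mere scaling. This supports the explicit
  witness in \<open>mr_superadditive\<close>.\<close>

lemma gs_of_orthogonal:
  assumes "\<And>i j. i < b \<Longrightarrow> j < b \<Longrightarrow> i \<noteq> j \<Longrightarrow> ip n (\<lambda>a. q (i, a)) (\<lambda>a. q (j, a)) = 0"
    and "\<And>i. i < b \<Longrightarrow> ip n (\<lambda>a. q (i, a)) (\<lambda>a. q (i, a)) \<noteq> 0"
  shows "k \<le> b \<Longrightarrow> \<exists>s. s \<noteq> 0 \<and> (\<forall>z. (\<forall>i<k. ip n z (\<lambda>a. q (i, a)) = 0) \<longrightarrow> gs n q k z = (\<lambda>a. s * z a))"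
proof (induction k)
  case (Suc k)
  obtain s where s: "s \<noteq> 0" "\<forall>z. (\<forall>i<k. ip n z (\<lambda>a. q (i, a)) = 0) \<longrightarrow> gs n q k z = (\<lambda>a. s * z a)"
    using Suc by auto
  have v: "gs n q k (\<lambda>a. q (k, a)) = (\<lambda>a. s * q (k, a))" using s(2) assms(1) Suc.prems by auto
  let ?A = "ip n (\<lambda>a. s * q (k, a)) (\<lambda>a. s * q (k, a))"
  have A: "?A = s * cnj s * ip n (\<lambda>a. q (k, a)) (\<lambda>a. q (k, a))"
    by (simp add: ip_def sum_distrib_left mult_ac)
  have A0: "?A \<noteq> 0" unfolding A using s(1) assms(2)[of k] Suc.prems by simp
  show ?case
  proof (intro exI[of _ "?A * s"] conjI allI impI)
    show "?A * s \<noteq> 0" using A0 s(1) by simp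
    fix z assume z: "\<forall>i<Suc k. ip n z (\<lambda>a. q (i, a)) = 0"
    then have gz: "gs n q k z = (\<lambda>a. s * z a)" using s(2) by auto
    have "ip n (\<lambda>a. s * z a) (\<lambda>a. s * q (k, a)) = s * cnj s * ip n z (\<lambda>a. q (k, a))"
      by (simp add: ip_def sum_distrib_left mult_ac)
    then have "ip n (\<lambda>a. s * z a) (\<lambda>a. s * q (k, a)) = 0" using z by simp
    then show "gs n q (Suc k) z = (\<lambda>a. ?A * s * z a)" by (simp add: gz v proj_def mult.assoc)
  qed
qed (auto intro: exI[of _ 1])

lemma rpoly_ip:
  assumes "\<And>j. rpoly (\<lambda>t. x t j)" "\<And>j. rpoly (\<lambda>t. w t j)"
  shows "rpoly (\<lambda>t. ip n (x t) (w t))"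
  unfolding ip_def by (intro rpoly_sum rpoly_mult rpoly_cnj assms)

lemma rpoly_gs:
  assumes "\<And>p. rpoly (\<lambda>t. q t p)"
  shows "(\<And>a. rpoly (\<lambda>t. z t a)) \<Longrightarrow> rpoly (\<lambda>t. gs n (q t) k (z t) a)"
proof (induction k arbitrary: z a)
  case (Suc k)
  have "rpoly (\<lambda>t. gs n (q t) k (\<lambda>a. q t (k, a)) a)" for a by (rule Suc.IH) (rule assms)
  then show ?case
    using Suc unfolding gs.simps proj_def by (intro rpoly_diff rpoly_mult rpoly_ip) auto
qed simp

context orth_map
begin

lemma gs_nonzero:
  assumes "idv b q" "l < b"
  shows "ip n (gs n q l (\<lambda>a. q (l, a))) (gs n q l (\<lambda>a. q (l, a))) \<noteq> 0"
  using assms(2)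
proof (induction l rule: less_induct)
  case (less l)
  let ?c = "\<Prod>i<l. ip n (gs n q i (\<lambda>a. q (i, a))) (gs n q i (\<lambda>a. q (i, a)))"
  have c0: "?c \<noteq> 0" using less by auto
  obtain d where d: "\<forall>a. gs n q l (\<lambda>a. q (l, a)) a = ?c * q (l, a) + (\<Sum>i<l. d i * q (i, a))"
    using gs_expand[of n q l "\<lambda>a. q (l, a)"] by blast
  show ?case
  proof
    assume "ip n (gs n q l (\<lambda>a. q (l, a))) (gs n q l (\<lambda>a. q (l, a))) = 0"
    then have z: "\<forall>a<n. ?c * q (l, a) + (\<Sum>i<l. d i * q (i, a)) = 0" unfolding ip_self_zero d[rule_format] .
    have "(\<Sum>j<b. (if j = l then ?c else if j < l then d j else 0) * (if a < n then q (j, a) else 0)) = 0" for a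
    proof (cases "a < n")
      case True
      have "(\<Sum>j<b. (if j = l then ?c else if j < l then d j else 0) * q (j, a))
        = (\<Sum>j<Suc l. (if j = l then ?c else if j < l then d j else 0) * q (j, a))"
        using less.prems by (intro sum.mono_neutral_right) auto
      also have "\<dots> = (\<Sum>i<l. d i * q (i, a)) + ?c * q (l, a)" by simp
      finally show ?thesis using z True by (simp add: add.commute)
    qed simp
    from indfD[OF assms(1), of "\<lambda>j. if j = l then ?c else if j < l then d j else 0" l, OF this]
    show False using less.prems c0 by simp
  qed
qed

text \<open>By \<open>h_A\<close> the two spans of values are orthogonal, so a vector in both is
  orthogonal to itself and the ranks add.\<close>

lemma orthogonal_rank:
  assumes "\<And>c d. ip n (P c) (P' d) = 0"
  shows "rk (\<lambda>c. h (P c)) UNIV + rk (\<lambda>d. h (P' d)) UNIV \<le> rk h UNIV"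
proof -
  have bdP: "bd (\<lambda>c. h (P c))" "bd (\<lambda>c. h (P' c))" using rvec_bd[OF rvec_h] unfolding bd_def by blast+
  obtain B where B: "indf (\<lambda>c. h (P c)) B" "card B = rk (\<lambda>c. h (P c)) UNIV" using rk_witness[OF bdP(1)] by metis
  obtain B' where B': "indf (\<lambda>c. h (P' c)) B'" "card B' = rk (\<lambda>c. h (P' c)) UNIV" using rk_witness[OF bdP(2)] by metis
  have fin: "finite B" "finite B'" using B B' indf_finite by blast+
  define E where "E = case_sum (\<lambda>c. h (P c)) (\<lambda>c. h (P' c))"
  have bdE: "bd E" unfolding bd_def E_def
    by (intro exI[of _ "{..<N}"]) (auto simp: supp_h not_less split: sum.splits)
  let ?I = "Inl ` B \<union> Inr ` B'"
  have "indf E ?I"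
  proof (rule indfI)
    show "finite ?I" using fin by simp
    fix \<beta> b assume z: "\<And>i. (\<Sum>b\<in>?I. \<beta> b * E b i) = 0" and b: "b \<in> ?I"
    let ?u = "\<lambda>i. \<Sum>c\<in>B. \<beta> (Inl c) * h (P c) i" and ?w = "\<lambda>i. \<Sum>c\<in>B'. \<beta> (Inr c) * h (P' c) i"
    have e: "?u i + ?w i = 0" for i
    proof -
      have "(\<Sum>x\<in>?I. \<beta> x * E x i) = (\<Sum>x\<in>Inl ` B. \<beta> x * E x i) + (\<Sum>x\<in>Inr ` B'. \<beta> x * E x i)"
        using fin by (intro sum.union_disjoint) auto
      then show ?thesis using z[of i] by (simp add: sum.reindex E_def)
    qed
    have "(\<Sum>i<N. ?u i * cnj (?w i)) = (\<Sum>i<N. \<Sum>c\<in>B. \<Sum>d\<in>B'. \<beta> (Inl c) * cnj (\<beta> (Inr d)) * (h (P c) i * cnj (h (P' d) i)))"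
      by (simp add: sum_product mult_ac)
    also have "\<dots> = (\<Sum>c\<in>B. \<Sum>i<N. \<Sum>d\<in>B'. \<beta> (Inl c) * cnj (\<beta> (Inr d)) * (h (P c) i * cnj (h (P' d) i)))"
      by (rule sum.swap)
    also have "\<dots> = (\<Sum>c\<in>B. \<Sum>d\<in>B'. \<Sum>i<N. \<beta> (Inl c) * cnj (\<beta> (Inr d)) * (h (P c) i * cnj (h (P' d) i)))"
      by (intro sum.cong refl) (rule sum.swap)
    also have "\<dots> = (\<Sum>c\<in>B. \<Sum>d\<in>B'. \<beta> (Inl c) * cnj (\<beta> (Inr d)) * (\<Sum>i<N. h (P c) i * cnj (h (P' d) i)))"
      by (simp only: sum_distrib_left)
    also have "\<dots> = 0" by (simp add: h_A assms)
    finally have "(\<Sum>i<N. ?u i * cnj (?w i)) = 0" .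
    moreover have "?w i = - ?u i" for i using e[of i] by (simp add: add_eq_0_iff)
    ultimately have "- (\<Sum>i<N. ?u i * cnj (?u i)) = 0" by (simp add: sum_negf)
    then have "ip N ?u ?u = 0" by (simp add: ip_def)
    then have u0: "?u i = 0" for i by (cases "i < N") (auto simp: ip_self_zero supp_h)
    then have w0: "?w i = 0" for i using e[of i] by simp
    have "\<beta> (Inl c) = 0" if "c \<in> B" for c using indfD[OF B(1), of "\<lambda>c. \<beta> (Inl c)"] u0 that by blast
    moreover have "\<beta> (Inr c) = 0" if "c \<in> B'" for c using indfD[OF B'(1), of "\<lambda>c. \<beta> (Inr c)"] w0 that by blast
    ultimately show "\<beta> b = 0" using b by blast
  qed
  then have "card ?I \<le> rk E UNIV" by (intro rk_ge[OF bdE]) auto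
  also have "\<dots> \<le> rk h UNIV"
  proof (rule rk_le_image[OF rvec_bd[OF rvec_h] bdE])
    show "\<exists>c\<in>UNIV. E x = h c" for x by (cases x) (auto simp: E_def)
  qed
  finally have "card ?I \<le> rk h UNIV" .
  moreover have "card ?I = card B + card B'"
    using fin by (subst card_Un_disjoint) (auto simp: card_image inj_on_def)
  ultimately show ?thesis using B(2) B'(2) by simp
qed

text \<open>The two subspaces have to be generic and orthogonal at once. The second is spanned by
  projections of further vectors of the same configuration, so genericity of both becomes a
  condition on one configuration.\<close>

lemma mr_superadditive:
  assumes "b \<le> n"
  shows "mr h b + mr h (n - b) \<le> mr h n"
proof -
  let ?m = "n - b"
  define q' where "q' q = (\<lambda>(j, a). gs n q b (\<lambda>a. q (b + j, a)) a)" for q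
  let ?B = "\<lambda>q. mr h b \<le> rk (\<lambda>c. h (pt b q c)) UNIV"
  let ?C = "\<lambda>q. mr h ?m \<le> rk (\<lambda>c. h (pt ?m (q' q) c)) UNIV"
  have gB: "gen ?B" by (rule gen_mr[OF rvec_h])
  have gC: "gen ?C"
  proof (rule gen_rk)
    show "ubd (\<lambda>q c. h (pt ?m (q' q) c))"
      using rvec_bd[OF rvec_h] unfolding bd_def ubd_def by blast
    fix x y :: "nat \<times> nat \<Rightarrow> complex" and c :: "nat \<Rightarrow> complex" and i
    show "rpoly (\<lambda>t. h (pt ?m (q' (pline x y t)) c) i)"
    proof (intro rvec_rpoly[OF rvec_h] rpoly_pt rpoly_const)
      fix j a
      have "rpoly (\<lambda>t. gs n (pline x y t) b (\<lambda>a. pline x y t (b + j, a)) a)"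
        by (intro rpoly_gs rpoly_pline)
      then show "rpoly (\<lambda>t. q' (pline x y t) (j, a))" by (simp add: q'_def)
    qed
  qed
  obtain qB where qB: "?B qB" using mr_ex[OF rvec_h] by blast
  obtain qm where qm: "mr h ?m \<le> rk (\<lambda>c. h (pt ?m qm c)) UNIV" using mr_ex[OF rvec_h] by blast
  have "\<exists>q0. mr h ?m \<le> rk (\<lambda>c. h (pt ?m q0 c)) UNIV \<and> idv n q0"
    by (rule gen_ex_conj[where x = qm and y = uq, OF gen_mr[OF rvec_h] gen_idv qm idv_uq]) simp
  then obtain q0 where q0: "mr h ?m \<le> rk (\<lambda>c. h (pt ?m q0 c)) UNIV" "idv n q0" by blast
  \<comment> \<open>The witness for \<open>?C\<close>: an orthogonal basis of the complement of the
    first \<open>?m\<close> vectors of \<open>q0\<close>, followed by these vectors themselves, so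
    that projecting only rescales them.\<close>
  define q1 where "q1 = (\<lambda>(j, a). if j < b then gs n q0 (?m + j) (\<lambda>a. q0 (?m + j, a)) a else q0 (j - b, a))"
  have q1b: "(\<lambda>a. q1 (i, a)) = gs n q0 (?m + i) (\<lambda>a. q0 (?m + i, a))" if "i < b" for i
    using that by (simp add: q1_def)
  have orth: "ip n (\<lambda>a. q1 (i, a)) (\<lambda>a. q1 (j, a)) = 0" if "i < b" "j < b" "i \<noteq> j" for i j
  proof (cases "j < i")
    case True
    then show ?thesis unfolding q1b[OF that(1)] q1b[OF that(2)] by (intro gs_orth) simp
  next
    case False
    then show ?thesis using that(3) unfolding q1b[OF that(1)] q1b[OF that(2)]
      by (intro ip_zero_sym[OF gs_orth]) simp
  qed
  have nz: "ip n (\<lambda>a. q1 (i, a)) (\<lambda>a. q1 (i, a)) \<noteq> 0" if "i < b" for i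
    unfolding q1b[OF that] using that assms by (intro gs_nonzero[OF q0(2)]) simp
  obtain s where s: "s \<noteq> 0" "\<forall>z. (\<forall>i<b. ip n z (\<lambda>a. q1 (i, a)) = 0) \<longrightarrow> gs n q1 b z = (\<lambda>a. s * z a)"
    using gs_of_orthogonal[of b n q1 b, OF orth nz] by auto
  have q1': "q' q1 (j, a) = s * q0 (j, a)" if "j < ?m" for j a
  proof -
    have "ip n (\<lambda>a. q0 (j, a)) (\<lambda>a. q1 (i, a)) = 0" if "i < b" for i
      unfolding q1b[OF that] using \<open>j < ?m\<close> by (intro gs_orth_orig) simp
    then have "gs n q1 b (\<lambda>a. q0 (j, a)) = (\<lambda>a. s * q0 (j, a))" using s(2) by blast
    moreover have "(\<lambda>a. q1 (b + j, a)) = (\<lambda>a. q0 (j, a))" by (simp add: q1_def)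
    ultimately show ?thesis by (simp add: q'_def)
  qed
  have qC: "?C q1"
  proof -
    have "rk (\<lambda>c. h (pt ?m q0 c)) UNIV \<le> rk (\<lambda>c. h (pt ?m (q' q1) c)) UNIV"
    proof (rule rk_le_image[OF bd_pt[OF rvec_h] bd_pt[OF rvec_h]])
      fix c :: "nat \<Rightarrow> complex"
      have "pt ?m (q' q1) (\<lambda>j. c j / s) = pt ?m q0 c"
        unfolding pt_def using s(1) by (intro ext sum.cong refl) (simp add: q1')
      then show "\<exists>d\<in>UNIV. h (pt ?m q0 c) = h (pt ?m (q' q1) d)" by (metis UNIV_I)
    qed
    then show ?thesis using q0(1) by simp
  qed
  have "\<exists>q. ?B q \<and> ?C q"
    by (rule gen_ex_conj[where P = ?B and Q = ?C and x = qB and y = q1, OF gB gC qB qC])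
  then obtain q where q: "?B q \<and> ?C q" by (rule exE)
  have "rk (\<lambda>c. h (pt b q c)) UNIV + rk (\<lambda>c. h (pt ?m (q' q) c)) UNIV \<le> rk h UNIV"
  proof (rule orthogonal_rank)
    fix c d
    have "ip n (\<lambda>a. q (i, a)) (pt ?m (q' q) d) = 0" if "i < b" for i
    proof (rule ip_zero_sym)
      have "ip n (\<lambda>a. q' q (j, a)) (\<lambda>a. q (i, a)) = 0" for j
        unfolding q'_def prod.case by (rule ip_zero_sym[OF gs_orth_orig[OF that]])
      then show "ip n (pt ?m (q' q) d) (\<lambda>a. q (i, a)) = 0" unfolding ip_pt by simp
    qed
    then show "ip n (pt b q c) (pt ?m (q' q) d) = 0" unfolding ip_pt[of n b] by simp
  qed
  then show ?thesis using q unfolding mr_n by linarith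
qed

end

section \<open>The growth dichotomy\<close>

lemma bd_scale: "bd g \<Longrightarrow> bd (\<lambda>c i. l c * g c i)"
  unfolding bd_def by (erule ex_forward) auto

context orth_map
begin

text \<open>The coefficients of \<open>s ^ l\<close> in \<open>h (y + s e)\<close>, where \<open>y\<close> has the coordinates \<open>c\<close> in the span of the
  first \<open>b\<close> vectors of \<open>q\<close> and \<open>e\<close> is the next vector of \<open>q\<close>.\<close>

definition jt :: "nat \<Rightarrow> (nat \<times> nat \<Rightarrow> complex) \<Rightarrow> nat \<times> (nat \<Rightarrow> complex) \<Rightarrow> nat \<Rightarrow> complex" where
  "jt b q x \<mu> = coeff (jpoly (\<lambda>y. h y \<mu>) (pt b q (snd x)) (\<lambda>a. q (b, a))) (fst x)"

abbreviation CL :: "nat \<Rightarrow> (nat \<times> (nat \<Rightarrow> complex)) set" where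
  "CL l \<equiv> {x. fst x \<le> l}"

lemma jt_0: "jt b q (0, c) = h (pt b q c)"
  using polyfun_jpoly(1)[OF poly_h, of _ "pt b q c" "\<lambda>a. q (b, a)" 0]
  by (auto simp: jt_def poly_0_coeff_0[symmetric])

lemma jpoly_supp: "N \<le> \<mu> \<Longrightarrow> jpoly (\<lambda>y. h y \<mu>) z e = 0"
  by (rule jpoly_eqI) (simp add: supp_h)

lemma ubd_jt: "ubd (jt b)"
  unfolding ubd_def by (intro exI[of _ "{..<N}"]) (auto simp: jt_def jpoly_supp not_less)

lemma bd_jt: "bd (jt b q)"
  by (rule ubd_bd[OF ubd_jt])

lemma rpoly_jt:
  assumes "\<And>p. rpoly (\<lambda>t. q t p)" "\<And>j. rpoly (\<lambda>t. c t j)"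
  shows "rpoly (\<lambda>t. jt b (q t) (l, c t) \<mu>)"
  unfolding jt_def fst_conv snd_conv by (intro polyfun_jpoly(3)[OF poly_h] rpoly_pt assms)

lemma degree_bound: "\<exists>K. \<forall>\<mu> z e. degree (jpoly (\<lambda>y. h y \<mu>) z e) \<le> K"
proof -
  have "\<forall>\<mu>. \<exists>K. \<forall>z e. degree (jpoly (\<lambda>y. h y \<mu>) z e) \<le> K" using polyfun_jpoly(2)[OF poly_h] by blast
  then obtain Kf where Kf: "\<forall>\<mu>. \<forall>z e. degree (jpoly (\<lambda>y. h y \<mu>) z e) \<le> Kf \<mu>" by metis
  have "degree (jpoly (\<lambda>y. h y \<mu>) z e) \<le> (\<Sum>\<mu><N. Kf \<mu>)" for \<mu> z e
  proof (cases "\<mu> < N")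
    case True
    have "Kf \<mu> \<le> (\<Sum>\<mu><N. Kf \<mu>)" using True by (intro member_le_sum) auto
    then show ?thesis using Kf le_trans by blast
  qed (simp add: jpoly_supp)
  then show ?thesis by blast
qed

text \<open>Adding \<open>t\<close> times the normal vector to the \<open>j\<close>-th vector of
  \<open>q\<close> moves the point with coordinates \<open>c\<close> by \<open>t * c j\<close> in
  the normal direction. By \<open>jpoly_shift\<close> the derivative of its jet of order
  \<open>l\<close> is \<open>c j * (l + 1)\<close> times the jet of order \<open>l + 1\<close>, and
  maximality of the rank makes \<open>pencil_relation\<close> applicable.\<close>

lemma jet_relation:
  assumes max: "\<And>q'. rk (jt b q') (CL l) \<le> rk (jt b q) (CL l)" and j: "j < b"
    and F: "finite F" "F \<subseteq> CL l" "\<And>\<mu>. (\<Sum>x\<in>F. \<beta> x * jt b q x \<mu>) = 0"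
  shows "(\<lambda>\<mu>. \<Sum>x\<in>F. \<beta> x * (snd x j * (of_nat (Suc (fst x)) * jt b q (Suc (fst x), snd x) \<mu>)))
    \<in> fv.span (jt b q ` CL l)"
proof -
  define qt where "qt t = (\<lambda>(i, a). q (i, a) + (if i = j then of_real t * q (b, a) else 0))" for t :: real
  have qt0: "qt 0 = q" by (auto simp: qt_def)
  have "\<exists>R. \<forall>x \<mu>. \<forall>\<tau>. coeff (pcompose (jpoly (\<lambda>y. h y \<mu>) (pt b q (snd x)) (\<lambda>a. q (b, a))) [:\<tau>, 1:]) (fst x)
      = jt b q x \<mu> + \<tau> * (of_nat (Suc (fst x)) * jt b q (Suc (fst x), snd x) \<mu>) + \<tau>^2 * poly (R x \<mu>) \<tau>"
    unfolding jt_def fst_conv snd_conv by (intro choice allI coeff_shift_expansion)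
  then obtain R where R: "\<forall>x \<mu>. \<forall>\<tau>. coeff (pcompose (jpoly (\<lambda>y. h y \<mu>) (pt b q (snd x)) (\<lambda>a. q (b, a))) [:\<tau>, 1:]) (fst x)
      = jt b q x \<mu> + \<tau> * (of_nat (Suc (fst x)) * jt b q (Suc (fst x), snd x) \<mu>) + \<tau>^2 * poly (R x \<mu>) \<tau>" ..
  have ptq: "pt b (qt t) c = (\<lambda>a. pt b q c a + (of_real t * c j) * q (b, a))" for t c
  proof
    fix a
    have "pt b (qt t) c a = (\<Sum>i<b. c i * q (i, a)) + (\<Sum>i<b. if i = j then c j * (of_real t * q (b, a)) else 0)"
      unfolding pt_def qt_def prod.case sum.distrib[symmetric]
      by (intro sum.cong refl) (simp add: distrib_left)
    then show "pt b (qt t) c a = pt b q c a + (of_real t * c j) * q (b, a)"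
      using j by (simp add: pt_def mult_ac)
  qed
  have qb: "(\<lambda>a. qt t (b, a)) = (\<lambda>a. q (b, a))" for t using j by (simp add: qt_def)
  have exp: "jt b (qt t) x \<mu> = jt b (qt 0) x \<mu>
      + of_real t * (snd x j * (of_nat (Suc (fst x)) * jt b q (Suc (fst x), snd x) \<mu>))
      + of_real t ^ 2 * ((snd x j)^2 * poly (R x \<mu>) (of_real t * snd x j))" for t x \<mu>
  proof -
    have "jt b (qt t) x \<mu> = coeff (pcompose (jpoly (\<lambda>y. h y \<mu>) (pt b q (snd x)) (\<lambda>a. q (b, a)))
        [:of_real t * snd x j, 1:]) (fst x)"
      unfolding jt_def ptq qb by (simp only: jpoly_shift[OF poly_h])
    then show ?thesis unfolding R[rule_format] qt0 by (simp add: power_mult_distrib mult_ac)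
  qed
  have "(\<lambda>\<mu>. \<Sum>x\<in>F. \<beta> x * (snd x j * (of_nat (Suc (fst x)) * jt b q (Suc (fst x), snd x) \<mu>)))
    \<in> fv.span (jt b (qt 0) ` CL l)"
  proof (rule pencil_relation[where \<Phi> = "\<lambda>t. jt b (qt t)" and C = "CL l" and
      r = "\<lambda>t x \<mu>. (snd x j)^2 * poly (R x \<mu>) (of_real t * snd x j)"])
    show "ubd (\<lambda>t. jt b (qt t))" using ubd_jt[of b] unfolding ubd_def by blast
    show "rk (jt b (qt t)) (CL l) \<le> rk (jt b (qt 0)) (CL l)" for t unfolding qt0 by (rule max)
    show "rpoly (\<lambda>t. (snd x j)^2 * poly (R x \<mu>) (of_real t * snd x j))" for x \<mu>
    proof (intro rpoly_mult rpoly_const)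
      have "poly (R x \<mu>) (of_real t * snd x j) = poly (pcompose (R x \<mu>) [:0, snd x j:]) (of_real t)" for t
        by (simp add: poly_pcompose)
      then show "rpoly (\<lambda>t. poly (R x \<mu>) (of_real t * snd x j))" unfolding rpoly_def by blast
    qed
  qed (use F exp qt0 in simp_all)
  then show ?thesis by (simp only: qt0)
qed

lemma normal_vector:
  assumes "idv b q" "1 \<le> b"
  obtains w where "\<And>i. i < b - 1 \<Longrightarrow> ip n (\<lambda>a. q (i, a)) w = 0" "ip n (\<lambda>a. q (b - 1, a)) w \<noteq> 0"
proof -
  let ?w = "gs n q (b - 1) (\<lambda>a. q (b - 1, a))"
  obtain d where d: "\<forall>a. ?w a = (\<Prod>i<b - 1. ip n (gs n q i (\<lambda>a. q (i, a))) (gs n q i (\<lambda>a. q (i, a)))) * q (b - 1, a)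
      + (\<Sum>i<b - 1. d i * q (i, a))"
    using gs_expand[of n q "b - 1" "\<lambda>a. q (b - 1, a)"] by blast
  let ?c = "\<Prod>i<b - 1. ip n (gs n q i (\<lambda>a. q (i, a))) (gs n q i (\<lambda>a. q (i, a)))"
  have o: "ip n (\<lambda>a. q (i, a)) ?w = 0" if "i < b - 1" for i using that by (rule gs_orth_orig)
  have "ip n ?w ?w = ip n (\<lambda>a. ?c * q (b - 1, a) + (\<Sum>i<b - 1. d i * q (i, a))) ?w"
    using d by (intro ip_cong) auto
  also have "\<dots> = ?c * ip n (\<lambda>a. q (b - 1, a)) ?w + (\<Sum>i<b - 1. d i * ip n (\<lambda>a. q (i, a)) ?w)"
    by (simp only: ip_add_left ip_scale_left ip_sum_left)
  also have "\<dots> = ?c * ip n (\<lambda>a. q (b - 1, a)) ?w" using o by simp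
  finally have "?c * ip n (\<lambda>a. q (b - 1, a)) ?w \<noteq> 0" using gs_nonzero[OF assms(1), of "b - 1"] assms(2) by auto
  then have "ip n (\<lambda>a. q (b - 1, a)) ?w \<noteq> 0" by auto
  then show ?thesis using o that by blast
qed

lemma pt_nonzero:
  assumes "idv b q" "j < b" "c j \<noteq> 0"
  shows "ip n (pt b q c) (pt b q c) \<noteq> 0"
proof
  assume "ip n (pt b q c) (pt b q c) = 0"
  then have z: "\<forall>a<n. pt b q c a = 0" by (simp only: ip_self_zero)
  have "(\<Sum>j<b. c j * (if a < n then q (j, a) else 0)) = 0" for a
    using z by (cases "a < n") (auto simp: pt_def)
  from indfD[OF assms(1), of c j, OF this] show False using assms by simp
qed

text \<open>Write the jet of order \<open>l - 1\<close> through jets of order at most 1 and apply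
  \<open>jet_relation\<close>: it contributes \<open>c j * l\<close> times the jet of order
  \<open>l\<close>, while all other terms have order at most 2.\<close>

lemma jets_reduce:
  assumes max: "\<And>l q'. l \<le> K + 2 \<Longrightarrow> rk (jt b q') (CL l) \<le> rk (jt b q) (CL l)" and b: "1 \<le> b"
    and two: "\<And>c. jt b q (2, c) \<in> fv.span (jt b q ` CL 1)" and l: "l \<le> K"
  shows "jt b q (l, c) \<in> fv.span (jt b q ` CL 1)"
  using l
proof (induction l arbitrary: c rule: less_induct)
  case (less l)
  let ?S = "fv.span (jt b q ` CL 1)"
  consider "l \<le> 1" | "l = 2" | "3 \<le> l" by linarith
  then show ?case
  proof cases
    case 1
    then show ?thesis by (intro span_fam_base) simp
  next
    case 2
    then show ?thesis using two by simp
  next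
    case 3
    have nz: "jt b q (l, c) \<in> ?S" if cj: "j < b" "c j \<noteq> 0" for j c
    proof -
      have "jt b q (l - 1, c) \<in> ?S" using less 3 by simp
      then obtain F \<beta> where F: "finite F" "F \<subseteq> CL 1" "\<forall>\<mu>. jt b q (l - 1, c) \<mu> = (\<Sum>x\<in>F. \<beta> x * jt b q x \<mu>)"
        unfolding span_fam by blast
      have nF: "(l - 1, c) \<notin> F" using F(2) 3 by auto
      define \<beta>' where "\<beta>' x = (if x = (l - 1, c) then 1 else - \<beta> x)" for x
      let ?D = "\<lambda>x \<mu>. snd x j * (of_nat (Suc (fst x)) * jt b q (Suc (fst x), snd x) \<mu>)"
      have eF: "(\<Sum>x\<in>F. \<beta>' x * g x) = - (\<Sum>x\<in>F. \<beta> x * g x)" for g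
        using nF unfolding sum_negf[symmetric] by (intro sum.cong) (auto simp: \<beta>'_def)
      have "(\<lambda>\<mu>. \<Sum>x\<in>insert (l - 1, c) F. \<beta>' x * ?D x \<mu>) \<in> fv.span (jt b q ` CL (l - 1))"
      proof (rule jet_relation)
        show "(\<Sum>x\<in>insert (l - 1, c) F. \<beta>' x * jt b q x \<mu>) = 0" for \<mu>
          using F nF eF[of "\<lambda>x. jt b q x \<mu>"] by (simp add: \<beta>'_def)
        show "rk (jt b q') (CL (l - 1)) \<le> rk (jt b q) (CL (l - 1))" for q'
          using max less.prems by simp
        show "insert (l - 1, c) F \<subseteq> CL (l - 1)" using F(2) 3 by auto
      qed (use F cj in auto)
      moreover have "fv.span (jt b q ` CL (l - 1)) \<subseteq> ?S"
      proof (rule fv.span_minimal)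
        show "jt b q ` CL (l - 1) \<subseteq> ?S"
        proof (rule image_subsetI)
          fix x assume x: "x \<in> CL (l - 1)"
          have "jt b q (fst x, snd x) \<in> ?S" using x 3 less.prems by (intro less.IH) auto
          then show "jt b q x \<in> ?S" by simp
        qed
      qed simp
      ultimately have m1: "(\<lambda>\<mu>. \<Sum>x\<in>insert (l - 1, c) F. \<beta>' x * ?D x \<mu>) \<in> ?S" by blast
      have m2: "(\<Sum>x\<in>F. fscale (\<beta> x * snd x j * of_nat (Suc (fst x))) (jt b q (Suc (fst x), snd x))) \<in> ?S"
      proof (intro fv.span_sum fv.span_scale)
        fix x assume "x \<in> F"
        then have "fst x = 0 \<or> fst x = 1" using F(2) by auto
        then show "jt b q (Suc (fst x), snd x) \<in> ?S"
          using two[of "snd x"] by (auto intro: span_fam_base simp: numeral_2_eq_2)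
      qed
      have "fscale (inverse (c j * of_nat l)) ((\<lambda>\<mu>. \<Sum>x\<in>insert (l - 1, c) F. \<beta>' x * ?D x \<mu>)
          + (\<Sum>x\<in>F. fscale (\<beta> x * snd x j * of_nat (Suc (fst x))) (jt b q (Suc (fst x), snd x)))) \<in> ?S"
        by (intro fv.span_scale fv.span_add m1 m2)
      also have "fscale (inverse (c j * of_nat l)) ((\<lambda>\<mu>. \<Sum>x\<in>insert (l - 1, c) F. \<beta>' x * ?D x \<mu>)
          + (\<Sum>x\<in>F. fscale (\<beta> x * snd x j * of_nat (Suc (fst x))) (jt b q (Suc (fst x), snd x))))
          = jt b q (l, c)"
      proof
        fix \<mu>
        have "(\<Sum>x\<in>insert (l - 1, c) F. \<beta>' x * ?D x \<mu>) = c j * (of_nat l * jt b q (l, c) \<mu>) - (\<Sum>x\<in>F. \<beta> x * ?D x \<mu>)"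
          using F nF 3 eF[of "\<lambda>x. ?D x \<mu>"] by (simp add: \<beta>'_def)
        moreover have "(\<Sum>x\<in>F. fscale (\<beta> x * snd x j * of_nat (Suc (fst x))) (jt b q (Suc (fst x), snd x))) \<mu>
            = (\<Sum>x\<in>F. \<beta> x * ?D x \<mu>)"
          by (simp add: sum_fun_app fscale_def mult_ac)
        ultimately show "fscale (inverse (c j * of_nat l)) ((\<lambda>\<mu>. \<Sum>x\<in>insert (l - 1, c) F. \<beta>' x * ?D x \<mu>)
          + (\<Sum>x\<in>F. fscale (\<beta> x * snd x j * of_nat (Suc (fst x))) (jt b q (Suc (fst x), snd x)))) \<mu> = jt b q (l, c) \<mu>"
          using cj 3 by (simp add: fscale_def field_simps)
      qed
      finally show ?thesis .
    qed
    \<comment> \<open>The argument divides by a coordinate \<open>c j\<close>; points without a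
      nonzero coordinate are reached as limits.\<close>
    let ?z = "\<lambda>t::real. \<lambda>j. c j + of_real t * unit 0 j"
    have r: "rpoly (\<lambda>t. ?z t j)" for j by (intro rpoly_add rpoly_mult rpoly_const rpoly_id)
    have "?z (1 + \<bar>Re (c 0)\<bar>) 0 \<noteq> 0" by (auto simp: unit_def complex_eq_iff)
    then have "finite {t. ?z t 0 = 0}" using rpoly_finite[where f = "\<lambda>t. ?z t 0", OF r] by blast
    then have "finite {t. \<not> jt b q (l, ?z t) \<in> ?S}"
      by (rule rev_finite_subset) (use nz[of 0 "?z _"] b in auto)
    then have "jt b q (l, ?z 0) \<in> ?S"
      by (intro span_closed[where v = "\<lambda>t. jt b q (l, ?z t)"] bd_jt rpoly_jt rpoly_const r)
    then show ?thesis by simp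
  qed
qed

text \<open>If the jets of order 2 reduce to order at most 1, so do all others, and the expansion in
  the normal direction brings every value of \<open>h\<close> on \<open>b + 1\<close> vectors into
  their span. Otherwise a functional detects some jet of order 2, with value \<open>w c\<close> at
  \<open>c\<close>; by \<open>jet_relation\<close> the vectors \<open>c\<close> scaled by
  \<open>w c\<close> factor through the jets of order at most 1 modulo values, and they have rank
  \<open>b\<close>.\<close>

lemma normal_jet_rank:
  assumes max: "\<And>l q'. l \<le> K + 2 \<Longrightarrow> rk (jt b q') (CL l) \<le> rk (jt b q) (CL l)" and b: "1 \<le> b"
    and K: "\<And>\<mu> z e. degree (jpoly (\<lambda>y. h y \<mu>) z e) \<le> K"
    and top: "mr h (b + 1) \<le> rk (\<lambda>c. h (pt (b + 1) q c)) UNIV"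
  shows "mr h (b + 1) \<le> rk (jt b q) (CL 1) \<or> rk (jt b q) (CL 0) + b \<le> rk (jt b q) (CL 1)"
proof (cases "\<forall>c. jt b q (2, c) \<in> fv.span (jt b q ` CL 1)")
  case True
  have red: "jt b q (l, c) \<in> fv.span (jt b q ` CL 1)" if "l \<le> K" for l c
    using jets_reduce[of K b q, OF max b _ that] True by blast
  have "rk (\<lambda>c. h (pt (b + 1) q c)) UNIV \<le> rk (jt b q) (CL 1)"
  proof (rule rk_le_span[OF bd_jt bd_pt[OF rvec_h]])
    fix c :: "nat \<Rightarrow> complex"
    have "h (pt (b + 1) q c) = (\<Sum>l\<le>K. fscale (c b ^ l) (jt b q (l, c)))"
    proof
      fix \<mu>
      let ?p = "jpoly (\<lambda>y. h y \<mu>) (pt b q c) (\<lambda>a. q (b, a))"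
      have "h (pt (b + 1) q c) \<mu> = poly ?p (c b)"
        using polyfun_jpoly(1)[OF poly_h, of \<mu> "pt b q c" "\<lambda>a. q (b, a)" "c b"] by (simp add: pt_Suc)
      also have "\<dots> = (\<Sum>l\<le>degree ?p. coeff ?p l * c b ^ l)" by (rule poly_altdef)
      also have "\<dots> = (\<Sum>l\<le>K. coeff ?p l * c b ^ l)"
        using K[of \<mu> "pt b q c" "\<lambda>a. q (b, a)"]
        by (intro sum.mono_neutral_left) (auto simp: coeff_eq_0 not_le)
      finally show "h (pt (b + 1) q c) \<mu> = (\<Sum>l\<le>K. fscale (c b ^ l) (jt b q (l, c))) \<mu>"
        by (simp add: sum_fun_app fscale_def jt_def mult.commute)
    qed
    also have "\<dots> \<in> fv.span (jt b q ` CL 1)"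
      using red by (intro fv.span_sum fv.span_scale) auto
    finally show "h (pt (b + 1) q c) \<in> fv.span (jt b q ` CL 1)" .
  qed
  then show ?thesis using top by simp
next
  case False
  then obtain c1 where c1: "jt b q (2, c1) \<notin> fv.span (jt b q ` CL 1)" by blast
  obtain J f where f: "finite J" "\<forall>x\<in>CL 1. (\<Sum>i\<in>J. f i * jt b q x i) = 0" "(\<Sum>i\<in>J. f i * jt b q (2, c1) i) = 1"
    using separating_functional[OF bd_jt c1] by blast
  define w where "w c = (\<Sum>i\<in>J. f i * jt b q (2, c) i)" for c
  have rw: "rpoly (\<lambda>t. w (z t))" if "\<And>j. rpoly (\<lambda>t. z t j)" for z
    unfolding w_def by (intro rpoly_sum rpoly_mult rpoly_const rpoly_jt that)
  define \<psi> where "\<psi> x j = (if fst x = 1 \<and> j < b then snd x j * w (snd x) else 0)"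
    for x :: "nat \<times> (nat \<Rightarrow> complex)" and j
  have bd\<psi>: "bd \<psi>" unfolding bd_def by (intro exI[of _ "{..<b}"]) (auto simp: \<psi>_def)
  have "rk (jt b q) (CL 0) + rk \<psi> (CL 1) \<le> rk (jt b q) (CL 1)"
  proof (rule rk_add[OF bd_jt bd\<psi>])
    show "relfac (jt b q) \<psi> (CL 1)"
      unfolding relfac_def
    proof (intro allI impI)
      fix F \<beta> j assume F: "finite F" "F \<subseteq> CL 1" "\<forall>\<mu>. (\<Sum>x\<in>F. \<beta> x * jt b q x \<mu>) = 0"
      show "(\<Sum>x\<in>F. \<beta> x * \<psi> x j) = 0"
      proof (cases "j < b")
        case True
        let ?D = "\<lambda>x \<mu>. snd x j * (of_nat (Suc (fst x)) * jt b q (Suc (fst x), snd x) \<mu>)"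
        have "(\<lambda>\<mu>. \<Sum>x\<in>F. \<beta> x * ?D x \<mu>) \<in> fv.span (jt b q ` CL 1)"
          by (rule jet_relation) (use F True max in auto)
        then have z: "(\<Sum>i\<in>J. f i * (\<Sum>x\<in>F. \<beta> x * ?D x i)) = 0"
          by (rule functional_span_zero[OF f(2)])
        have "(\<Sum>i\<in>J. f i * (\<Sum>x\<in>F. \<beta> x * ?D x i))
          = (\<Sum>x\<in>F. \<beta> x * (snd x j * (of_nat (Suc (fst x)) * (\<Sum>i\<in>J. f i * jt b q (Suc (fst x), snd x) i))))"
          by (simp add: sum_distrib_left mult_ac) (rule sum.swap)
        also have "\<dots> = (\<Sum>x\<in>F. 2 * (\<beta> x * \<psi> x j))"
        proof (rule sum.cong[OF refl])
          fix x assume "x \<in> F"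
          then consider "fst x = 0" | "fst x = 1" using F(2) by fastforce
          then show "\<beta> x * (snd x j * (of_nat (Suc (fst x)) * (\<Sum>i\<in>J. f i * jt b q (Suc (fst x), snd x) i)))
              = 2 * (\<beta> x * \<psi> x j)"
          proof cases
            case 1
            then have "(\<Sum>i\<in>J. f i * jt b q (Suc (fst x), snd x) i) = 0" using f(2) by auto
            then show ?thesis using 1 by (simp add: \<psi>_def)
          next
            case 2
            then show ?thesis using True by (simp add: \<psi>_def w_def numeral_2_eq_2)
          qed
        qed
        also have "\<dots> = 2 * (\<Sum>x\<in>F. \<beta> x * \<psi> x j)" by (simp add: sum_distrib_left)
        finally show ?thesis using z by simp
      qed (simp add: \<psi>_def)
    qed
  qed (auto simp: \<psi>_def)
  moreover have "b \<le> rk \<psi> (CL 1)"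
  proof -
    let ?P = "\<lambda>p. \<forall>i\<in>{..<b}. w (\<lambda>a. p (i, a)) \<noteq> 0"
    let ?R = "\<lambda>p j a. if a < b then p (j, a) else (0::complex)"
    let ?Q = "\<lambda>p :: nat \<times> nat \<Rightarrow> complex. indf (?R p) {..<b}"
    have gP: "gen ?P"
      by (intro gen_ball gen_nonzero rw rpoly_pline) simp
    have gQ: "gen ?Q"
    proof (rule gen_indf)
      fix x y :: "nat \<times> nat \<Rightarrow> complex" and j i
      show "rpoly (\<lambda>t. ?R (pline x y t) j i)" by (cases "i < b") (auto intro: rpoly_pline)
    qed
    have eP: "?P (\<lambda>(i, a). c1 a)" using f(3) by (simp add: w_def)
    have eQ: "?Q uq"
    proof (rule indfI)
      fix \<beta> c assume z: "\<And>i. (\<Sum>j<b. \<beta> j * ?R uq j i) = 0" and c: "c \<in> {..<b}"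
      have "(\<Sum>j<b. \<beta> j * ?R uq j c) = (\<Sum>j<b. if j = c then \<beta> j else 0)"
        using c by (intro sum.cong) (auto simp: unit_def)
      then show "\<beta> c = 0" using z[of c] c by simp
    qed simp
    have "\<exists>p. ?P p \<and> ?Q p"
      by (rule gen_ex_conj[where P = ?P and Q = ?Q and x = "\<lambda>(i, a). c1 a" and y = uq, OF gP gQ eP eQ])
    then obtain p where "?P p \<and> ?Q p" by (rule exE)
    then have p: "?P p" "?Q p" by (rule conjunct1, rule conjunct2)
    define e where "e i = (1 :: nat, \<lambda>a. p (i, a))" for i
    have "indf (\<lambda>i. \<psi> (e i)) {..<b}"
    proof (rule indfI)
      fix \<beta> i assume z: "\<And>j. (\<Sum>i<b. \<beta> i * \<psi> (e i) j) = 0" and i: "i \<in> {..<b}"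
      have "(\<Sum>i<b. (\<beta> i * w (\<lambda>a. p (i, a))) * ?R p i a) = 0" for a
        using z[of a] by (cases "a < b") (simp_all add: \<psi>_def e_def mult_ac)
      from indfD[OF p(2), of "\<lambda>i. \<beta> i * w (\<lambda>a. p (i, a))" i, OF this] show "\<beta> i = 0" using p(1) i by simp
    qed simp
    then have ie: "inj_on e {..<b}" "indf \<psi> (e ` {..<b})" by (rule indf_image(1)[of \<psi>], rule indf_image(2)[of \<psi>])
    have "card (e ` {..<b}) \<le> rk \<psi> (CL 1)" by (rule rk_ge[OF bd\<psi> _ ie(2)]) (auto simp: e_def)
    then show ?thesis using ie(1) by (simp add: card_image)
  qed
  ultimately show ?thesis by simp
qed

text \<open>The relation \<open>\<Sum> \<beta> h = 0\<close> on the span of \<open>b\<close> generic vectors passes to the normal jets with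
  an extra linear factor; when these jets already exhaust the functions in the span of \<open>h\<close> that
  vanish on a hyperplane, they also determine the \<open>A(\<cdot>, w)\<close>.\<close>

lemma factor_through:
  assumes b: "1 \<le> b" and iq: "idv b q"
    and low: "mr h (b - 1) \<le> rk (\<lambda>c. h (pt (b - 1) q c)) UNIV"
    and g: "bd g" "\<And>z i. (\<And>j. rpoly (\<lambda>t. z t j)) \<Longrightarrow> rpoly (\<lambda>t. g (z t) i)"
    and rel: "\<And>F \<beta> j i. finite F \<Longrightarrow> (\<And>\<mu>. (\<Sum>c\<in>F. \<beta> c * h (pt b q c) \<mu>) = 0) \<Longrightarrow> j < b \<Longrightarrow> (\<Sum>c\<in>F. \<beta> c * (c j * g c i)) = 0"
    and eq: "rk (\<lambda>c. h (pt b q c)) UNIV \<le> mr h (b - 1) + rk g UNIV"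
  shows "relfac (\<lambda>c. h (pt b q c)) (tfam k b q) UNIV"
  unfolding relfac_def
proof (intro allI impI)
  fix F :: "(nat \<Rightarrow> complex) set" and \<beta> and p :: "nat \<times> 'b"
  assume F: "finite F" and z: "\<forall>\<mu>. (\<Sum>c\<in>F. \<beta> c * h (pt b q c) \<mu>) = 0"
  obtain j l where p: "p = (j, l)" by fastforce
  define lam where "lam w c = ip n (pt b q c) w" for w c
  have lam_sum: "lam w c = (\<Sum>j<b. c j * ip n (\<lambda>a. q (j, a)) w)" for w c
    unfolding lam_def by (rule ip_pt)
  have lam_comb: "lam w (\<lambda>j. s * c j - t * d j) = s * lam w c - t * lam w d" for w s c t d
    unfolding lam_sum by (simp add: left_diff_distrib sum_subtractf sum_distrib_left mult.assoc)
  obtain w0 where w0: "\<And>i. i < b - 1 \<Longrightarrow> ip n (\<lambda>a. q (i, a)) w0 = 0" "ip n (\<lambda>a. q (b - 1, a)) w0 \<noteq> 0"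
    by (rule normal_vector[OF iq b]) blast
  have lu: "lam w (unit (b - 1)) = ip n (\<lambda>a. q (b - 1, a)) w" for w
    unfolding lam_def using b by (subst pt_unit) auto
  \<comment> \<open>The relation will be divided by \<open>lam w c\<close>. At points without
    nonzero coordinate this is zero for every \<open>w\<close>, but there the coefficient
    \<open>\<beta> c * c j\<close> is zero too.\<close>
  define Fn where "Fn = {c \<in> F. \<exists>i<b. c i \<noteq> 0}"
  \<comment> \<open>The hyperplane \<open>lam w = 0\<close> is parametrised by pairs of vectors,
    since a basis depending polynomially on \<open>w\<close> and its conjugate is not at
    hand.\<close>
  let ?G1 = "\<lambda>w. mr h (b - 1) \<le> rk (\<lambda>(c, c'). h (pt b q (\<lambda>j. lam w c * c' j - lam w c' * c j))) UNIV"
  let ?G2 = "\<lambda>w. \<forall>c\<in>Fn. lam w c \<noteq> 0"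
  let ?G3 = "\<lambda>w. lam w (unit (b - 1)) \<noteq> 0"
  have rlam: "rpoly (\<lambda>t. lam (pline x y t) c)" for x y c
    unfolding lam_def by (intro rpoly_ip rpoly_const rpoly_pline)
  have g1: "gen ?G1"
  proof (rule gen_rk)
    show "ubd (\<lambda>w (c, c'). h (pt b q (\<lambda>j. lam w c * c' j - lam w c' * c j)))"
      unfolding ubd_def by (intro exI[of _ "{..<N}"]) (auto simp: supp_h not_less)
    fix x y :: "nat \<Rightarrow> complex" and cc :: "(nat \<Rightarrow> complex) \<times> (nat \<Rightarrow> complex)" and \<mu>
    obtain c c' where cc: "cc = (c, c')" by fastforce
    show "rpoly (\<lambda>t. (case cc of (c, c') \<Rightarrow> h (pt b q (\<lambda>j. lam (pline x y t) c * c' j - lam (pline x y t) c' * c j))) \<mu>)"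
      unfolding cc prod.case
      by (intro rvec_rpoly[OF rvec_h] rpoly_pt rpoly_const rpoly_diff rpoly_mult rlam)
  qed
  have g2: "gen ?G2" using F by (intro gen_ball gen_nonzero rlam) (simp add: Fn_def)
  have g3: "gen ?G3" by (intro gen_nonzero rlam)
  have e1: "?G1 w0"
  proof -
    have "rk (\<lambda>c. h (pt (b - 1) q c)) UNIV
        \<le> rk (\<lambda>(c, c'). h (pt b q (\<lambda>j. lam w0 c * c' j - lam w0 c' * c j))) UNIV"
    proof (rule rk_le_image[OF _ bd_pt[OF rvec_h]])
      show "bd (\<lambda>(c, c'). h (pt b q (\<lambda>j. lam w0 c * c' j - lam w0 c' * c j)))"
        unfolding bd_def by (intro exI[of _ "{..<N}"]) (auto simp: supp_h not_less)
      fix c :: "nat \<Rightarrow> complex"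
      let ?u = "unit (b - 1)" and ?c = "\<lambda>j. if j < b - 1 then c j / lam w0 (unit (b - 1)) else 0"
      have lc: "lam w0 ?c = 0"
      proof -
        have "(\<Sum>j<b. ?c j * ip n (\<lambda>a. q (j, a)) w0) = 0" by (rule sum.neutral) (auto simp: w0)
        then show ?thesis by (simp add: lam_sum)
      qed
      have nz: "lam w0 ?u \<noteq> 0" using w0(2) unfolding lu .
      have "lam w0 ?u * ?c j - lam w0 ?c * ?u j = (if j < b - 1 then c j else 0)" for j
        unfolding lc using nz by (cases "j < b - 1") (simp_all del: One_nat_def)
      then have "pt b q (\<lambda>j. lam w0 ?u * ?c j - lam w0 ?c * ?u j) = pt b q (\<lambda>j. if j < b - 1 then c j else 0)"
        by (simp only:)
      also have "\<dots> = pt (b - 1) q (\<lambda>j. if j < b - 1 then c j else 0)" by (intro pt_restrict) auto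
      also have "\<dots> = pt (b - 1) q c" by (intro pt_cong) auto
      finally show "\<exists>x\<in>UNIV. h (pt (b - 1) q c) = (case x of (c, c') \<Rightarrow> h (pt b q (\<lambda>j. lam w0 c * c' j - lam w0 c' * c j)))"
        by (intro bexI[of _ "(?u, ?c)"]) auto
    qed
    then show ?thesis using low by simp
  qed
  have e2: "\<exists>w. ?G2 w"
  proof (rule gen_ball_ex)
    show "finite Fn" using F by (simp add: Fn_def)
    show "gen (\<lambda>w. lam w c \<noteq> 0)" for c by (intro gen_nonzero rlam)
    show "\<exists>w. lam w c \<noteq> 0" if "c \<in> Fn" for c
      using that pt_nonzero[OF iq] unfolding Fn_def lam_def by blast
  qed
  have e3: "?G3 w0" using w0(2) unfolding lu .
  let ?G23 = "\<lambda>w. ?G2 w \<and> ?G3 w"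
  have g23: "gen ?G23" by (rule gen_conj[OF g2 g3])
  have e23: "\<exists>w. ?G23 w"
  proof -
    obtain w2 where w2: "?G2 w2" using e2 by (rule exE)
    show ?thesis by (rule gen_ex_conj[where P = ?G2 and Q = ?G3 and x = w2 and y = w0, OF g2 g3 w2 e3])
  qed
  let ?G = "\<lambda>w. ?G1 w \<and> ?G23 w"
  have gG: "gen ?G" by (rule gen_conj[OF g1 g23])
  have "\<exists>w. ?G w"
  proof -
    obtain w2 where w2: "?G23 w2" using e23 by (rule exE)
    show ?thesis by (rule gen_ex_conj[where P = ?G1 and Q = ?G23 and x = w0 and y = w2, OF g1 g23 e1 w2])
  qed
  then obtain w1 where w1: "?G w1" by (rule exE)
  define \<gamma> where "\<gamma> c = \<beta> c * c j" for c
  have good: "(\<Sum>c\<in>F. \<gamma> c * A (pt b q c) w) = 0" if G: "?G w" and jb: "j < b" for w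
  proof -
    \<comment> \<open>Both families factor through \<open>h\<close> and vanish on the hyperplane
      \<open>lam w = 0\<close>. That hyperplane and \<open>?\<psi>\<close> already account for the
      whole rank of \<open>h\<close>, so adjoining \<open>?\<xi>\<close> cannot raise the rank of
      \<open>?\<psi>\<close>.\<close>
    let ?\<psi> = "\<lambda>c i. lam w c * g c i" and ?\<xi> = "\<lambda>c. lam w c * A (pt b q c) w"
    let ?C = "{c. lam w c = 0}"
    have bd\<psi>: "bd ?\<psi>" by (rule bd_scale[OF g(1)])
    have rel\<psi>: "(\<Sum>c\<in>F. \<beta> c * (lam w c * g c i)) = 0"
      if "finite F" "\<And>\<mu>. (\<Sum>c\<in>F. \<beta> c * h (pt b q c) \<mu>) = 0" for F \<beta> i
    proof -
      have "(\<Sum>c\<in>F. \<beta> c * (lam w c * g c i)) = (\<Sum>c\<in>F. \<Sum>j<b. ip n (\<lambda>a. q (j, a)) w * (\<beta> c * (c j * g c i)))"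
        unfolding lam_sum by (simp add: sum_distrib_left sum_distrib_right mult_ac)
      also have "\<dots> = (\<Sum>j<b. ip n (\<lambda>a. q (j, a)) w * (\<Sum>c\<in>F. \<beta> c * (c j * g c i)))"
        by (subst sum.swap) (simp add: sum_distrib_left)
      also have "\<dots> = 0" using rel[OF that] by simp
      finally show ?thesis .
    qed
    have rel\<xi>: "(\<Sum>c\<in>F. \<beta> c * (lam w c * A (pt b q c) w)) = 0"
      if "finite F" "\<And>\<mu>. (\<Sum>c\<in>F. \<beta> c * h (pt b q c) \<mu>) = 0" for F \<beta>
    proof -
      have "(\<Sum>c\<in>F. \<beta> c * (lam w c * A (pt b q c) w)) = (\<Sum>c\<in>F. \<Sum>\<mu><N. \<beta> c * (h (pt b q c) \<mu> * cnj (h w \<mu>)))"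
        unfolding lam_def h_A[symmetric] by (simp add: sum_distrib_left)
      also have "\<dots> = (\<Sum>\<mu><N. (\<Sum>c\<in>F. \<beta> c * h (pt b q c) \<mu>) * cnj (h w \<mu>))"
        by (subst sum.swap) (simp add: sum_distrib_right mult.assoc)
      finally show ?thesis using that(2) by simp
    qed
    have "rk (\<lambda>c. h (pt b q c)) ?C + rk (adj ?\<psi> ?\<xi>) UNIV \<le> rk (\<lambda>c. h (pt b q c)) UNIV"
    proof (rule rk_add[OF bd_pt[OF rvec_h] bd_adj[OF bd\<psi>]])
      show "relfac (\<lambda>c. h (pt b q c)) (adj ?\<psi> ?\<xi>) UNIV"
        unfolding relfac_def
      proof (intro allI impI)
        fix F :: "(nat \<Rightarrow> complex) set" and \<beta> and oi
        assume F: "finite F" and z: "\<forall>\<mu>. (\<Sum>c\<in>F. \<beta> c * h (pt b q c) \<mu>) = 0"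
        show "(\<Sum>c\<in>F. \<beta> c * adj ?\<psi> ?\<xi> c oi) = 0"
        proof (cases oi)
          case None
          then show ?thesis using rel\<xi>[OF F, of \<beta>] z by (simp add: adj_def)
        next
          case (Some i)
          then show ?thesis using rel\<psi>[OF F, of \<beta>] z by (simp add: adj_def)
        qed
      qed
    qed (auto simp: adj_def split: option.splits)
    moreover have "mr h (b - 1) \<le> rk (\<lambda>c. h (pt b q c)) ?C"
    proof -
      have "rk (\<lambda>(c, c'). h (pt b q (\<lambda>j. lam w c * c' j - lam w c' * c j))) UNIV \<le> rk (\<lambda>c. h (pt b q c)) ?C"
      proof (rule rk_le_image[OF bd_pt[OF rvec_h]])
        show "bd (\<lambda>(c, c'). h (pt b q (\<lambda>j. lam w c * c' j - lam w c' * c j)))"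
          unfolding bd_def by (intro exI[of _ "{..<N}"]) (auto simp: supp_h not_less)
        fix cc :: "(nat \<Rightarrow> complex) \<times> (nat \<Rightarrow> complex)"
        obtain c c' where cc: "cc = (c, c')" by fastforce
        show "\<exists>d\<in>?C. (case cc of (c, c') \<Rightarrow> h (pt b q (\<lambda>j. lam w c * c' j - lam w c' * c j))) = h (pt b q d)"
          unfolding cc prod.case
          by (rule bexI[of _ "\<lambda>j. lam w c * c' j - lam w c' * c j"]) (auto simp: lam_comb)
      qed
      then show ?thesis using G by linarith
    qed
    moreover have "rk g UNIV \<le> rk ?\<psi> UNIV"
    proof (rule rk_le_span[OF bd\<psi> g(1)])
      fix c :: "nat \<Rightarrow> complex"
      let ?z = "\<lambda>t::real. \<lambda>j. c j + of_real t * unit (b - 1) j"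
      have r: "rpoly (\<lambda>t. ?z t j)" for j by (intro rpoly_add rpoly_mult rpoly_const rpoly_id)
      have lz: "lam w (?z t) = lam w c + of_real t * lam w (unit (b - 1))" for t
        unfolding lam_sum by (simp add: distrib_right sum.distrib sum_distrib_left mult.assoc)
      have rl: "rpoly (\<lambda>t. lam w (?z t))" unfolding lz by (intro rpoly_add rpoly_mult rpoly_const rpoly_id)
      have "lam w (?z 0) \<noteq> 0 \<or> lam w (?z 1) \<noteq> 0" unfolding lz using G by auto
      then have "finite {t. lam w (?z t) = 0}"
        using rpoly_finite[where f = "\<lambda>t. lam w (?z t)", OF rl] by blast
      then have "g (?z 0) \<in> fv.span ((\<lambda>c i. lam w c * g c i) ` UNIV)"
        by (intro scale_span[where l = "lam w" and z = ?z and \<phi> = g] g r)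
      then show "g c \<in> fv.span (?\<psi> ` UNIV)" by simp
    qed
    ultimately have le: "rk (adj ?\<psi> ?\<xi>) UNIV \<le> rk ?\<psi> UNIV" using eq by linarith
    have finFn: "finite Fn" using F by (simp add: Fn_def)
    have off: "\<gamma> c = 0" if "c \<in> F - Fn" for c using that jb by (auto simp: Fn_def \<gamma>_def)
    have sumFn: "(\<Sum>c\<in>Fn. \<gamma> c * a c) = (\<Sum>c\<in>F. \<gamma> c * a c)" for a
      using off F by (intro sum.mono_neutral_left) (auto simp: Fn_def)
    have sc: "(\<Sum>c\<in>Fn. (\<gamma> c / lam w c) * (lam w c * a c)) = (\<Sum>c\<in>F. \<gamma> c * a c)" for a
    proof -
      have "(\<Sum>c\<in>Fn. (\<gamma> c / lam w c) * (lam w c * a c)) = (\<Sum>c\<in>Fn. \<gamma> c * a c)"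
        using G by (intro sum.cong refl) simp
      then show ?thesis using sumFn by simp
    qed
    have "(\<Sum>c\<in>Fn. (\<gamma> c / lam w c) * ?\<xi> c) = 0"
    proof (rule rk_adj_relation[OF bd\<psi> le finFn subset_UNIV])
      fix i
      have "(\<Sum>c\<in>F. \<gamma> c * g c i) = 0"
        using rel[OF F _ jb, of \<beta> i] z by (simp add: \<gamma>_def mult.assoc)
      then show "(\<Sum>c\<in>Fn. (\<gamma> c / lam w c) * (lam w c * g c i)) = 0" unfolding sc .
    qed
    then show ?thesis unfolding sc .
  qed
  have "(\<Sum>c\<in>F. \<gamma> c * k (pt b q c) l) = 0" if jb: "j < b"
  proof (rule sum_k_zero)
    fix w
    \<comment> \<open>\<open>good\<close> covers generic \<open>w\<close> only, whereas
      \<open>sum_k_zero\<close> needs every \<open>w\<close>; polynomiality along lines closes the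
      gap.\<close>
    have "finite {t. \<not> ?G (pline w1 w t)}" using gG w1 unfolding gen_def by blast
    then have "finite {t. (\<Sum>c\<in>F. \<gamma> c * A (pt b q c) (pline w1 w t)) \<noteq> 0}"
      by (rule rev_finite_subset) (use good[OF _ jb] in blast)
    moreover have "rpoly (\<lambda>t. \<Sum>c\<in>F. \<gamma> c * A (pt b q c) (pline w1 w t))"
      by (intro rpoly_sum rpoly_mult rpoly_const rpoly_A rpoly_pline)
    ultimately have "(\<Sum>c\<in>F. \<gamma> c * A (pt b q c) (pline w1 w 1)) = 0" by (intro rpoly_zero)
    then show "(\<Sum>c\<in>F. \<gamma> c * A (pt b q c) w) = 0" by simp
  qed
  then show "(\<Sum>c\<in>F. \<beta> c * tfam k b q c p) = 0"
    by (cases "j < b") (simp_all add: tfam_def p \<gamma>_def mult.assoc)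
qed

text \<open>\<open>g\<close> is the first normal jet modulo the values. Multiplied by
  \<open>c (b - 1)\<close> it factors through \<open>h\<close> and vanishes on a hyperplane, so
  \<open>mr h (b - 1) + rk g UNIV \<le> mr h b\<close>. Equality is the situation of
  \<open>factor_through\<close>; strictness together with the bound for \<open>rk g UNIV\<close>
  from \<open>normal_jet_rank\<close> is the other alternative.\<close>

lemma growth_dichotomy:
  assumes b: "1 \<le> b" "b < n"
  shows "(\<forall>i\<le>b. (\<Sum>i'=1..i. mr k i') \<le> mr h i) \<or>
    mr h (b - 1) + min (mr h (b + 1) - mr h b) b + 1 \<le> mr h b"
proof -
  obtain K where K: "\<And>\<mu> z e. degree (jpoly (\<lambda>y. h y \<mu>) z e) \<le> K" using degree_bound by blast
  let ?c1 = "\<lambda>q. \<forall>l\<in>{..K + 2}. maxrk (jt b) (CL l) \<le> rk (jt b q) (CL l)"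
  let ?c2 = "\<lambda>q. \<forall>i\<in>{b - 1, b, b + 1}. mr h i \<le> rk (\<lambda>c. h (pt i q c)) UNIV"
  let ?c3 = "\<lambda>q. \<forall>i\<in>{1..b}. mr k i \<le> rk (\<lambda>c. k (pt i q c)) UNIV"
  have gj: "gen (\<lambda>q. r \<le> rk (jt b q) (CL l))" for r l
  proof (rule gen_rk[OF ubd_jt])
    fix x y c i assume "c \<in> CL l"
    show "rpoly (\<lambda>t. jt b (pline x y t) c i)"
      using rpoly_jt[of "\<lambda>t. pline x y t" "\<lambda>t. snd c" b "fst c" i] by (simp add: rpoly_pline)
  qed
  have g1: "gen ?c1" by (intro gen_ball gj) simp
  have g2: "gen ?c2" by (intro gen_ball gen_mr[OF rvec_h]) simp
  have g3: "gen ?c3" by (intro gen_ball gen_mr[OF rvec_k]) simp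
  have "\<exists>q. ?c1 q"
  proof (rule gen_ball_ex)
    show "\<exists>q. maxrk (jt b) (CL l) \<le> rk (jt b q) (CL l)" for l
      using maxrk_attained[OF ubd_jt, of b "CL l"] by (metis order_refl)
  qed (auto intro: gj)
  then obtain q1 where q1: "?c1 q1" by (rule exE)
  have "\<exists>q. ?c2 q" by (rule gen_ball_ex) (auto intro: gen_mr[OF rvec_h] mr_ex[OF rvec_h])
  then obtain q2 where q2: "?c2 q2" by (rule exE)
  have "\<exists>q. ?c3 q" by (rule gen_ball_ex) (auto intro: gen_mr[OF rvec_k] mr_ex[OF rvec_k])
  then obtain q3 where q3: "?c3 q3" by (rule exE)
  have "\<exists>q. ?c1 q \<and> ?c2 q"
    by (rule gen_ex_conj[where P = ?c1 and Q = ?c2 and x = q1 and y = q2, OF g1 g2 q1 q2])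
  then obtain q4 where q4: "?c1 q4 \<and> ?c2 q4" by (rule exE)
  have "\<exists>q. ?c3 q \<and> idv b q"
    by (rule gen_ex_conj[where P = ?c3 and Q = "idv b" and x = q3 and y = uq, OF g3 gen_idv q3 idv_uq])
       (use b in simp)
  then obtain q5 where q5: "?c3 q5 \<and> idv b q5" by (rule exE)
  have "\<exists>q. (?c1 q \<and> ?c2 q) \<and> (?c3 q \<and> idv b q)"
    by (rule gen_ex_conj[where P = "\<lambda>q. ?c1 q \<and> ?c2 q" and Q = "\<lambda>q. ?c3 q \<and> idv b q" and x = q4 and y = q5,
          OF gen_conj[OF g1 g2] gen_conj[OF g3 gen_idv] q4 q5])
  then obtain q where q: "(?c1 q \<and> ?c2 q) \<and> (?c3 q \<and> idv b q)" by (rule exE)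
  have max: "rk (jt b q') (CL l) \<le> rk (jt b q) (CL l)" if "l \<le> K + 2" for l q'
    using maxrk_ge[OF ubd_jt, of b q' "CL l"] q that by (meson atMost_iff le_trans)
  have c2: "mr h (b - 1) \<le> rk (\<lambda>c. h (pt (b - 1) q c)) UNIV" "mr h b \<le> rk (\<lambda>c. h (pt b q c)) UNIV"
    "mr h (b + 1) \<le> rk (\<lambda>c. h (pt (b + 1) q c)) UNIV" using q by auto
  have c3: "?c3 q" and iq: "idv b q" using q by blast+
  have H: "rk (\<lambda>c. h (pt b q c)) UNIV = mr h b" using c2(2) mr_ge[OF rvec_h, of b q] by simp
  have r0: "rk (jt b q) (CL 0) = mr h b"
  proof (rule antisym)
    have "rk (jt b q) (CL 0) \<le> rk (\<lambda>c. h (pt b q c)) UNIV"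
      by (rule rk_le_image[OF bd_pt[OF rvec_h] bd_jt]) (auto simp: jt_0)
    then show "rk (jt b q) (CL 0) \<le> mr h b" using H by simp
    have "rk (\<lambda>c. h (pt b q c)) UNIV \<le> rk (jt b q) (CL 0)"
      by (rule rk_le_image[OF bd_jt bd_pt[OF rvec_h]]) (auto simp: jt_0[symmetric])
    then show "mr h b \<le> rk (jt b q) (CL 0)" using H by simp
  qed
  have sub: "CL 0 \<subseteq> CL 1" by auto
  obtain D J f where f: "finite D \<and> finite J \<and> (\<forall>b i. b \<notin> D \<longrightarrow> f b i = 0) \<and>
    (\<forall>x\<in>CL 0. \<forall>d. (\<Sum>i\<in>J. f d i * jt b q x i) = 0) \<and>
    rk (jt b q) (CL 1) \<le> rk (jt b q) (CL 0) + rk (\<lambda>x (d :: nat \<times> (nat \<Rightarrow> complex)). \<Sum>i\<in>J. f d i * jt b q x i) (CL 1)"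
    using quotient_functionals[OF bd_jt[of b q] sub] by (elim exE)
  define g where "g c d = (\<Sum>i\<in>J. f d i * jt b q (1, c) i)" for c d
  have bdg: "bd g" unfolding bd_def g_def using f by (intro exI[of _ D]) auto
  have rg: "rpoly (\<lambda>t. g (z t) i)" if "\<And>j. rpoly (\<lambda>t. z t j)" for z i
    unfolding g_def by (intro rpoly_sum rpoly_mult rpoly_const rpoly_jt that)
  let ?\<Psi> = "\<lambda>x d. \<Sum>i\<in>J. f d i * jt b q x i"
  have "rk ?\<Psi> (CL 1) \<le> rk g UNIV"
  proof (rule rk_le_span[OF bdg])
    show "bd ?\<Psi>" unfolding bd_def using f by (intro exI[of _ D]) auto
    fix x :: "nat \<times> (nat \<Rightarrow> complex)" assume "x \<in> CL 1"
    then consider "x \<in> CL 0" | "x = (1, snd x)" by (cases x) fastforce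
    then show "?\<Psi> x \<in> fv.span (g ` UNIV)"
    proof cases
      case 1
      have "\<forall>x\<in>CL 0. \<forall>d. (\<Sum>i\<in>J. f d i * jt b q x i) = 0" using f by (elim conjE)
      from bspec[OF this 1] have "?\<Psi> x = 0" unfolding fun_eq_iff zero_fun_apply .
      then show ?thesis by (simp add: fv.span_zero)
    next
      case 2
      have "?\<Psi> (1, snd x) = g (snd x)" by (simp add: g_def fun_eq_iff)
      then show ?thesis using 2 by (metis span_fam_base UNIV_I)
    qed
  qed
  then have d1: "rk (jt b q) (CL 1) \<le> mr h b + rk g UNIV" using f r0 by linarith
  have "mr h (b + 1) \<le> rk (jt b q) (CL 1) \<or> rk (jt b q) (CL 0) + b \<le> rk (jt b q) (CL 1)"
    by (rule normal_jet_rank[where K = K, OF max b(1) K c2(3)])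
  then have dl: "min (mr h (b + 1) - mr h b) b \<le> rk g UNIV" using d1 r0 by auto
  have rel: "(\<Sum>c\<in>F. \<beta> c * (c j * g c i)) = 0"
    if F: "finite F" "\<And>\<mu>. (\<Sum>c\<in>F. \<beta> c * h (pt b q c) \<mu>) = 0" "j < b" for F \<beta> j i
  proof -
    let ?D = "\<lambda>x \<mu>. snd x j * (of_nat (Suc (fst x)) * jt b q (Suc (fst x), snd x) \<mu>)"
    let ?F = "Pair (0::nat) ` F"
    have inj: "inj_on (Pair (0::nat)) F" by (auto simp: inj_on_def)
    have "(\<lambda>\<mu>. \<Sum>x\<in>?F. \<beta> (snd x) * ?D x \<mu>) \<in> fv.span (jt b q ` CL 0)"
    proof (rule jet_relation)
      show "(\<Sum>x\<in>?F. \<beta> (snd x) * jt b q x \<mu>) = 0" for \<mu>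
        using F(2)[of \<mu>] inj by (simp add: sum.reindex jt_0)
      show "rk (jt b q') (CL 0) \<le> rk (jt b q) (CL 0)" for q' by (rule max) simp
    qed (use F in auto)
    then have "(\<Sum>i'\<in>J. f i i' * (\<Sum>x\<in>?F. \<beta> (snd x) * ?D x i')) = 0"
      by (rule functional_span_zero[rotated]) (use f in blast)
    also have "(\<Sum>i'\<in>J. f i i' * (\<Sum>x\<in>?F. \<beta> (snd x) * ?D x i')) = (\<Sum>c\<in>F. \<beta> c * (c j * g c i))"
      unfolding g_def using inj
      by (simp add: sum.reindex sum_distrib_left mult_ac) (rule sum.swap)
    finally show ?thesis .
  qed
  let ?\<psi> = "\<lambda>c i. c (b - 1) * g c i"
  have bd\<psi>: "bd ?\<psi>" by (rule bd_scale[OF bdg])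
  have "rk (\<lambda>c. h (pt b q c)) {c. \<forall>j\<ge>b - 1. c j = 0} + rk ?\<psi> UNIV \<le> rk (\<lambda>c. h (pt b q c)) UNIV"
  proof (rule rk_add[OF bd_pt[OF rvec_h] bd\<psi>])
    show "relfac (\<lambda>c. h (pt b q c)) ?\<psi> UNIV" unfolding relfac_def using rel b(1) by auto
  qed auto
  moreover have "rk (\<lambda>c. h (pt (b - 1) q c)) UNIV \<le> rk (\<lambda>c. h (pt b q c)) {c. \<forall>j\<ge>b - 1. c j = 0}"
    by (rule rk_pt_mono[OF rvec_h]) simp
  moreover have "rk g UNIV \<le> rk ?\<psi> UNIV"
  proof (rule rk_le_span[OF bd\<psi> bdg])
    fix c :: "nat \<Rightarrow> complex"
    let ?z = "\<lambda>t::real. \<lambda>j. c j + of_real t * unit (b - 1) j"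
    have r: "rpoly (\<lambda>t. ?z t j)" for j by (intro rpoly_add rpoly_mult rpoly_const rpoly_id)
    have "?z (1 + \<bar>Re (c (b - 1))\<bar>) (b - 1) \<noteq> 0" by (auto simp: unit_def complex_eq_iff)
    then have "finite {t. ?z t (b - 1) = 0}" using rpoly_finite[where f = "\<lambda>t. ?z t (b - 1)", OF r] by blast
    then have "g (?z 0) \<in> fv.span ((\<lambda>c i. c (b - 1) * g c i) ` UNIV)"
      by (intro scale_span[where l = "\<lambda>c. c (b - 1)" and z = ?z and \<phi> = g] bdg rg r)
    then show "g c \<in> fv.span (?\<psi> ` UNIV)" by simp
  qed
  ultimately have low: "mr h (b - 1) + rk g UNIV \<le> mr h b" using c2(1) H by linarith
  show ?thesis
  proof (cases "mr h (b - 1) + rk g UNIV = mr h b")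
    case False
    then show ?thesis using low dl by linarith
  next
    case True
    have rf: "relfac (\<lambda>c. h (pt b q c)) (tfam k b q) UNIV"
      by (rule factor_through[where g = g, OF b(1) iq c2(1) bdg rg rel]) (use True H in auto)
    have "(\<Sum>i'=1..i. mr k i') \<le> mr h i" if "i \<le> b" for i
    proof -
      have "(\<Sum>i'=1..i. mr k i') \<le> (\<Sum>i'=1..i. rk (\<lambda>c. k (pt i' q c)) UNIV)"
        using c3 that by (intro sum_mono) auto
      also have "\<dots> \<le> mr h i" by (rule tensor_mr[OF rf that])
      finally show ?thesis .
    qed
    then show ?thesis by blast
  qed
qed

end

section \<open>Counting\<close>

lemma choose_two_pred: "1 \<le> d \<Longrightarrow> d choose 2 = ((d - 1) choose 2) + (d - 1)"
  by (cases d) (simp_all add: numeral_2_eq_2)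

text \<open>Subtraction is truncated: the last term is zero unless \<open>a > n + 1\<close>.\<close>

lemma sum_min:
  "(\<Sum>i=1..n. min i a) + (a choose 2) = n * a + ((a - n) choose 2)"
proof (induction n)
  case (Suc n)
  have "min (Suc n) a + ((a - n) choose 2) = a + ((a - Suc n) choose 2)"
    by (cases "n < a") (use choose_two_pred[of "a - n"] in auto)
  then show ?case using Suc by simp
qed simp

text \<open>A lower bound for the rank of \<open>z \<otimes> k z\<close> on \<open>i\<close> generic vectors when \<open>A\<close> is not positive
  semidefinite.\<close>

definition fcnt :: "nat \<Rightarrow> nat \<Rightarrow> nat" where
  "fcnt \<kappa> i = (\<Sum>j=1..i. if j = 1 then 1 else min (j + 1) (\<kappa> + 1))"

lemma fcnt_Suc: "1 \<le> i \<Longrightarrow> fcnt \<kappa> (Suc i) = fcnt \<kappa> i + min (i + 2) (\<kappa> + 1)"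
  by (simp add: fcnt_def)

lemma fcnt_1: "fcnt \<kappa> 1 = 1"
  by (simp add: fcnt_def)

lemma fcnt_eq:
  assumes "1 \<le> \<kappa>" "1 \<le> i"
  shows "fcnt \<kappa> i + (\<kappa> choose 2) + 1 = i * (\<kappa> + 1) + ((\<kappa> - i) choose 2)"
  using assms(2)
proof (induction i rule: dec_induct)
  case base
  then show ?case using choose_two_pred[OF assms(1)] assms(1) by (simp add: fcnt_1 del: One_nat_def)
next
  case (step i)
  have "min (i + 2) (\<kappa> + 1) + ((\<kappa> - i) choose 2) = \<kappa> + 1 + ((\<kappa> - Suc i) choose 2)"
    by (cases "i < \<kappa>") (use choose_two_pred[of "\<kappa> - i"] in auto)
  then show ?case using step fcnt_Suc[of i \<kappa>] by simp
qed

lemma fcnt_small: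
  assumes "1 \<le> i" "i \<le> \<kappa>"
  shows "2 * fcnt \<kappa> i + 4 = (i + 1) * (i + 2)"
  using assms
proof (induction i rule: dec_induct)
  case base
  then show ?case by (simp add: fcnt_1 del: One_nat_def)
next
  case (step i)
  have "fcnt \<kappa> (Suc i) = fcnt \<kappa> i + (i + 2)" using step fcnt_Suc[of i \<kappa>] by simp
  then show ?case using step by (simp add: algebra_simps)
qed

text \<open>If the first alternative of \<open>dich\<close> fails for all \<open>b\<close> in the upper half, the increments of \<open>R\<close>
  grow from \<open>n\<close> downwards, so the one at the middle is so large that \<open>growth\<close> applies to it. For odd
  \<open>n\<close> it may be too small by one; then the increments are known exactly enough to contradict \<open>sup\<close>,
  except for \<open>n = 3\<close>.\<close>

lemma growth_count:
  assumes n: "2 \<le> n" "\<kappa> choose 2 < n" "1 \<le> \<kappa>" and R1: "1 \<le> R (1 :: nat)"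
    and sup: "\<And>b. b \<le> n \<Longrightarrow> R b + R (n - b) \<le> R n"
    and growth: "\<And>k m. 2 \<le> k \<Longrightarrow> k \<le> m \<Longrightarrow> R (m - 1) + m + 1 \<le> R m \<Longrightarrow> R (k - 1) + k + 1 \<le> R k"
    and dich: "\<And>b. 1 \<le> b \<Longrightarrow> b < n \<Longrightarrow> (\<forall>i\<le>b. fcnt \<kappa> i \<le> R i) \<or> R (b - 1) + min (R (b + 1) - R b) b + 1 \<le> R b"
  shows "n * \<kappa> \<le> R n + (\<kappa> choose 2) + 1"
proof -
  define h0 where "h0 = n div 2"
  define m where "m = n - h0"
  have hm: "1 \<le> h0" "h0 \<le> m" "m < n" "h0 + m = n" "m \<le> h0 + 1" using n(1) by (auto simp: h0_def m_def)
  have grow: "fcnt \<kappa> i \<le> R i" if "R (j - 1) + j + 1 \<le> R j \<or> j = 1" "1 \<le> i" "i \<le> j" for i j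
    using that(2,3)
  proof (induction i rule: dec_induct)
    case base
    then show ?case using R1 by (simp only: fcnt_1)
  next
    case (step i)
    have "R i + Suc i + 1 \<le> R (Suc i)" using growth[of "Suc i" j] that(1) step by auto
    then show ?case using step fcnt_Suc[of i \<kappa>] by simp
  qed
  \<comment> \<open>The two bounds add up to at least
    \<open>n * (\<kappa> + 1) - 2 * ((\<kappa> choose 2) + 1)\<close>, and the spare summand
    \<open>n\<close> pays for one of the two copies of
    \<open>(\<kappa> choose 2) + 1\<close>.\<close>
  have fin: ?thesis if "fcnt \<kappa> h0 \<le> R h0" "fcnt \<kappa> m \<le> R m"
  proof -
    have "R m + R h0 \<le> R n" using sup[of m] hm by (simp add: m_def h0_def)
    moreover have "n * (\<kappa> + 1) \<le> (fcnt \<kappa> h0 + (\<kappa> choose 2) + 1) + (fcnt \<kappa> m + (\<kappa> choose 2) + 1)"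
    proof -
      have "n * (\<kappa> + 1) = h0 * (\<kappa> + 1) + m * (\<kappa> + 1)" using hm(4) by (metis distrib_right)
      moreover have "1 \<le> m" using hm by linarith
      ultimately show ?thesis using fcnt_eq[OF n(3), of h0] fcnt_eq[OF n(3), of m] hm(1) by linarith
    qed
    ultimately show ?thesis using that n by simp
  qed
  show ?thesis
  proof (cases "\<exists>b. m \<le> b \<and> b < n \<and> (\<forall>i\<le>b. fcnt \<kappa> i \<le> R i)")
    case True
    then show ?thesis using fin hm by (meson le_trans)
  next
    case False
    then have d2: "R (b - 1) + min (R (b + 1) - R b) b + 1 \<le> R b" if "m \<le> b" "b < n" for b
      using dich[of b] that hm by auto
    \<comment> \<open>Downward induction starting from \<open>R 1\<close>. In the upper half
      \<open>n - i \<le> i\<close>, so the minimum in \<open>d2\<close> does not cut the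
      increment.\<close>
    have top: "R (i - 1) + (n - i + 1) \<le> R i" if "m \<le> i" "i \<le> n" for i
      using that(2,1)
    proof (induction i rule: inc_induct)
      case base
      then show ?case using sup[of "n - 1"] R1 n(1) by simp
    next
      case (step i)
      have "R i + (n - i) \<le> R (Suc i)" using step by auto
      moreover have "n - i \<le> i" using step hm by linarith
      ultimately have "n - i \<le> min (R (i + 1) - R i) i" by simp
      then show ?case using d2[of i] step by linarith
    qed
    show ?thesis
    proof (cases "R (m - 1) + m + 1 \<le> R m")
      case True
      then show ?thesis using grow[of m h0] grow[of m m] hm fin by linarith
    next
      case F: False
      have tm: "R (m - 1) + (n - m + 1) \<le> R m" using top[of m] hm by simp
      \<comment> \<open>The increment at \<open>m\<close> is at least \<open>n - m + 1\<close> and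
        at most \<open>m\<close>; hence \<open>n\<close> is odd and the increment is exactly
        \<open>m\<close>.\<close>
      then have h0: "m = h0 + 1" "n = 2 * m - 1" using F hm by linarith+
      have Rm: "R m = R h0 + m" using tm F h0 hm by simp
      \<comment> \<open>The increment at \<open>h0 + 1\<close> is larger than \<open>h0\<close>, so
        the second alternative at \<open>h0\<close> gives an increment of at least
        \<open>h0 + 1\<close> there, which is what \<open>grow\<close> needs.\<close>
      have fh: "fcnt \<kappa> h0 \<le> R h0"
        using dich[of h0] grow[of h0 h0] hm Rm h0 by auto
      show ?thesis
      proof (cases "\<kappa> + 1 \<le> m")
        case True
        have "fcnt \<kappa> m \<le> R m" using fcnt_Suc[of h0 \<kappa>] h0 hm True fh Rm by simp
        then show ?thesis using fin fh by simp
      next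
        case kap: False
        \<comment> \<open>From the exact value at \<open>m\<close> the increments must fall by at
          least one each time: the minimum in \<open>d2\<close> lies below \<open>m + t\<close>,
          hence is the next increment.\<close>
        have up: "R (m + t) \<le> R (m + t - 1) + (m - t)" if "t < m" for t
          using that
        proof (induction t)
          case 0
          then show ?case using Rm h0 by simp
        next
          case (Suc t)
          have "min (R (m + t + 1) - R (m + t)) (m + t) + 1 \<le> m - t"
            using d2[of "m + t"] Suc h0 by simp
          then show ?case using Suc h0 by (auto simp: min_def split: if_splits)
        qed
        have "2 * R (m + t) + t * t \<le> 2 * R m + t * (2 * m - 1)" if "t < m" for t
          using that
        proof (induction t)
          case (Suc t)
          have s: "R (m + Suc t) \<le> R (m + t) + (m - Suc t)" using up[of "Suc t"] Suc by simp
          obtain e where e: "m = Suc t + e" using Suc.prems by (metis less_imp_add_positive)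
          show ?case using s Suc unfolding e by (simp add: algebra_simps)
        qed simp
        \<comment> \<open>So \<open>R n - R m\<close> is at most \<open>h0 * (h0 + 1) / 2\<close>,
          and by \<open>sup\<close> so is \<open>R h0\<close>. On the other hand \<open>R h0\<close>
          is at least \<open>(h0^2 + 3 * h0 - 2) / 2\<close>.\<close>
        from this[of h0] have "2 * R n + h0 * h0 \<le> 2 * R m + h0 * (2 * h0 + 1)" using h0 hm by (simp add: add.commute)
        moreover have "R m + R h0 \<le> R n" using sup[of m] hm by (simp add: m_def h0_def)
        ultimately have "2 * R h0 + h0 * h0 \<le> h0 * (2 * h0 + 1)" by linarith
        moreover have "2 * fcnt \<kappa> h0 + 4 = (h0 + 1) * (h0 + 2)" using fcnt_small[of h0 \<kappa>] hm h0 kap by simp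
        ultimately have "h0 \<le> 1" using fh by (simp add: algebra_simps)
        then have v: "h0 = 1" "m = 2" "n = 3" using hm h0 by auto
        have "\<kappa> \<le> 2"
        proof (rule ccontr)
          assume "\<not> \<kappa> \<le> 2"
          then have "3 choose 2 \<le> \<kappa> choose 2" by (intro binomial_right_mono) simp
          then show False using n(2) v by (simp add: numeral_3_eq_3 numeral_2_eq_2)
        qed
        then have "\<kappa> = 2" using kap v by simp
        then show ?thesis using \<open>R m + R h0 \<le> R n\<close> Rm R1 v by simp
      qed
    qed
  qed
qed

section \<open>The rank bounds with and without \<open>psd\<close>\<close>

context orth_map
begin

lemma rank_k_large:
  assumes "\<not> psd" "\<kappa> choose 2 < n"
  shows "\<kappa> + 1 \<le> rk k UNIV"
proof (rule ccontr)
  let ?a = "rk k UNIV"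
  assume "\<not> \<kappa> + 1 \<le> ?a"
  then have "?a choose 2 \<le> \<kappa> choose 2" by (intro binomial_right_mono) simp
  moreover have "(\<Sum>i=1..n. min i ?a) \<le> (\<Sum>i=1..n. mr k i)" by (intro sum_mono mr_ge_min[OF rvec_k])
  ultimately have "n * ?a < rk T UNIV + n" using T_rank_lower sum_min[of ?a n] assms(2) by linarith
  then show False using psd_of_large_T assms(1) by simp
qed

text \<open>If \<open>h\<close> were zero, <x, w> A(x, w) would vanish identically. Along a suitable
  line the first factor has finitely many zeros, so \<open>A\<close> would be zero, which is
  \<open>psd\<close>.\<close>

lemma h_nonzero:
  assumes "\<not> psd"
  shows "1 \<le> mr h 1"
proof (rule ccontr)
  assume "\<not> 1 \<le> mr h 1"
  then have r0: "rk h UNIV = 0" using mr_ge_min[OF rvec_h, of 1] by simp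
  have hz: "h x \<mu> = 0" for x \<mu>
  proof (rule ccontr)
    assume nz: "h x \<mu> \<noteq> 0"
    have "indf h {x}"
    proof (rule indfI)
      fix \<beta> b assume z: "\<And>i. (\<Sum>b\<in>{x}. \<beta> b * h b i) = 0" and "b \<in> {x}"
      then show "\<beta> b = 0" using z[of \<mu>] nz by simp
    qed simp
    then show False using rk_ge[OF rvec_bd[OF rvec_h] subset_UNIV, of "{x}"] r0 by simp
  qed
  have "A x w = 0" for x w
  proof -
    let ?s = "\<lambda>x t j. x j + complex_of_real t * unit 0 j"
    let ?i = "\<lambda>t. ip n (?s x t) (?s w t)"
    have rs: "rpoly (\<lambda>t. ?s x t j)" for x j by (intro rpoly_add rpoly_mult rpoly_const rpoly_id)
    have s0: "(\<Sum>j<n. f j * unit 0 j) = f 0" for f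
      using n2 by (subst sum.remove[of _ 0]) (auto simp: unit_def)
    have "?i t = ip n x w + of_real t * (x 0 + cnj (w 0)) + of_real t * of_real t" for t
    proof -
      have "?i t = (\<Sum>j<n. x j * cnj (w j) + (of_real t * (x j + cnj (w j)) + of_real t * of_real t) * unit 0 j)"
        unfolding ip_def by (intro sum.cong refl) (auto simp: unit_def algebra_simps)
      then show ?thesis unfolding sum.distrib s0 by (simp add: ip_def algebra_simps)
    qed
    note exp = this
    \<comment> \<open>The second difference of the inner product in \<open>t\<close> is 2, so it is
      nonzero at one of 1, -1 and 0.\<close>
    have nz: "a \<noteq> 0 \<or> b \<noteq> 0 \<or> c \<noteq> 0" if "a + b - 2 * c = 2" for a b c :: complex
      using that by auto
    from exp[of 1] exp[of "- 1"] exp[of 0] have "?i 1 + ?i (- 1) - 2 * ?i 0 = 2" by simp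
    then have "?i 1 \<noteq> 0 \<or> ?i (- 1) \<noteq> 0 \<or> ?i 0 \<noteq> 0" by (rule nz)
    then obtain t where "?i t \<noteq> 0" by blast
    then have "finite {t. ?i t = 0}" by (rule rpoly_finite[OF rpoly_ip[OF rs rs]])
    moreover have "?i t * A (?s x t) (?s w t) = 0" for t
      using h_A[of "?s x t" "?s w t"] hz by simp
    ultimately have "finite {t. A (?s x t) (?s w t) \<noteq> 0}" by (elim rev_finite_subset) auto
    then have "A (?s x 0) (?s w 0) = 0" by (intro rpoly_zero rpoly_A rs)
    then show ?thesis by simp
  qed
  then show False using assms by (simp add: psd_def Q_def)
qed

lemma non_psd_bound:
  assumes np: "\<not> psd" and n: "\<kappa> choose 2 < n" "1 \<le> \<kappa>"
  shows "n * \<kappa> \<le> rk h UNIV + (\<kappa> choose 2) + 1"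
  unfolding mr_n(1)[symmetric]
proof (rule growth_count[where R = "mr h"])
  have a: "\<kappa> + 1 \<le> rk k UNIV" by (rule rank_k_large[OF np n(1)])
  have "\<exists>q. \<not> rk (\<lambda>c. k (pt 2 q c)) UNIV \<le> 2"
  proof (rule ccontr)
    assume "\<nexists>q. \<not> rk (\<lambda>c. k (pt 2 q c)) UNIV \<le> 2"
    then have "rk (\<lambda>c. k (pt 2 q c)) UNIV \<le> 2" for q by simp
    then show False using psd_of_lines np by simp
  qed
  then obtain q where "\<not> rk (\<lambda>c. k (pt 2 q c)) UNIV \<le> 2" by (rule exE)
  then have q: "3 \<le> rk (\<lambda>c. k (pt 2 q c)) UNIV" by simp
  have km: "(if j = 1 then 1 else min (j + 1) (\<kappa> + 1)) \<le> mr k j" if "1 \<le> j" for j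
    using mr_ge_min[OF rvec_k, of 1] mr_ge_min_line[OF rvec_k q, of j] a that by auto
  have fk: "fcnt \<kappa> i \<le> (\<Sum>j=1..i. mr k j)" for i unfolding fcnt_def by (intro sum_mono km) simp
  show "(\<forall>i\<le>b. fcnt \<kappa> i \<le> mr h i) \<or> mr h (b - 1) + min (mr h (b + 1) - mr h b) b + 1 \<le> mr h b"
    if "1 \<le> b" "b < n" for b
    using growth_dichotomy[OF that] fk by (meson le_trans)
qed (use n2 n h_nonzero[OF np] mr_superadditive rank_growth[OF rvec_h] in auto)

text \<open>A rank of \<open>k\<close> below \<open>\<kappa>\<close> selects the interval. For
  larger ranks only \<open>\<kappa>\<close> of it is used, which gives one more than the required
  bound.\<close>

lemma psd_bound:
  assumes psd "\<kappa> \<le> n"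
  shows "n * \<kappa> \<le> rk h UNIV + (\<kappa> choose 2) \<or>
    (\<exists>a<\<kappa>. a * n \<le> rk h UNIV + (a choose 2) \<and> rk h UNIV \<le> a * n)"
proof -
  let ?a = "rk k UNIV"
  have low: "(\<Sum>i=1..n. min i b) \<le> rk h UNIV" if "b \<le> ?a" for b
  proof -
    have "(\<Sum>i=1..n. min i b) \<le> (\<Sum>i=1..n. mr k i)"
      by (rule sum_mono) (use mr_ge_min[OF rvec_k] that in \<open>meson le_trans min.mono order_refl\<close>)
    then show ?thesis using psd_rank_lower[OF assms(1)] by simp
  qed
  have eq: "n * b \<le> rk h UNIV + (b choose 2)" if "b \<le> ?a" for b
    using low[OF that] sum_min[of b n] by linarith
  show ?thesis
  proof (cases "?a < \<kappa>")
    case True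
    then show ?thesis using eq[of ?a] rank_upper by (auto simp: mult.commute)
  next
    case False
    then show ?thesis using eq[of \<kappa>] by simp
  qed
qed

end

section \<open>Polynomials as functions\<close>

lemma eval_hol_superset:
  assumes "finite U" "Poly_Mapping.keys f \<subseteq> U"
  shows "eval_hol f z = (\<Sum>\<alpha>\<in>U. Poly_Mapping.lookup f \<alpha> * eval_monom \<alpha> z)"
  unfolding eval_hol_def
  by (rule sum.mono_neutral_left) (use assms in \<open>auto simp: in_keys_iff\<close>)

lemma polyfun_monom: "polyfun (eval_monom \<alpha>)"
  unfolding eval_monom_def[abs_def] by (intro polyfun_prod polyfun_power polyfun.intros)

lemma polyfun_hol: "polyfun (eval_hol f)"
  unfolding eval_hol_def[abs_def] by (intro polyfun_sum polyfun.intros polyfun_monom)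

lemma eval_monom_cong:
  assumes "\<alpha> \<in> multi_indices n" "\<And>j. j < n \<Longrightarrow> x j = y j"
  shows "eval_monom \<alpha> x = eval_monom \<alpha> y"
  unfolding eval_monom_def using assms by (intro prod.cong) (auto simp: multi_indices_def)

lemma eval_monom_scale:
  "eval_monom \<alpha> (z(j := s * z j)) = s ^ Poly_Mapping.lookup \<alpha> j * eval_monom \<alpha> z"
proof -
  let ?S = "insert j (Poly_Mapping.keys \<alpha>)"
  have "eval_monom \<alpha> (z(j := s * z j)) = (\<Prod>i\<in>?S. (if i = j then s ^ Poly_Mapping.lookup \<alpha> j else 1) * z i ^ Poly_Mapping.lookup \<alpha> i)"
    unfolding eval_monom_superset[of ?S \<alpha>, OF _ subset_insertI, simplified]
    by (intro prod.cong) (auto simp: power_mult_distrib)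
  also have "\<dots> = s ^ Poly_Mapping.lookup \<alpha> j * eval_monom \<alpha> z"
    unfolding prod.distrib eval_monom_superset[of ?S \<alpha> z, OF _ subset_insertI, simplified]
    by simp
  finally show ?thesis .
qed

text \<open>Distinct monomials are distinguished by doubling one coordinate of the point.\<close>

lemma monomials_independent:
  assumes "finite U" "\<And>z. (\<Sum>\<alpha>\<in>U. c \<alpha> * eval_monom \<alpha> z) = 0" "\<alpha> \<in> U"
  shows "c \<alpha> = 0"
  using assms
proof (induction U arbitrary: c \<alpha> rule: finite_induct)
  case (insert a U)
  have U: "c \<alpha> = 0" if \<alpha>: "\<alpha> \<in> U" for \<alpha>
  proof -
    have "Poly_Mapping.lookup a \<noteq> Poly_Mapping.lookup \<alpha>" using \<alpha> insert.hyps(2) by (auto simp: lookup_inject)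
    then obtain j where j: "Poly_Mapping.lookup a j \<noteq> Poly_Mapping.lookup \<alpha> j" by (auto simp: fun_eq_iff)
    let ?c = "\<lambda>\<alpha>. c \<alpha> * (2 ^ Poly_Mapping.lookup \<alpha> j - 2 ^ Poly_Mapping.lookup a j)"
    have "(\<Sum>\<alpha>\<in>U. ?c \<alpha> * eval_monom \<alpha> z) = 0" for z
    proof -
      have "(\<Sum>\<alpha>\<in>U. ?c \<alpha> * eval_monom \<alpha> z) = (\<Sum>\<alpha>\<in>insert a U. ?c \<alpha> * eval_monom \<alpha> z)"
        using insert.hyps by simp
      also have "\<dots> = (\<Sum>\<alpha>\<in>insert a U. c \<alpha> * eval_monom \<alpha> (z(j := 2 * z j)))
          - 2 ^ Poly_Mapping.lookup a j * (\<Sum>\<alpha>\<in>insert a U. c \<alpha> * eval_monom \<alpha> z)"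
        unfolding eval_monom_scale sum_distrib_left sum_subtractf[symmetric]
        by (intro sum.cong refl) (simp add: algebra_simps)
      also have "\<dots> = 0" unfolding insert.prems(1) by simp
      finally show ?thesis .
    qed
    then have "?c \<alpha> = 0" using \<alpha> by (rule insert.IH)
    moreover have "(2 :: complex) ^ Poly_Mapping.lookup \<alpha> j \<noteq> 2 ^ Poly_Mapping.lookup a j"
    proof
      assume "(2 :: complex) ^ Poly_Mapping.lookup \<alpha> j = 2 ^ Poly_Mapping.lookup a j"
      then have "(of_nat (2 ^ Poly_Mapping.lookup \<alpha> j) :: complex) = of_nat (2 ^ Poly_Mapping.lookup a j)" by simp
      then have "(2 :: nat) ^ Poly_Mapping.lookup \<alpha> j = 2 ^ Poly_Mapping.lookup a j" by (simp only: of_nat_eq_iff)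
      then show False using j by simp
    qed
    ultimately show ?thesis by simp
  qed
  moreover have "c a = 0"
  proof -
    have "(\<Sum>\<alpha>\<in>insert a U. c \<alpha> * eval_monom \<alpha> (\<lambda>_. 1)) = 0" by (rule insert.prems)
    moreover have "(\<Sum>\<alpha>\<in>U. c \<alpha> * eval_monom \<alpha> (\<lambda>_. 1)) = 0" using U by simp
    ultimately show ?thesis using insert.hyps by (simp add: eval_monom_def)
  qed
  ultimately show ?case using insert.prems by blast
qed simp

text \<open>A substitute for being polynomial in \<open>x\<close> and in the conjugate of
  \<open>w\<close>: on these pairs the two conjugations of \<open>\<tau>\<close> cancel and the
  value is polynomial in \<open>\<tau>\<close>.\<close>

definition sesqui :: "((nat \<Rightarrow> complex) \<Rightarrow> (nat \<Rightarrow> complex) \<Rightarrow> complex) \<Rightarrow> bool" where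
  "sesqui F \<longleftrightarrow> (\<forall>u e. \<exists>R. \<forall>\<tau>. F (\<lambda>j. u j + \<tau> * e j) (\<lambda>j. u j + cnj \<tau> * e j) = poly R \<tau>)"

lemma sesqui_left: "polyfun f \<Longrightarrow> sesqui (\<lambda>x w. f x)"
  unfolding sesqui_def using polyfun_jpoly(1) by metis

lemma sesqui_right:
  assumes "polyfun f"
  shows "sesqui (\<lambda>x w. cnj (f w))"
  unfolding sesqui_def
proof (intro allI)
  fix u e :: "nat \<Rightarrow> complex"
  have "cnj (f (\<lambda>j. u j + cnj \<tau> * e j)) = poly (map_poly cnj (jpoly f u e)) \<tau>" for \<tau>
    using polyfun_jpoly(1)[OF assms, of u e "cnj \<tau>"] complex_cnj_cnj poly_cnj by metis
  then show "\<exists>R. \<forall>\<tau>. cnj (f (\<lambda>j. u j + cnj \<tau> * e j)) = poly R \<tau>" by blast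
qed

lemma sesqui_mult: "sesqui F \<Longrightarrow> sesqui G \<Longrightarrow> sesqui (\<lambda>x w. F x w * G x w)"
  unfolding sesqui_def by (metis poly_mult)

lemma sesqui_diff: "sesqui F \<Longrightarrow> sesqui G \<Longrightarrow> sesqui (\<lambda>x w. F x w - G x w)"
  unfolding sesqui_def by (metis poly_diff)

lemma sesqui_sum:
  assumes "\<And>i. i \<in> I \<Longrightarrow> sesqui (F i)"
  shows "sesqui (\<lambda>x w. \<Sum>i\<in>I. F i x w)"
  unfolding sesqui_def
proof (intro allI)
  fix u e :: "nat \<Rightarrow> complex"
  have "\<forall>i\<in>I. \<exists>R. \<forall>\<tau>. F i (\<lambda>j. u j + \<tau> * e j) (\<lambda>j. u j + cnj \<tau> * e j) = poly R \<tau>"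
    using assms unfolding sesqui_def by blast
  then obtain R where R: "\<forall>i\<in>I. \<forall>\<tau>. F i (\<lambda>j. u j + \<tau> * e j) (\<lambda>j. u j + cnj \<tau> * e j) = poly (R i) \<tau>"
    by (rule bchoice[THEN exE])
  have "(\<Sum>i\<in>I. F i (\<lambda>j. u j + \<tau> * e j) (\<lambda>j. u j + cnj \<tau> * e j)) = poly (\<Sum>i\<in>I. R i) \<tau>" for \<tau>
    using R by (simp add: poly_sum)
  then show "\<exists>R. \<forall>\<tau>. (\<Sum>i\<in>I. F i (\<lambda>j. u j + \<tau> * e j) (\<lambda>j. u j + cnj \<tau> * e j)) = poly R \<tau>" by blast
qed

text \<open>With \<open>u = (x + w) / 2\<close> and \<open>e = (x - w) / (2 i)\<close>, the point \<open>(u + \<tau> e, u + cnj \<tau> e)\<close>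
  is diagonal for real \<open>\<tau>\<close> and equals \<open>(x, w)\<close> for \<open>\<tau> = i\<close>.\<close>

lemma sesqui_polarisation:
  assumes F: "sesqui F" and diag: "\<And>x. F x x = 0"
  shows "F x w = 0"
proof -
  define u where "u = (\<lambda>j. (x j + w j) / 2)"
  define e where "e = (\<lambda>j. (x j - w j) / (2 * \<i>))"
  obtain R where R: "\<And>\<tau>. F (\<lambda>j. u j + \<tau> * e j) (\<lambda>j. u j + cnj \<tau> * e j) = poly R \<tau>"
    using F unfolding sesqui_def by blast
  have "poly R (of_real t) = 0" for t :: real
    using R[of "of_real t"] diag by simp
  then have "range complex_of_real \<subseteq> {\<tau>. poly R \<tau> = 0}" by auto
  moreover have "infinite (range complex_of_real)"
    using infinite_UNIV_char_0[where 'a = real] by (simp add: finite_image_iff inj_of_real)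
  ultimately have "R = 0" using poly_roots_finite[of R] finite_subset by blast
  moreover have "(\<lambda>j. u j + \<i> * e j) = x" "(\<lambda>j. u j + cnj \<i> * e j) = w"
    by (auto simp: u_def e_def fun_eq_iff field_simps)
  ultimately show ?thesis using R[of "\<i>"] by simp
qed

section \<open>The rank of a sum of squares\<close>

lemma hrank_eq_rk:
  assumes "bd (coeff_column B)"
  shows "hrank B = rk (coeff_column B) UNIV"
proof -
  let ?c = "coeff_column B"
  have cs: "cscale = fscale" by (simp add: cscale_def fscale_def fun_eq_iff)
  obtain F where F: "F \<subseteq> UNIV" "indf ?c F" "card F = rk ?c UNIV" using rk_witness[OF assms] .
  have "fv.dim (range ?c) = card (?c ` F)"
    by (rule fv.dim_unique[OF _ _ indf_independent[OF F(2)]]) (use rk_span[OF assms F] in auto)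
  then show ?thesis unfolding hrank_def cs using indf_inj[OF F(2)] F(3) by (simp add: card_image)
qed

text \<open>Polarisation frees the identity from the diagonal; coefficients are then compared first
  in \<open>x\<close> and afterwards, conjugated, in \<open>w\<close>.\<close>

lemma sos_coefficients:
  fixes f :: "nat \<Rightarrow> hol_poly"
  assumes eq: "\<And>z. eval_bi B z = of_real (\<Sum>\<mu><N. (cmod (eval_hol (f \<mu>) z))\<^sup>2)"
  shows "Poly_Mapping.lookup B (\<alpha>, \<beta>) = (\<Sum>\<mu><N. Poly_Mapping.lookup (f \<mu>) \<alpha> * cnj (Poly_Mapping.lookup (f \<mu>) \<beta>))"
proof -
  define U where "U = {\<alpha>, \<beta>} \<union> fst ` Poly_Mapping.keys B \<union> snd ` Poly_Mapping.keys B \<union> (\<Union>\<mu><N. Poly_Mapping.keys (f \<mu>))"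
  have finU: "finite U" by (simp add: U_def)
  let ?M = "\<lambda>\<alpha> \<beta>. \<Sum>\<mu><N. Poly_Mapping.lookup (f \<mu>) \<alpha> * cnj (Poly_Mapping.lookup (f \<mu>) \<beta>)"
  let ?D = "\<lambda>\<alpha> \<beta>. Poly_Mapping.lookup B (\<alpha>, \<beta>) - ?M \<alpha> \<beta>"
  let ?F = "\<lambda>x w. \<Sum>\<alpha>\<in>U. \<Sum>\<beta>\<in>U. ?D \<alpha> \<beta> * eval_monom \<alpha> x * cnj (eval_monom \<beta> w)"
  have "sesqui ?F"
    by (intro sesqui_sum sesqui_mult[OF sesqui_mult] sesqui_left sesqui_right polyfun_monom polyfun.polyfun_const)
  moreover have "?F x x = 0" for x
  proof -
    have "eval_bi B x = (\<Sum>(\<alpha>, \<beta>)\<in>U \<times> U. Poly_Mapping.lookup B (\<alpha>, \<beta>) * eval_monom \<alpha> x * cnj (eval_monom \<beta> x))"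
      using finU by (intro eval_bi_superset) (force simp: U_def)+
    then have b: "eval_bi B x = (\<Sum>\<alpha>\<in>U. \<Sum>\<beta>\<in>U. Poly_Mapping.lookup B (\<alpha>, \<beta>) * eval_monom \<alpha> x * cnj (eval_monom \<beta> x))"
      by (simp add: sum.cartesian_product)
    have hol: "eval_hol (f \<mu>) x = (\<Sum>\<alpha>\<in>U. Poly_Mapping.lookup (f \<mu>) \<alpha> * eval_monom \<alpha> x)" if "\<mu> < N" for \<mu>
      using finU that by (intro eval_hol_superset) (auto simp: U_def)
    have "of_real (\<Sum>\<mu><N. (cmod (eval_hol (f \<mu>) x))\<^sup>2) = (\<Sum>\<mu><N. eval_hol (f \<mu>) x * cnj (eval_hol (f \<mu>) x))"
      unfolding of_real_sum complex_norm_square ..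
    also have "\<dots> = (\<Sum>\<mu><N. \<Sum>\<alpha>\<in>U. \<Sum>\<beta>\<in>U. Poly_Mapping.lookup (f \<mu>) \<alpha> * cnj (Poly_Mapping.lookup (f \<mu>) \<beta>) * eval_monom \<alpha> x * cnj (eval_monom \<beta> x))"
      by (intro sum.cong refl) (simp add: hol sum_product mult_ac)
    also have "\<dots> = (\<Sum>\<alpha>\<in>U. \<Sum>\<mu><N. \<Sum>\<beta>\<in>U. Poly_Mapping.lookup (f \<mu>) \<alpha> * cnj (Poly_Mapping.lookup (f \<mu>) \<beta>) * eval_monom \<alpha> x * cnj (eval_monom \<beta> x))"
      by (rule sum.swap)
    also have "\<dots> = (\<Sum>\<alpha>\<in>U. \<Sum>\<beta>\<in>U. \<Sum>\<mu><N. Poly_Mapping.lookup (f \<mu>) \<alpha> * cnj (Poly_Mapping.lookup (f \<mu>) \<beta>) * eval_monom \<alpha> x * cnj (eval_monom \<beta> x))"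
      by (intro sum.cong refl sum.swap)
    also have "\<dots> = (\<Sum>\<alpha>\<in>U. \<Sum>\<beta>\<in>U. ?M \<alpha> \<beta> * eval_monom \<alpha> x * cnj (eval_monom \<beta> x))"
      by (simp add: sum_distrib_right)
    finally show ?thesis using b eq[of x] by (simp add: left_diff_distrib sum_subtractf)
  qed
  ultimately have z: "?F x w = 0" for x w by (rule sesqui_polarisation[where F = ?F])
  have "(\<Sum>\<beta>\<in>U. ?D \<alpha> \<beta> * cnj (eval_monom \<beta> w)) = 0" for w
  proof (rule monomials_independent[OF finU, of "\<lambda>\<alpha>. \<Sum>\<beta>\<in>U. ?D \<alpha> \<beta> * cnj (eval_monom \<beta> w)"])
    show "(\<Sum>\<alpha>\<in>U. (\<Sum>\<beta>\<in>U. ?D \<alpha> \<beta> * cnj (eval_monom \<beta> w)) * eval_monom \<alpha> x) = 0" for x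
      by (rule trans[OF _ z[of x w]], unfold sum_distrib_right, intro sum.cong refl) (simp only: mult_ac)
  qed (simp add: U_def)
  then have "cnj (\<Sum>\<beta>\<in>U. ?D \<alpha> \<beta> * cnj (eval_monom \<beta> w)) = 0" for w by (simp only: complex_cnj_zero)
  then have "(\<Sum>\<beta>\<in>U. cnj (?D \<alpha> \<beta>) * eval_monom \<beta> w) = 0" for w
    by (simp only: cnj_sum complex_cnj_mult complex_cnj_cnj)
  then have "cnj (?D \<alpha> \<beta>) = 0"
    by (rule monomials_independent[OF finU, of "\<lambda>\<beta>. cnj (?D \<alpha> \<beta>)"]) (simp add: U_def)
  then show ?thesis by (simp only: complex_cnj_zero_iff right_minus_eq)
qed

text \<open>The coefficient matrix is the product of the matrix with rows \<open>g \<alpha>\<close>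
  and its adjoint, so the two have the same rank. As monomials are independent, the vectors
  \<open>g \<beta>\<close> and the values of the map span the same space.\<close>

lemma hrank_sos:
  fixes f :: "nat \<Rightarrow> hol_poly"
  assumes eq: "\<And>z. eval_bi B z = of_real (\<Sum>\<mu><N. (cmod (eval_hol (f \<mu>) z))\<^sup>2)"
    and f0: "\<And>\<mu>. N \<le> \<mu> \<Longrightarrow> f \<mu> = 0"
  shows "hrank B = rk (\<lambda>x \<mu>. eval_hol (f \<mu>) x) UNIV"
proof -
  let ?h = "\<lambda>x \<mu>. eval_hol (f \<mu>) x"
  define g where "g \<beta> \<mu> = Poly_Mapping.lookup (f \<mu>) \<beta>" for \<beta> \<mu>
  define U where "U = (\<Union>\<mu><N. Poly_Mapping.keys (f \<mu>))"
  have finU: "finite U" by (simp add: U_def)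
  have U: "Poly_Mapping.keys (f \<mu>) \<subseteq> U" for \<mu> using f0[of \<mu>] by (cases "\<mu> < N") (auto simp: U_def)
  have hol: "eval_hol (f \<mu>) x = (\<Sum>\<beta>\<in>U. eval_monom \<beta> x * g \<beta> \<mu>)" for \<mu> x
    unfolding eval_hol_superset[OF finU U] g_def by (simp add: mult.commute)
  have col: "coeff_column B \<beta> \<alpha> = (\<Sum>\<mu><N. g \<alpha> \<mu> * cnj (g \<beta> \<mu>))" for \<alpha> \<beta>
    unfolding coeff_column_def g_def by (rule sos_coefficients[OF eq])
  have bdg: "bd g" unfolding bd_def g_def by (intro exI[of _ "{..<N}"]) (auto simp: f0 not_less)
  have bdh: "bd ?h" unfolding bd_def by (intro exI[of _ "{..<N}"]) (auto simp: f0 not_less eval_hol_def)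
  have gU: "g \<alpha> \<mu> = 0" if "\<alpha> \<notin> U" for \<alpha> \<mu>
    using U[of \<mu>] that by (auto simp: g_def in_keys_iff)
  have bdc: "bd (coeff_column B)"
    unfolding bd_def col using gU finU by (intro exI[of _ U]) auto
  have scol: "(\<Sum>\<beta>\<in>F. c \<beta> * coeff_column B \<beta> \<alpha>) = (\<Sum>\<mu><N. g \<alpha> \<mu> * cnj (\<Sum>\<beta>\<in>F. cnj (c \<beta>) * g \<beta> \<mu>))" for F c \<alpha>
    unfolding col by (simp add: sum_distrib_left mult_ac) (rule sum.swap)
  have "rk (coeff_column B) UNIV \<le> rk g UNIV"
  proof -
    obtain F where F: "F \<subseteq> UNIV" "indf (coeff_column B) F" "card F = rk (coeff_column B) UNIV"
      using rk_witness[OF bdc] .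
    have "indf g F"
    proof (rule indfI[OF indf_finite[OF F(2)]])
      fix c \<beta> assume z: "\<And>\<mu>. (\<Sum>\<beta>\<in>F. c \<beta> * g \<beta> \<mu>) = 0" and \<beta>: "\<beta> \<in> F"
      have "(\<Sum>\<beta>\<in>F. cnj (c \<beta>) * coeff_column B \<beta> \<alpha>) = 0" for \<alpha> unfolding scol by (simp add: z)
      then have "cnj (c \<beta>) = 0" by (rule indfD[OF F(2), of "\<lambda>\<beta>. cnj (c \<beta>)", OF _ \<beta>])
      then show "c \<beta> = 0" by simp
    qed
    then show ?thesis using rk_ge[OF bdg subset_UNIV] F(3) by metis
  qed
  moreover have "rk g UNIV \<le> rk (coeff_column B) UNIV"
  proof -
    obtain F where F: "F \<subseteq> UNIV" "indf g F" "card F = rk g UNIV" using rk_witness[OF bdg] .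
    have "indf (coeff_column B) F"
    proof (rule indfI[OF indf_finite[OF F(2)]])
      fix c \<beta> assume z: "\<And>\<alpha>. (\<Sum>\<beta>\<in>F. c \<beta> * coeff_column B \<beta> \<alpha>) = 0" and \<beta>: "\<beta> \<in> F"
      \<comment> \<open>\<open>y\<close> is orthogonal to every \<open>g \<alpha>\<close>; being a
        combination of them, it is orthogonal to itself.\<close>
      define y where "y \<mu> = (\<Sum>\<beta>\<in>F. cnj (c \<beta>) * g \<beta> \<mu>)" for \<mu>
      have y0: "(\<Sum>\<mu><N. g \<alpha> \<mu> * cnj (y \<mu>)) = 0" for \<alpha> using z[of \<alpha>] unfolding scol y_def .
      have "(\<Sum>\<mu><N. y \<mu> * cnj (y \<mu>)) = (\<Sum>\<mu><N. \<Sum>\<alpha>\<in>F. cnj (c \<alpha>) * (g \<alpha> \<mu> * cnj (y \<mu>)))"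
        unfolding y_def by (simp add: sum_distrib_right mult.assoc)
      also have "\<dots> = (\<Sum>\<alpha>\<in>F. cnj (c \<alpha>) * (\<Sum>\<mu><N. g \<alpha> \<mu> * cnj (y \<mu>)))"
        by (subst sum.swap) (simp add: sum_distrib_left)
      also have "\<dots> = 0" by (simp add: y0)
      finally have "complex_of_real (\<Sum>\<mu><N. (cmod (y \<mu>))\<^sup>2) = 0"
        unfolding of_real_sum complex_norm_square .
      then have "(\<Sum>\<mu><N. (cmod (y \<mu>))\<^sup>2) = 0" by (simp only: of_real_eq_0_iff)
      then have "y \<mu> = 0" if "\<mu> < N" for \<mu> using that by (subst (asm) sum_nonneg_eq_0_iff) auto
      moreover have "y \<mu> = 0" if "\<not> \<mu> < N" for \<mu> using that f0[of \<mu>] by (simp add: y_def g_def)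
      ultimately have "y \<mu> = 0" for \<mu> by blast
      then have "cnj (c \<beta>) = 0" unfolding y_def by (rule indfD[OF F(2), of "\<lambda>\<beta>. cnj (c \<beta>)", OF _ \<beta>])
      then show "c \<beta> = 0" by simp
    qed
    then show ?thesis using rk_ge[OF bdc subset_UNIV] F(3) by metis
  qed
  moreover have "rk ?h UNIV \<le> rk g UNIV"
    by (rule rk_le_span[OF bdg bdh], rule span_famI[OF finU subset_UNIV]) (rule hol)
  moreover have "rk g UNIV \<le> rk ?h UNIV"
  proof (rule rk_le_span[OF bdh bdg], rule ccontr)
    fix \<beta> assume "g \<beta> \<notin> fv.span (range ?h)"
    then obtain J l where l: "\<forall>x\<in>UNIV. (\<Sum>i\<in>J. l i * ?h x i) = 0" "(\<Sum>i\<in>J. l i * g \<beta> i) = 1"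
      using separating_functional[OF bdh, of "g \<beta>" UNIV] by blast
    have "(\<Sum>\<beta>\<in>U. (\<Sum>i\<in>J. l i * g \<beta> i) * eval_monom \<beta> x) = 0" for x
    proof -
      have "(\<Sum>\<beta>\<in>U. (\<Sum>i\<in>J. l i * g \<beta> i) * eval_monom \<beta> x) = (\<Sum>i\<in>J. l i * ?h x i)"
        unfolding hol by (simp add: sum_distrib_left sum_distrib_right mult_ac) (rule sum.swap)
      then show ?thesis using l(1) by simp
    qed
    then have "(\<Sum>i\<in>J. l i * g \<beta> i) = 0" if "\<beta> \<in> U"
      using that by (intro monomials_independent[OF finU, of "\<lambda>\<beta>. \<Sum>i\<in>J. l i * g \<beta> i"])
    moreover have "(\<Sum>i\<in>J. l i * g \<beta> i) = 0" if "\<beta> \<notin> U" using gU[OF that] by simp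
    ultimately show False using l(2) by auto
  qed
  ultimately show ?thesis using hrank_eq_rk[OF bdc] by simp
qed

section \<open>The gap theorem\<close>

lemma sos_orth_map:
  fixes f :: "nat \<Rightarrow> hol_poly"
  assumes n: "2 \<le> n" and A: "A \<in> hermitian_polys n"
    and f: "\<And>\<mu>. f \<mu> \<in> hol_polys n" "\<And>\<mu>. N \<le> \<mu> \<Longrightarrow> f \<mu> = 0"
    and eq: "\<And>z. eval_bi (A * norm_sq_poly n) z = of_real (\<Sum>\<mu><N. (cmod (eval_hol (f \<mu>) z))\<^sup>2)"
  shows "\<exists>k (v :: _ \<Rightarrow> multi_index \<Rightarrow> complex) S B. orth_map n N (\<lambda>x \<mu>. eval_hol (f \<mu>) x) k v S B"
proof -
  define S where "S = fst ` Poly_Mapping.keys A \<union> snd ` Poly_Mapping.keys A"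
  define k where "k x \<beta> = (\<Sum>\<alpha>\<in>S. Poly_Mapping.lookup A (\<alpha>, \<beta>) * eval_monom \<alpha> x)" for x \<beta>
  define v where "v w \<beta> = eval_monom \<beta> w" for w :: "nat \<Rightarrow> complex" and \<beta>
  define B where "B x w = (\<Sum>\<beta>\<in>S. k x \<beta> * cnj (v w \<beta>))" for x w
  have finS: "finite S" by (simp add: S_def)
  have Sn: "S \<subseteq> multi_indices n" using A unfolding hermitian_polys_def S_def by auto
  have herm: "Poly_Mapping.lookup A (\<beta>, \<alpha>) = cnj (Poly_Mapping.lookup A (\<alpha>, \<beta>))" for \<alpha> \<beta>
    using A unfolding hermitian_polys_def by blast
  have diag: "B x x = eval_bi A x" for x
  proof -
    have "eval_bi A x = (\<Sum>(\<alpha>, \<beta>)\<in>S \<times> S. Poly_Mapping.lookup A (\<alpha>, \<beta>) * eval_monom \<alpha> x * cnj (eval_monom \<beta> x))"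
      using finS by (intro eval_bi_superset) (force simp: S_def)+
    also have "\<dots> = (\<Sum>\<alpha>\<in>S. \<Sum>\<beta>\<in>S. Poly_Mapping.lookup A (\<alpha>, \<beta>) * eval_monom \<alpha> x * cnj (eval_monom \<beta> x))"
      by (simp add: sum.cartesian_product)
    also have "\<dots> = B x x"
      unfolding B_def k_def v_def sum_distrib_right by (rule sum.swap)
    finally show ?thesis ..
  qed
  have pk: "polyfun (\<lambda>x. k x \<beta>)" and pv: "polyfun (\<lambda>x. v x \<beta>)" for \<beta>
    unfolding k_def v_def by (intro polyfun_sum polyfun.intros polyfun_monom)+
  have orth: "(\<Sum>\<mu><N. eval_hol (f \<mu>) x * cnj (eval_hol (f \<mu>) w)) = ip n x w * B x w" for x w
  proof -
    let ?F = "\<lambda>x w. (\<Sum>\<mu><N. eval_hol (f \<mu>) x * cnj (eval_hol (f \<mu>) w)) - ip n x w * B x w"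
    have "sesqui ?F" unfolding ip_def B_def
      by (intro sesqui_diff sesqui_mult sesqui_sum sesqui_left sesqui_right polyfun_hol pk pv polyfun.polyfun_coord)
    moreover have "?F x x = 0" for x
    proof -
      have "(\<Sum>\<mu><N. eval_hol (f \<mu>) x * cnj (eval_hol (f \<mu>) x)) = eval_bi (A * norm_sq_poly n) x"
        unfolding eq of_real_sum complex_norm_square ..
      moreover have "ip n x x = eval_bi (norm_sq_poly n) x"
        unfolding eval_bi_norm_sq ip_def of_real_sum complex_norm_square ..
      ultimately show ?thesis by (simp add: eval_bi_mult diag)
    qed
    ultimately have "?F x w = 0" by (rule sesqui_polarisation[where F = ?F])
    then show ?thesis by simp
  qed
  have "orth_map n N (\<lambda>x \<mu>. eval_hol (f \<mu>) x) k v S B"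
  proof
    show "eval_hol (f \<mu>) x = 0" if "N \<le> \<mu>" for \<mu> x using f(2)[OF that] by (simp add: eval_hol_def)
    show "k x \<beta> = 0" if "\<beta> \<notin> S" for x \<beta>
    proof -
      have "Poly_Mapping.lookup A (\<alpha>, \<beta>) = 0" for \<alpha>
        using that unfolding S_def by (metis UnI2 image_eqI in_keys_iff snd_conv)
      then show ?thesis by (simp add: k_def)
    qed
    show "(\<lambda>\<mu>. eval_hol (f \<mu>) x) = (\<lambda>\<mu>. eval_hol (f \<mu>) y)" if "\<And>j. j < n \<Longrightarrow> x j = y j" for x y
    proof (rule ext)
      fix \<mu>
      have "Poly_Mapping.keys (f \<mu>) \<subseteq> multi_indices n" using f(1) by (simp add: hol_polys_def)
      then have "eval_monom \<alpha> x = eval_monom \<alpha> y" if "\<alpha> \<in> Poly_Mapping.keys (f \<mu>)" for \<alpha>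
        using that by (intro eval_monom_cong[of _ n] \<open>\<And>j. j < n \<Longrightarrow> x j = y j\<close>) auto
      then show "eval_hol (f \<mu>) x = eval_hol (f \<mu>) y" unfolding eval_hol_def by simp
    qed
    show "k x = k y" if "\<And>j. j < n \<Longrightarrow> x j = y j" for x y
      unfolding k_def using Sn eval_monom_cong[of _ n x y, OF _ that] by (intro ext sum.cong refl) auto
    show "c \<beta> = 0" if z: "\<And>w. (\<Sum>\<beta>\<in>S. c \<beta> * cnj (v w \<beta>)) = 0" and \<beta>: "\<beta> \<in> S" for c \<beta>
    proof -
      have "(\<Sum>\<beta>\<in>S. cnj (c \<beta>) * eval_monom \<beta> w) = 0" for w
        using arg_cong[OF z[of w], of cnj] by (simp add: v_def)
      then have "cnj (c \<beta>) = 0" by (rule monomials_independent[OF finS, of "\<lambda>\<beta>. cnj (c \<beta>)", OF _ \<beta>])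
      then show ?thesis by simp
    qed
    show "B w x = cnj (B x w)" for x w
    proof -
      have "cnj (B x w) = (\<Sum>\<beta>\<in>S. \<Sum>\<alpha>\<in>S. Poly_Mapping.lookup A (\<beta>, \<alpha>) * eval_monom \<beta> w * cnj (eval_monom \<alpha> x))"
        unfolding B_def k_def v_def sum_distrib_right by (simp add: herm[symmetric] mult_ac)
      also have "\<dots> = B w x"
        unfolding B_def k_def v_def sum_distrib_right by (rule sum.swap)
      finally show ?thesis ..
    qed
  qed (use n finS pk pv B_def orth polyfun_hol in auto)
  then show ?thesis by blast
qed

lemma choose_two_real: "real (k choose 2) = real k * (real k - 1) / 2"
  by (induction k) (simp_all add: numeral_2_eq_2 field_simps)

theorem theorem1p5:
  fixes n \<kappa> \<rho> :: nat and \<Lambda> :: int and A :: bi_poly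
  assumes "n \<ge> 2"
    and "\<kappa> choose 2 < n" and "n \<le> (\<kappa> + 1) choose 2"
    and "\<Lambda> = int n * int \<kappa> - int (\<kappa> choose 2) - 1"
    and "A \<in> hermitian_polys n"
    and "A * norm_sq_poly n \<in> SOS n"
    and "\<rho> = hrank (A * norm_sq_poly n)"
  shows "int \<rho> \<ge> \<Lambda> \<or>
    (\<exists>k\<in>{0..<\<kappa>}. real k * real n - real k * (real k - 1) / 2 \<le> real \<rho> \<and> \<rho> \<le> k * n)"
proof -
  obtain N f0 where f0: "\<forall>\<mu><N. f0 \<mu> \<in> hol_polys n"
    "\<forall>z. eval_bi (A * norm_sq_poly n) z = of_real (\<Sum>\<mu><(N::nat). (cmod (eval_hol (f0 \<mu>) z))\<^sup>2)"
    using assms(6) unfolding SOS_def by blast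
  \<comment> \<open>Padding by zero, as the components in \<open>orth_map\<close> are indexed by all
    natural numbers and vanish from \<open>N\<close> on.\<close>
  define f where "f \<mu> = (if \<mu> < N then f0 \<mu> else 0)" for \<mu>
  have f: "f \<mu> \<in> hol_polys n" "N \<le> \<mu> \<Longrightarrow> f \<mu> = 0" for \<mu>
    using f0(1) by (auto simp: f_def hol_polys_def)
  have eq: "eval_bi (A * norm_sq_poly n) z = of_real (\<Sum>\<mu><N. (cmod (eval_hol (f \<mu>) z))\<^sup>2)" for z
    using f0(2) by (simp add: f_def)
  obtain k v S B where "orth_map n N (\<lambda>x \<mu>. eval_hol (f \<mu>) x) k (v :: _ \<Rightarrow> multi_index \<Rightarrow> complex) S B"
    using sos_orth_map[OF assms(1,5) f eq] by blast
  then interpret orth_map n N "\<lambda>x \<mu>. eval_hol (f \<mu>) x" k v S B .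
  have r: "rk (\<lambda>x \<mu>. eval_hol (f \<mu>) x) UNIV = \<rho>"
    using hrank_sos[OF eq f(2)] assms(7) by simp
  have \<kappa>1: "1 \<le> \<kappa>" using assms(1,3) by (cases \<kappa>) (auto simp: numeral_2_eq_2)
  have \<kappa>n: "\<kappa> \<le> n"
  proof (cases "\<kappa> \<le> 2")
    case False
    then show ?thesis using assms(2) choose_two_pred[of \<kappa>] choose_two_pred[of "\<kappa> - 1"] by linarith
  qed (use assms(1) in simp)
  have "n * \<kappa> \<le> \<rho> + (\<kappa> choose 2) + 1 \<or> (\<exists>a<\<kappa>. a * n \<le> \<rho> + (a choose 2) \<and> \<rho> \<le> a * n)"
    using psd_bound[of \<kappa>, OF _ \<kappa>n] non_psd_bound[OF _ assms(2) \<kappa>1] unfolding r by fastforce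
  then show ?thesis
  proof (elim disjE exE conjE)
    assume "n * \<kappa> \<le> \<rho> + (\<kappa> choose 2) + 1"
    then have "int (n * \<kappa>) \<le> int (\<rho> + (\<kappa> choose 2) + 1)" by (simp only: of_nat_le_iff)
    then show ?thesis unfolding assms(4) by simp
  next
    fix a assume a: "a < \<kappa>" "a * n \<le> \<rho> + (a choose 2)" "\<rho> \<le> a * n"
    have "real (a * n) \<le> real (\<rho> + (a choose 2))" using a(2) by (simp only: of_nat_le_iff)
    then show ?thesis using a unfolding of_nat_add of_nat_mult choose_two_real
      by (intro disjI2 bexI[of _ a]) auto
  qed
qed

end
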